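(* Let $\Omega\subset\mathbb{R}^d$ be a bounded $C^2$ domain and let $\mu(dx)=\rho(x)\,dx$ be a probability measure on the compact set $\bar\Omega$ with Lebesgue density $\rho$ bounded above and below by positive constants on $\Omega$. Let $X_1,X_2,\dots$ be independent with law $\mu$, let $\kappa>0$, and let $(h_n)$ be a sequence of positive numbers with $h_n\to0$ and $nh_n^d/\log n\to\infty$. Then for every $T\in C^2(\bar\Omega;\mathbb{R}^m)$, $$\lim_{n\to\infty}\widehat{\mathrm{KL}}_n(T)=\mathcal{KL}(T)\qquad\text{almost surely.}$$
   Context: Set $\sigma_\kappa(x)=\frac{1}{\sqrt{2\pi e}}\left(\frac{\kappa}{\rho(x)}\right)^{1/d}$ and $\sigma_{i,n}=h_n\sigma_\kappa(X_i)$. For $T:\bar\Omega\to\mathbb{R}^m$ define $$\mathrm{A}_n[T]=\frac1n\sum_{i=1}^n\frac{\sum_{j=1}^n\exp\left(\frac{-|X_i-X_j|^2}{2\sigma_{i,n}^2}\right)\log\left(1+|T(X_i)-T(X_j)|^2\right)}{\sum_{j=1}^n\exp\left(\frac{-|X_i-X_j|^2}{2\sigma_{i,n}^2}\right)},$$ $$\mathrm{R}_n[T]=\log\left(\frac1{n^2}\sum_{i=1}^n\sum_{j=1}^n\frac{1}{1+|T(X_i)-T(X_j)|^2}\right),\qquad \widehat{\mathrm{KL}}_n(T)=\frac{\mathrm{A}_n[T]}{h_n^2}+\mathrm{R}_n[T],$$ and, writing $T=(T_1,\dots,T_m)$, $$\mathcal{KL}(T)=\frac{\kappa^{2/d}}{2\pi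 e}\int_\Omega\sum_{i=1}^m|\nabla T_i(x)|^2\rho^{1-2/d}(x)\,dx+\log\left(\int_\Omega\int_\Omega\frac{1}{1+|T(x)-T(x')|^2}\rho(x)\rho(x')\,dx\,dx'\right).$$ *)

theory Defs
  imports "HOL-Probability.Probability"
begin

text \<open>
  \<open>C2_closure U f\<close> is membership in \<open>C\<^sup>2(closure U)\<close>: \<open>f\<close> is continuous on the closure, twice
  differentiable in the open set \<open>U\<close>, and its first and second derivatives extend continuously
  to the closure (\<open>D\<close> and \<open>D2\<close> are the extensions). For \<open>U = UNIV\<close> this is the usual \<open>C\<^sup>2\<close>.
\<close>

definition C2_closure ::
  "'a::real_normed_vector set \<Rightarrow> ('a \<Rightarrow> 'b::real_normed_vector) \<Rightarrow> bool" where
  "C2_closure U f \<longleftrightarrow>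
     continuous_on (closure U) f \<and>
     (\<exists>(D :: 'a \<Rightarrow> 'a \<Rightarrow>\<^sub>L 'b) (D2 :: 'a \<Rightarrow> 'a \<Rightarrow>\<^sub>L 'a \<Rightarrow>\<^sub>L 'b).
        continuous_on (closure U) D \<and> continuous_on (closure U) D2 \<and>
        (\<forall>x\<in>U. (f has_derivative blinfun_apply (D x)) (at x) \<and>
               (D has_derivative blinfun_apply (D2 x)) (at x)))"

text \<open>
  A bounded domain is \<open>C\<^sup>2\<close> if near every boundary point, and in suitably rotated coordinates, it
  is the region above the graph of a \<open>C\<^sup>2\<close> function. The unit vector \<open>e\<close> is the vertical
  direction and \<open>x - (x \<bullet> e) *\<^sub>R e\<close> the projection of \<open>x\<close> to the hyperplane orthogonal to \<open>e\<close>;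
  only the restriction of \<open>\<gamma>\<close> to that hyperplane matters.
\<close>

definition bounded_C2_domain :: "'a::euclidean_space set \<Rightarrow> bool" where
  "bounded_C2_domain \<Omega> \<longleftrightarrow>
     open \<Omega> \<and> connected \<Omega> \<and> \<Omega> \<noteq> {} \<and> bounded \<Omega> \<and>
     (\<forall>p\<in>frontier \<Omega>. \<exists>r>0. \<exists>e. \<exists>\<gamma> :: 'a \<Rightarrow> real.
        norm e = 1 \<and> C2_closure UNIV \<gamma> \<and>
        \<Omega> \<inter> ball p r = {x \<in> ball p r. \<gamma> (x - (x \<bullet> e) *\<^sub>R e) < x \<bullet> e})"

definition gradient :: "('a::real_inner \<Rightarrow> real) \<Rightarrow> 'a \<Rightarrow> 'a" where
  "gradient f x = (THE D. GDERIV f x :> D)"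

definition sigma_kappa :: "real \<Rightarrow> (real^'d \<Rightarrow> real) \<Rightarrow> real^'d \<Rightarrow> real" where
  "sigma_kappa \<kappa> \<rho> x =
     1 / sqrt (2 * pi * exp 1) * (\<kappa> / \<rho> x) powr (1 / real CARD('d))"

definition gauss_weight ::
  "real \<Rightarrow> (real^'d \<Rightarrow> real) \<Rightarrow> real \<Rightarrow> real^'d \<Rightarrow> real^'d \<Rightarrow> real" where
  "gauss_weight \<kappa> \<rho> h x y = exp (- (norm (x - y))\<^sup>2 / (2 * (h * sigma_kappa \<kappa> \<rho> x)\<^sup>2))"

text \<open>
  In the empirical functionals \<open>h\<close> is the single bandwidth \<open>h\<^sub>n\<close> and \<open>x 1, \<dots>, x n\<close> are the
  sample points.
\<close>

definition A_emp ::
  "real \<Rightarrow> (real^'d \<Rightarrow> real) \<Rightarrow> real \<Rightarrow> (nat \<Rightarrow> real^'d) \<Rightarrow> nat \<Rightarrow> (real^'d \<Rightarrow> real^'m) \<Rightarrow> real" where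
  "A_emp \<kappa> \<rho> h x n T =
     1 / real n * (\<Sum>i=1..n.
       (\<Sum>j=1..n. gauss_weight \<kappa> \<rho> h (x i) (x j) * ln (1 + (norm (T (x i) - T (x j)))\<^sup>2)) /
       (\<Sum>j=1..n. gauss_weight \<kappa> \<rho> h (x i) (x j)))"

definition R_emp :: "(nat \<Rightarrow> real^'d) \<Rightarrow> nat \<Rightarrow> (real^'d \<Rightarrow> real^'m) \<Rightarrow> real" where
  "R_emp x n T =
     ln (1 / (real n)\<^sup>2 * (\<Sum>i=1..n. \<Sum>j=1..n. 1 / (1 + (norm (T (x i) - T (x j)))\<^sup>2)))"

definition KL_emp ::
  "real \<Rightarrow> (real^'d \<Rightarrow> real) \<Rightarrow> real \<Rightarrow> (nat \<Rightarrow> real^'d) \<Rightarrow> nat \<Rightarrow> (real^'d \<Rightarrow> real^'m) \<Rightarrow> real" where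
  "KL_emp \<kappa> \<rho> h x n T = A_emp \<kappa> \<rho> h x n T / h\<^sup>2 + R_emp x n T"

definition KL_lim ::
  "real \<Rightarrow> (real^'d) set \<Rightarrow> (real^'d \<Rightarrow> real) \<Rightarrow> (real^'d \<Rightarrow> real^'m) \<Rightarrow> real" where
  "KL_lim \<kappa> \<Omega> \<rho> T =
     \<kappa> powr (2 / real CARD('d)) / (2 * pi * exp 1) *
       (LINT x:\<Omega>|lborel. (\<Sum>i\<in>UNIV. (norm (gradient (\<lambda>y. T y $ i) x))\<^sup>2) *
          \<rho> x powr (1 - 2 / real CARD('d))) +
     ln (LINT x:\<Omega>|lborel. (LINT x':\<Omega>|lborel.
          1 / (1 + (norm (T x - T x'))\<^sup>2) * \<rho> x * \<rho> x'))"

end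

theory Submission
  imports Defs "HOL-Real_Asymp.Real_Asymp"
begin

text \<open>
  The quotient \<open>A\<^sub>n[T] / h\<^sub>n\<^sup>2\<close> is the mean over \<open>i\<close> of a ratio of two sums over \<open>j\<close>, with
  the Gaussian weight of bandwidth \<open>h\<^sub>n \<sigma>(X\<^sub>i)\<close> in both and the rescaled logarithm
  \<open>log(1 + |T(X\<^sub>i) - T(X\<^sub>j)|\<^sup>2) / h\<^sub>n\<^sup>2\<close> in the numerator. Its limit is found by separating fluctuation
  from bias.

  \<^item> Fluctuation. Given \<open>X\<^sub>i = x\<close>, each of the two sums has independent, bounded, nonnegative terms
  with mean of order \<open>h\<^sub>n\<^sup>d\<close>. A Chernoff bound whose exponent is proportional to the mean makes
  a relative error above \<open>\<epsilon>\<close> have probability of order \<open>exp(-c n h\<^sub>n\<^sup>d)\<close>. Because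
  \<open>n h\<^sub>n\<^sup>d / log n \<rightarrow> \<infinity>\<close>, this beats every power of \<open>n\<close>, so a union bound over \<open>i \<le> n\<close> and
  the Borel-Cantelli lemma give almost sure convergence uniformly in \<open>i\<close>
  (\<open>uniform_empirical_average\<close>). With means of order \<open>1\<close> the same theorem is a law of large numbers
  for triangular arrays and for the double sum in \<open>R\<^sub>n\<close>.

  \<^item> Bias. Substituting \<open>y = x + h z\<close>, the means of the two sums become, up to the common factor
  \<open>h\<^sup>d\<close>, the Gaussian integrals \<open>moment h x\<close> and \<open>mass h x\<close>. If \<open>\<rho>\<close> were continuous, their ratio
  would tend pointwise to \<open>\<sigma>\<^sup>2 |DT|\<^sup>2\<close>, since the Gaussian has covariance \<open>\<sigma>\<^sup>2\<close> times the
  identity. For a density that is only bounded and measurable, the error splits into a part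
  governed by \<open>\<rho>(x + h z) - \<rho>(x)\<close>, which vanishes in the mean by continuity of translations in
  \<open>L\<^sup>1\<close>, and a part that compares \<open>log(1 + |T(x) - T(x + h z)|\<^sup>2) / h\<^sup>2\<close> with \<open>|DT(x) z|\<^sup>2\<close>,
  which vanishes pointwise and boundedly (\<open>numerator_error\<close>, \<open>mean_ratio_tendsto\<close>). Finally
  \<open>\<sigma>\<^sup>2 \<rho>\<close> is \<open>\<kappa>\<close> to the power \<open>2/d\<close> over \<open>2 \<pi> e\<close>, times \<open>\<rho>\<close> to the power \<open>1 - 2/d\<close>.

  The regularity of the boundary is used in the form of a uniform interior cone condition
  (\<open>uniform_cone\<close>). It keeps \<open>mass\<close> away from \<open>0\<close> up to the boundary, it makes \<open>T\<close> Lipschitz on a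
  domain that need not be convex, and it forces the boundary to be a null set, so that almost
  surely all sample points lie in \<open>\<Omega>\<close>.
\<close>

section \<open>Exponential concentration, uniformly over the sample\<close>

lemma exp_le_quadratic:
  fixes x :: real
  assumes "\<bar>x\<bar> \<le> 1"
  shows "exp x \<le> 1 + x + x\<^sup>2"
proof (cases "x \<ge> 0")
  case True
  then show ?thesis using exp_bound[of x] assms by simp
next
  case False
  define u where "u = - x"
  have u: "0 < u" "u \<le> 1" using False assms by (auto simp: u_def)
  have "exp x = 1 / exp u" by (simp add: u_def exp_minus field_simps)
  also have "\<dots> \<le> 1 / (1 + u)" using u exp_ge_add_one_self[of u] by (intro divide_left_mono) auto
  also have "\<dots> \<le> 1 - u + u\<^sup>2"
  proof -
    have "(1 - u + u\<^sup>2) * (1 + u) = 1 + u ^ 3" by (simp add: power2_eq_square power3_eq_cube algebra_simps)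
    then have "1 \<le> (1 - u + u\<^sup>2) * (1 + u)" using u by simp
    then show ?thesis using u by (simp add: divide_le_eq)
  qed
  finally show ?thesis by (simp add: u_def)
qed

text \<open>
  For values in \<open>[0, B]\<close> the second moment is at most \<open>B\<close> times the mean. The exponent is
  therefore proportional to the mean, where Hoeffding's inequality would have \<open>B\<^sup>2\<close>; for means of
  order \<open>h\<^sup>d\<close> this yields the effective sample size \<open>n h\<^sup>d\<close> instead of \<open>n h\<close> to the power \<open>2 d\<close>.
\<close>
lemma (in prob_space) mgf_bound:
  fixes g :: "'a \<Rightarrow> real"
  assumes [measurable]: "g \<in> borel_measurable M" and g: "\<And>y. 0 \<le> g y" "\<And>y. g y \<le> B"
    and t: "\<bar>t\<bar> * B \<le> 1"
  shows "(\<integral>\<^sup>+y. ennreal (exp (t * (g y - expectation g))) \<partial>M) \<le> ennreal (exp (t\<^sup>2 * B * expectation g))"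
proof -
  have ig: "integrable M g" by (rule integrable_const_bound[of _ B]) (use g in auto)
  let ?m = "expectation g"
  have *: "exp (t * g y) \<le> 1 + (t + t\<^sup>2 * B) * g y" for y
  proof -
    have "\<bar>t * g y\<bar> \<le> \<bar>t\<bar> * B" using g by (auto simp: abs_mult intro!: mult_left_mono)
    then have "exp (t * g y) \<le> 1 + t * g y + (t * g y)\<^sup>2" using t by (intro exp_le_quadratic) linarith
    also have "(t * g y)\<^sup>2 \<le> t\<^sup>2 * B * g y"
      using mult_left_mono[OF mult_right_mono[OF g(2)[of y] g(1)[of y]], of "t\<^sup>2"]
          by (simp add: power2_eq_square mult_ac)
    finally show ?thesis by (simp add: algebra_simps)
  qed
  then have nn: "0 \<le> 1 + (t + t\<^sup>2 * B) * g y" for y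
    using order.trans[OF less_imp_le[OF exp_gt_zero]] by blast
  have "(\<integral>\<^sup>+y. ennreal (exp (t * (g y - ?m))) \<partial>M) \<le> (\<integral>\<^sup>+y. ennreal (exp (- t * ?m) * (1 + (t + t\<^sup>2 * B)
      * g y)) \<partial>M)"
  proof (intro nn_integral_mono ennreal_leI)
    fix y
    have "exp (t * (g y - ?m)) = exp (- t * ?m) * exp (t * g y)" by (simp add: exp_add[symmetric] algebra_simps)
    also have "\<dots> \<le> exp (- t * ?m) * (1 + (t + t\<^sup>2 * B) * g y)" by (intro mult_left_mono *) auto
    finally show "exp (t * (g y - ?m)) \<le> exp (- t * ?m) * (1 + (t + t\<^sup>2 * B) * g y)" .
  qed
  also have "\<dots> = ennreal (\<integral>y. exp (- t * ?m) * (1 + (t + t\<^sup>2 * B) * g y) \<partial>M)"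
    by (intro nn_integral_eq_integral AE_I2 mult_nonneg_nonneg nn) (use ig in auto)
  also have "(\<integral>y. exp (- t * ?m) * (1 + (t + t\<^sup>2 * B) * g y) \<partial>M) = exp (- t * ?m) * (1 + (t + t\<^sup>2 * B) * ?m)"
    using ig by (simp add: prob_space)
  also have "\<dots> \<le> exp (- t * ?m) * exp ((t + t\<^sup>2 * B) * ?m)"
    by (intro mult_left_mono exp_ge_add_one_self) auto
  also have "\<dots> = exp (t\<^sup>2 * B * ?m)" by (simp add: exp_add[symmetric] algebra_simps)
  finally show ?thesis by (simp add: ennreal_leI)
qed

text \<open>
  With coordinate \<open>i\<close> held fixed the summands are independent, so the inner integral over the other
  coordinates factorises and each factor is bounded by \<open>mgf_bound\<close>, uniformly in the fixed value.
\<close>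
lemma (in prob_space) pair_sum_mgf:
  fixes f :: "'a \<Rightarrow> 'a \<Rightarrow> real"
  assumes f[measurable]: "case_prod f \<in> borel_measurable (M \<Otimes>\<^sub>M M)"
    and f0: "\<And>x y. 0 \<le> f x y" "\<And>x y. f x y \<le> B"
    and K: "\<And>x. (\<integral>y. f x y \<partial>M) \<le> K" and t: "\<bar>t\<bar> * B \<le> 1" and B: "B \<ge> 0"
    and I: "finite I" "i \<in> I"
  shows "(\<integral>\<^sup>+\<omega>. ennreal (exp (t * (\<Sum>j\<in>I - {i}. f (\<omega> i) (\<omega> j) - (\<integral>y. f (\<omega> i) y \<partial>M)))) \<partial>PiM I (\<lambda>_. M))
     \<le> ennreal (exp (t\<^sup>2 * B * K * real (card I)))"
proof -
  interpret P: product_sigma_finite "\<lambda>_. M" by standard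
  define J where "J = I - {i}"
  have J: "finite J" "i \<notin> J" "I = insert i J" using I by (auto simp: J_def)
  define m where "m x = (\<integral>y. f x y \<partial>M)" for x
  have m[measurable]: "m \<in> borel_measurable M" unfolding m_def by measurable
  have m0: "0 \<le> m x" for x unfolding m_def using f0 by (intro integral_nonneg_AE) auto
  have K0: "0 \<le> K" using m0 K unfolding m_def by (meson order_trans)
  have "(\<integral>\<^sup>+\<omega>. ennreal (exp (t * (\<Sum>j\<in>J. f (\<omega> i) (\<omega> j) - m (\<omega> i)))) \<partial>PiM (insert i J) (\<lambda>_. M))
     = (\<integral>\<^sup>+x. \<integral>\<^sup>+\<omega>. ennreal (exp (t * (\<Sum>j\<in>J. f ((fun_upd \<omega> i x) i) ((fun_upd \<omega> i x) j)
         - m ((fun_upd \<omega> i x) i)))) \<partial>PiM J (\<lambda>_. M) \<partial>M)"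
    by (rule P.product_nn_integral_insert_rev) (use J in auto)
  also have "\<dots> = (\<integral>\<^sup>+x. \<integral>\<^sup>+\<omega>. (\<Prod>j\<in>J. ennreal (exp (t * (f x (\<omega> j) - m x)))) \<partial>PiM J (\<lambda>_. M) \<partial>M)"
  proof (intro nn_integral_cong)
    fix x and \<omega> :: "'b \<Rightarrow> 'a"
    have "(\<Sum>j\<in>J. f ((fun_upd \<omega> i x) i) ((fun_upd \<omega> i x) j) - m ((fun_upd \<omega> i x) i)) = (\<Sum>j\<in>J. f x (\<omega> j) - m x)"
      using J by (intro sum.cong) auto
    then show "ennreal (exp (t * (\<Sum>j\<in>J. f ((fun_upd \<omega> i x) i) ((fun_upd \<omega> i x) j) - m ((fun_upd \<omega> i x) i)))) =
        (\<Prod>j\<in>J. ennreal (exp (t * (f x (\<omega> j) - m x))))"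
      by (simp add: prod_ennreal exp_sum[symmetric] J(1) sum_distrib_left)
  qed
  also have "\<dots> = (\<integral>\<^sup>+x. (\<Prod>j\<in>J. \<integral>\<^sup>+y. ennreal (exp (t * (f x y - m x))) \<partial>M) \<partial>M)"
    by (intro nn_integral_cong P.product_nn_integral_prod) (use J in auto)
  also have "\<dots> \<le> (\<integral>\<^sup>+x. (\<Prod>j\<in>J. ennreal (exp (t\<^sup>2 * B * K))) \<partial>M)"
  proof (intro nn_integral_mono prod_mono_ennreal)
    fix x j assume x: "x \<in> space M"
    have "(\<integral>\<^sup>+y. ennreal (exp (t * (f x y - m x))) \<partial>M) \<le> ennreal (exp (t\<^sup>2 * B * m x))"
      unfolding m_def by (rule mgf_bound) (use x f0 t in auto)
    also have "\<dots> \<le> ennreal (exp (t\<^sup>2 * B * K))" unfolding m_def using K B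
        by (intro ennreal_leI) (auto intro!: mult_left_mono)
    finally show "(\<integral>\<^sup>+y. ennreal (exp (t * (f x y - m x))) \<partial>M) \<le> ennreal (exp (t\<^sup>2 * B * K))" .
  qed
  also have "\<dots> = ennreal (exp (t\<^sup>2 * B * K * real (card J)))"
    by (simp add: prod_constant emeasure_space_1 ennreal_power exp_of_nat_mult[symmetric] mult_ac)
  also have "\<dots> \<le> ennreal (exp (t\<^sup>2 * B * K * real (card I)))"
    using card_mono[OF I(1), of J] J B K0 by (intro ennreal_leI) (auto intro!: mult_left_mono)
  finally show ?thesis unfolding m_def J_def[symmetric] J(3)[symmetric] .
qed

text \<open>
  Markov's inequality for the exponential of the centred sum and of its negative, transported from
  the product measure to the sample by independence.
\<close>
lemma (in prob_space) pair_sum_tail: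
  fixes X :: "nat \<Rightarrow> 'a \<Rightarrow> 'b" and f :: "'b \<Rightarrow> 'b \<Rightarrow> real"
  assumes \<mu>: "prob_space \<mu>" and sets: "sets \<mu> = sets S"
    and X: "\<And>i. i \<in> I \<Longrightarrow> X i \<in> M \<rightarrow>\<^sub>M S" "indep_vars (\<lambda>_. S) X I" "\<And>i. i \<in> I \<Longrightarrow> distr M S (X i) = \<mu>"
    and f[measurable]: "case_prod f \<in> borel_measurable (\<mu> \<Otimes>\<^sub>M \<mu>)"
    and f0: "\<And>x y. 0 \<le> f x y" "\<And>x y. f x y \<le> B"
    and K: "\<And>x. (\<integral>y. f x y \<partial>\<mu>) \<le> K" and t: "0 \<le> t" "t * B \<le> 1" and B: "B \<ge> 0"
    and I: "finite I" "i \<in> I"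
  shows "prob {\<omega>\<in>space M. l \<le> \<bar>(\<Sum>j\<in>I - {i}. f (X i \<omega>) (X j \<omega>) - (\<integral>y. f (X i \<omega>) y \<partial>\<mu>))\<bar>}
     \<le> 2 * exp (t\<^sup>2 * B * K * real (card I) - t * l)"
proof -
  interpret \<mu>: prob_space \<mu> by fact
  note sets[measurable_cong]
  have XI[measurable]: "i \<in> I \<Longrightarrow> X i \<in> M \<rightarrow>\<^sub>M S" for i by fact
  define G where "G \<omega> = (\<Sum>j\<in>I - {i}. f (\<omega> i) (\<omega> j) - (\<integral>y. f (\<omega> i) y \<partial>\<mu>))" for \<omega> :: "nat \<Rightarrow> 'b"
  have iI[measurable]: "(\<lambda>\<omega>. \<omega> j) \<in> PiM I (\<lambda>_. S) \<rightarrow>\<^sub>M \<mu>" if "j \<in> I" for j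
    using that by (simp add: measurable_cong_sets[OF refl sets])
  have m: "(\<lambda>x. \<integral>y. f x y \<partial>\<mu>) \<in> borel_measurable \<mu>" by measurable
  have [measurable]: "G \<in> borel_measurable (PiM I (\<lambda>_. S))"
    unfolding G_def
  proof (intro borel_measurable_sum borel_measurable_diff)
    fix j assume "j \<in> I - {i}"
    then show "(\<lambda>\<omega>. f (\<omega> i) (\<omega> j)) \<in> borel_measurable (PiM I (\<lambda>_. S))"
      using measurable_compose[OF measurable_Pair[OF iI[of i] iI[of j]] f] I by auto
    show "(\<lambda>\<omega>. \<integral>y. f (\<omega> i) y \<partial>\<mu>) \<in> borel_measurable (PiM I (\<lambda>_. S))"
      by (rule measurable_compose[OF iI[OF I(2)] m])
  qed
  define Y where "Y \<omega> = (\<lambda>j\<in>I. X j \<omega>)" for \<omega>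
  have Y[measurable]: "Y \<in> M \<rightarrow>\<^sub>M PiM I (\<lambda>_. S)" unfolding Y_def by measurable
  have GY: "G (Y \<omega>) = (\<Sum>j\<in>I - {i}. f (X i \<omega>) (X j \<omega>) - (\<integral>y. f (X i \<omega>) y \<partial>\<mu>))" for \<omega>
    using I unfolding G_def Y_def by (intro sum.cong) auto
  have law: "distr M (PiM I (\<lambda>_. S)) Y = PiM I (\<lambda>_. \<mu>)"
  proof -
    have "distr M (PiM I (\<lambda>_. S)) Y = PiM I (\<lambda>i. distr M S (X i))"
      using X(2) unfolding Y_def by (subst (asm) indep_vars_iff_distr_eq_PiM') (use I X(1) in auto)
    also have "\<dots> = PiM I (\<lambda>_. \<mu>)" by (rule PiM_cong) (auto simp: X(3))
    finally show ?thesis .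
  qed
  have tail: "prob {\<omega>\<in>space M. l \<le> \<theta> * G (Y \<omega>)} \<le> exp (t\<^sup>2 * B * K * real (card I) - t * l)" if \<theta>: "\<theta>
      = 1 \<or> \<theta> = -1" for \<theta>
  proof -
    have "emeasure M {\<omega>\<in>space M. l \<le> \<theta> * G (Y \<omega>)} \<le> emeasure M {\<omega>\<in>space M. 1
        \<le> ennreal (exp (- t * l)) * ennreal (exp (t * \<theta> * G (Y \<omega>)))}"
    proof (intro emeasure_mono)
      show "{\<omega>\<in>space M. l \<le> \<theta> * G (Y \<omega>)} \<subseteq> {\<omega>\<in>space M. 1 \<le> ennreal (exp (- t * l)) * ennreal (exp (t * \<theta>
          * G (Y \<omega>)))}"
      proof safe
        fix \<omega> assume "l \<le> \<theta> * G (Y \<omega>)"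
        then have "t * l \<le> t * \<theta> * G (Y \<omega>)" using t mult_left_mono[of l "\<theta> * G (Y \<omega>)" t] by (simp add: mult_ac)
        then have "1 \<le> exp (- t * l + t * \<theta> * G (Y \<omega>))" by simp
        then show "1 \<le> ennreal (exp (- t * l)) * ennreal (exp (t * \<theta> * G (Y \<omega>)))"
          by (simp add: ennreal_mult[symmetric] exp_add[symmetric])
      qed
    qed measurable
    also have "\<dots> \<le> ennreal (exp (- t * l)) * (\<integral>\<^sup>+\<omega>. ennreal (exp (t * \<theta> * G (Y \<omega>))) * indicator (space M) \<omega> \<partial>M)"
      using nn_integral_Markov_inequality[of "\<lambda>\<omega>. ennreal (exp (t * \<theta>
          * G (Y \<omega>)))" "space M" M "ennreal (exp (- t * l))"]
      by (auto simp: measurable_compose)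
    also have "(\<integral>\<^sup>+\<omega>. ennreal (exp (t * \<theta> * G (Y \<omega>))) * indicator (space M) \<omega> \<partial>M)
        = (\<integral>\<^sup>+\<omega>. ennreal (exp (t * \<theta> * G (Y \<omega>))) \<partial>M)"
      by (intro nn_integral_cong) simp
    also have "\<dots> = (\<integral>\<^sup>+\<omega>. ennreal (exp (t * \<theta> * G \<omega>)) \<partial>PiM I (\<lambda>_. \<mu>))"
      unfolding law[symmetric] by (subst nn_integral_distr) auto
    also have "\<dots> \<le> ennreal (exp ((t * \<theta>)\<^sup>2 * B * K * real (card I)))"
      unfolding G_def by (rule \<mu>.pair_sum_mgf) (use f f0 K t B I \<theta> in auto)
    also have "(t * \<theta>)\<^sup>2 = t\<^sup>2" using \<theta> by auto
    finally have "emeasure M {\<omega>\<in>space M. l \<le> \<theta> * G (Y \<omega>)} \<le> ennreal (exp (- t * l)) * ennreal (exp (t\<^sup>2 * B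
        * K * real (card I)))"
      by (auto simp: mult_left_mono)
    also have "\<dots> = ennreal (exp (t\<^sup>2 * B * K * real (card I) - t * l))"
      by (simp add: ennreal_mult[symmetric] exp_add[symmetric])
    finally show ?thesis by (simp add: emeasure_eq_measure)
  qed
  have "prob {\<omega>\<in>space M. l \<le> \<bar>G (Y \<omega>)\<bar>} \<le> prob ({\<omega>\<in>space M. l \<le> 1 * G (Y \<omega>)} \<union> {\<omega>\<in>space M. l \<le> -1 * G (Y \<omega>)})"
    by (intro finite_measure_mono) auto
  also have "\<dots> \<le> prob {\<omega>\<in>space M. l \<le> 1 * G (Y \<omega>)} + prob {\<omega>\<in>space M. l \<le> -1 * G (Y \<omega>)}"
    by (intro measure_Un_le) measurable
  also have "\<dots> \<le> 2 * exp (t\<^sup>2 * B * K * real (card I) - t * l)"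
    using tail[of 1] tail[of "-1"] by simp
  finally show ?thesis unfolding GY .
qed

text \<open>
  The sequence \<open>a\<close> is the order of magnitude of the mean of one term, so the error
  \<open>\<epsilon> * (n * a n)\<close> is relative to the size of the sum. The diagonal term \<open>j = i\<close> is not independent
  of \<open>X i\<close>, but it is at most \<open>B\<close>, which is negligible because \<open>n * a n\<close> outgrows \<open>ln n\<close>.
\<close>
theorem (in prob_space) uniform_empirical_average:
  fixes X :: "nat \<Rightarrow> 'a \<Rightarrow> 'b" and f :: "nat \<Rightarrow> 'b \<Rightarrow> 'b \<Rightarrow> real" and a :: "nat \<Rightarrow> real"
  assumes \<mu>: "prob_space \<mu>" and sets: "sets \<mu> = sets S"
    and X: "\<And>i. i \<ge> 1 \<Longrightarrow> X i \<in> M \<rightarrow>\<^sub>M S" "indep_vars (\<lambda>_. S) X {1..}" "\<And>i. i \<ge> 1 \<Longrightarrow> distr M S (X i) = \<mu>"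
    and f: "\<And>n. n \<ge> 1 \<Longrightarrow> case_prod (f n) \<in> borel_measurable (\<mu> \<Otimes>\<^sub>M \<mu>)"
    and f0: "\<And>n x y. n \<ge> 1 \<Longrightarrow> 0 \<le> f n x y" "\<And>n x y. n \<ge> 1 \<Longrightarrow> f n x y \<le> B"
    and K: "\<And>n x. n \<ge> 1 \<Longrightarrow> (\<integral>y. f n x y \<partial>\<mu>) \<le> K * a n"
    and a: "filterlim (\<lambda>n. real n * a n / ln (real n)) at_top sequentially"
  shows "AE \<omega> in M. \<forall>\<epsilon>>0. \<forall>\<^sub>F n in sequentially. \<forall>i\<in>{1..n}.
     \<bar>(\<Sum>j=1..n. f n (X i \<omega>) (X j \<omega>)) - real n * (\<integral>y. f n (X i \<omega>) y \<partial>\<mu>)\<bar> \<le> \<epsilon> * (real n * a n)"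
proof -
  interpret \<mu>: prob_space \<mu> by fact
  note sets[measurable_cong]
  have X'[measurable]: "X i \<in> M \<rightarrow>\<^sub>M \<mu>" if "i \<ge> 1" for i
    using X(1)[OF that] by (simp add: measurable_cong_sets[OF refl sets])
  define m where "m n x = (\<integral>y. f n x y \<partial>\<mu>)" for n x
  have m[measurable]: "m n \<in> borel_measurable \<mu>" if "n \<ge> 1" for n
    unfolding m_def using f[OF that] by measurable
  have B: "0 \<le> B" using f0[of 1 undefined undefined] by simp
  have m0: "0 \<le> m n x" "m n x \<le> B" if "n \<ge> 1" for n x
  proof -
    show "0 \<le> m n x" unfolding m_def by (intro integral_nonneg_AE AE_I2 f0 that)
    have "m n x \<le> (\<integral>y. B \<partial>\<mu>)" unfolding m_def
      by (rule integral_mono') (use f0 that B in auto)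
    then show "m n x \<le> B" by (simp add: \<mu>.prob_space)
  qed
  have large: "\<forall>\<^sub>F n in sequentially. c * ln (real n) \<le> real n * a n \<and> ln (real n) > 0 \<and> n \<ge> 2" for c
  proof -
    have "\<forall>\<^sub>F n in sequentially. c \<le> real n * a n / ln (real n)"
      using a by (simp add: filterlim_at_top)
    moreover have "\<forall>\<^sub>F n in sequentially. n \<ge> (2::nat)" by (rule eventually_ge_at_top)
    ultimately show ?thesis by eventually_elim (auto simp: field_simps)
  qed
  have main: "AE \<omega> in M. \<forall>\<^sub>F n in sequentially. \<forall>i\<in>{1..n}.
     \<bar>(\<Sum>j=1..n. f n (X i \<omega>) (X j \<omega>)) - real n * m n (X i \<omega>)\<bar> \<le> \<epsilon> * (real n * a n)"
    if \<epsilon>: "\<epsilon> > 0" for \<epsilon> :: real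
  proof -
    define B' K' where "B' = max 1 B" and "K' = max 1 K"
    have BK: "B' > 0" "K' > 0" "B \<le> B'" "K \<le> K'" by (auto simp: B'_def K'_def)
    \<comment> \<open>The Chernoff parameter keeps the quadratic term \<open>t\<^sup>2 B' K'\<close> at most half of the
      linear gain \<open>t \<epsilon> / 2\<close>.\<close>
    define t where "t = min (1 / B') (\<epsilon> / (4 * B' * K'))"
    have t: "t > 0" "t * B' \<le> 1" "t * B' * K' \<le> \<epsilon> / 4"
      using BK \<epsilon> by (auto simp: t_def field_simps min_def)
    define l where "l n = \<epsilon> / 2 * (real n * a n)" for n
    define G where "G n i \<omega> = (\<Sum>j\<in>{1..n} - {i}. f n (X i \<omega>) (X j \<omega>) - m n (X i \<omega>))" for n i \<omega>
    define A where "A n = (\<Union>i\<in>{1..n}. {\<omega>\<in>space M. l n \<le> \<bar>G n i \<omega>\<bar>})" for n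
    have Gm: "G n i \<in> borel_measurable M" if "i \<in> {1..n}" for n i
      unfolding G_def
    proof (intro borel_measurable_sum borel_measurable_diff)
      have n: "n \<ge> 1" "i \<ge> 1" using that by auto
      fix j assume "j \<in> {1..n} - {i}"
      then have j: "j \<ge> 1" by auto
      show "(\<lambda>\<omega>. f n (X i \<omega>) (X j \<omega>)) \<in> borel_measurable M"
        using measurable_compose[OF measurable_Pair[OF X'[OF n(2)] X'[OF j]] f[OF n(1)]] by simp
      show "(\<lambda>\<omega>. m n (X i \<omega>)) \<in> borel_measurable M"
        by (rule measurable_compose[OF X'[OF n(2)] m[OF n(1)]])
    qed
    have Am: "A n \<in> sets M" for n
      unfolding A_def using Gm by (intro sets.finite_UN) (auto intro!: borel_measurable_le)
    have PA: "\<forall>\<^sub>F n in sequentially. norm (prob (A n)) \<le> 2 * (1 / real n ^ 2)"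
      \<comment> \<open>Eventually \<open>t \<epsilon> / 4 * n * a n\<close> is at least \<open>3 ln n\<close>: one power of \<open>n\<close> pays for the union
        bound and the other two make the series converge.\<close>
      using large[of "12 / (t * \<epsilon>)"]
    proof eventually_elim
      case (elim n)
      then have n: "n \<ge> 1" by simp
      have na: "0 \<le> real n * a n" using elim t(1) \<epsilon>
        by (meson divide_nonneg_pos less_eq_real_def mult_nonneg_nonneg mult_pos_pos order_trans
            zero_le_numeral)
      then have an: "0 \<le> a n" using n by (simp add: zero_le_mult_iff)
      have Ka: "m n x \<le> K' * a n" for x
        using K[OF n, of x] mult_right_mono[OF BK(4) an] unfolding m_def by linarith
      have "prob (A n) \<le> (\<Sum>i\<in>{1..n}. prob {\<omega>\<in>space M. l n \<le> \<bar>G n i \<omega>\<bar>})"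
        unfolding A_def using Gm by (intro finite_measure_subadditive_finite) (auto intro!: borel_measurable_le)
      also have "\<dots> \<le> (\<Sum>i\<in>{1..n}. 2 * exp (t\<^sup>2 * B' * (K' * a n) * real (card {1..n}) - t * l n))"
      proof (rule sum_mono)
        fix i assume i: "i \<in> {1..n}"
        show "prob {\<omega>\<in>space M. l n \<le> \<bar>G n i \<omega>\<bar>} \<le> 2 * exp (t\<^sup>2 * B' * (K' * a n) * real (card {1..n}) - t
            * l n)"
          unfolding G_def m_def
        proof (rule pair_sum_tail[OF \<mu> sets])
          show "indep_vars (\<lambda>_. S) X {1..n}" by (rule indep_vars_subset[OF X(2)]) auto
          show "f n x y \<le> B'" for x y using f0(2)[OF n, of x y] BK by simp
        qed (use X(1,3) f[OF n] f0(1)[OF n] Ka t BK i in \<open>auto simp: m_def\<close>)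
      qed
      also have "\<dots> = real n * (2 * exp (t\<^sup>2 * B' * (K' * a n) * real n - t * l n))" by simp
      also have "t\<^sup>2 * B' * (K' * a n) * real n - t * l n = t * (real n * a n) * (t * B' * K' - \<epsilon> / 2)"
        by (simp add: l_def power2_eq_square algebra_simps)
      also have "\<dots> \<le> t * (real n * a n) * (- (\<epsilon> / 4))"
        using t na by (intro mult_left_mono) auto
      also have "\<dots> \<le> - (3 * ln (real n))"
        using elim t(1) \<epsilon> by (simp add: field_simps)
      also have "exp (- (3 * ln (real n))) = 1 / real n ^ 3"
      proof -
        have "exp (3 * ln (real n)) = real n ^ 3" using n by (simp add: exp_of_nat_mult[of 3, simplified])
        then show ?thesis by (simp add: exp_minus field_simps)
      qed
      finally have "prob (A n) \<le> real n * (2 * (1 / real n ^ 3))" by (simp add: mult_left_mono)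
      also have "\<dots> = 2 * (1 / real n ^ 2)" using n by (simp add: power2_eq_square power3_eq_cube)
      finally show ?case by simp
    qed
    have "summable (\<lambda>n. 2 * (1 / real n ^ 2))"
      using inverse_power_summable[of 2, where 'a=real] by (intro summable_mult) (simp add: inverse_eq_divide)
    then have "summable (\<lambda>n. prob (A n))" by (rule summable_comparison_test_ev[OF PA])
    then have "AE \<omega> in M. \<forall>\<^sub>F n in sequentially. \<omega> \<in> space M - A n"
      using Am by (intro borel_cantelli_AE1) (auto simp: emeasure_eq_measure)
    then show ?thesis
    proof (eventually_elim)
      case (elim \<omega>)
      have "\<forall>\<^sub>F n in sequentially. 2 * B / \<epsilon> \<le> ln (real n)"
        using filterlim_compose[OF ln_at_top filterlim_real_sequentially] by (simp add: filterlim_at_top)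
      with elim large[of 1] show ?case
      proof eventually_elim
        case (elim n)
        then have n: "n \<ge> 1" by simp
        show ?case
        proof
          fix i assume i: "i \<in> {1..n}"
          have "\<not> l n \<le> \<bar>G n i \<omega>\<bar>" using elim(1) i unfolding A_def by blast
          then have G: "\<bar>G n i \<omega>\<bar> < l n" by simp
          have "(\<Sum>j=1..n. f n (X i \<omega>) (X j \<omega>)) - real n * m n (X i \<omega>)
              = (\<Sum>j=1..n. f n (X i \<omega>) (X j \<omega>) - m n (X i \<omega>))"
            by (simp add: sum_subtractf)
          also have "\<dots> = (f n (X i \<omega>) (X i \<omega>) - m n (X i \<omega>)) + G n i \<omega>"
            unfolding G_def using i by (subst sum.remove[of _ i]) auto
          finally have "\<bar>(\<Sum>j=1..n. f n (X i \<omega>) (X j \<omega>)) - real n * m n (X i \<omega>)\<bar> \<le> B + l n"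
            using G f0[OF n, of "X i \<omega>" "X i \<omega>"] m0[OF n, of "X i \<omega>"] by linarith
          moreover have "2 * B / \<epsilon> \<le> real n * a n" using elim by linarith
          then have "B \<le> l n" using \<epsilon> by (simp add: l_def field_simps)
          then have "B + l n \<le> \<epsilon> * (real n * a n)" by (simp add: l_def)
          ultimately show "\<bar>(\<Sum>j=1..n. f n (X i \<omega>) (X j \<omega>)) - real n * m n (X i \<omega>)\<bar> \<le> \<epsilon> * (real n * a n)"
              by linarith
        qed
      qed
    qed
  qed
  have "AE \<omega> in M. \<forall>k. \<forall>\<^sub>F n in sequentially. \<forall>i\<in>{1..n}.
     \<bar>(\<Sum>j=1..n. f n (X i \<omega>) (X j \<omega>)) - real n * m n (X i \<omega>)\<bar> \<le> 1 / real (Suc k) * (real n * a n)"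
    unfolding AE_all_countable by (intro allI main) simp
  then show ?thesis unfolding m_def[symmetric]
  proof eventually_elim
    case (elim \<omega>)
    show ?case
    proof (intro allI impI)
      fix \<epsilon> :: real assume "\<epsilon> > 0"
      then obtain k where k: "1 / real (Suc k) < \<epsilon>" using nat_approx_posE by blast
      show "\<forall>\<^sub>F n in sequentially. \<forall>i\<in>{1..n}.
         \<bar>(\<Sum>j=1..n. f n (X i \<omega>) (X j \<omega>)) - real n * m n (X i \<omega>)\<bar> \<le> \<epsilon> * (real n * a n)"
        using elim[rule_format, of k] large[of 1]
      proof eventually_elim
        case (elim n)
        then have "0 \<le> real n * a n" by linarith
        then have "1 / real (Suc k) * (real n * a n) \<le> \<epsilon> * (real n * a n)" using k
            by (intro mult_right_mono) auto
        then show ?case using elim(1) by force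
      qed
    qed
  qed
qed

section \<open>Interior cones of smooth domains\<close>

lemma C1_locally_lipschitz:
  fixes f :: "'a::euclidean_space \<Rightarrow> 'b::real_normed_vector"
  assumes "C2_closure UNIV f"
  shows "\<exists>K>0. \<forall>x\<in>ball p R. \<forall>y\<in>ball p R. norm (f x - f y) \<le> K * norm (x - y)"
proof -
  obtain D where D: "continuous_on UNIV D" "\<And>x. (f has_derivative blinfun_apply (D x)) (at x)"
    using assms unfolding C2_closure_def by auto
  have "compact (D ` cball p R)"
    by (intro compact_continuous_image continuous_on_subset[OF D(1)]) auto
  then obtain K where K: "K > 0" "\<And>x. x \<in> cball p R \<Longrightarrow> norm (D x) \<le> K"
    using compact_imp_bounded[of "D ` cball p R"] by (auto simp: bounded_pos)
  have "norm (f x - f y) \<le> K * norm (x - y)" if "x \<in> ball p R" "y \<in> ball p R" for x y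
    by (rule differentiable_bound[where S="ball p R" and f'="\<lambda>x. blinfun_apply (D x)"])
       (use that K(2) D(2) in \<open>auto simp: norm_blinfun.rep_eq[symmetric] intro: has_derivative_at_withinI\<close>)
  with K(1) show ?thesis by blast
qed

text \<open>
  A truncated open cone with vertex \<open>y\<close>, axis \<open>e\<close> and aperture given by \<open>a\<close> is the union of the
  balls \<open>ball (y + s *\<^sub>R e) (a * s)\<close>. One axis serves all points of \<open>\<Omega>\<close> near \<open>p\<close>; the Lipschitz
  estimate below needs this.
\<close>
definition interior_cone :: "'a::euclidean_space set \<Rightarrow> 'a \<Rightarrow> real \<Rightarrow> real \<Rightarrow> 'a \<Rightarrow> bool" where
  "interior_cone \<Omega> p r a e \<longleftrightarrow> norm e = 1 \<and>
     (\<forall>y\<in>\<Omega> \<inter> ball p r. \<forall>s. 0 < s \<and> s < r \<longrightarrow> ball (y + s *\<^sub>R e) (a * s) \<subseteq> \<Omega>)"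

lemma interior_coneD:
  assumes "interior_cone \<Omega> p r a e"
  shows "norm e = 1"
    and "\<And>y s. y \<in> \<Omega> \<Longrightarrow> dist p y < r \<Longrightarrow> 0 < s \<Longrightarrow> s < r \<Longrightarrow> ball (y + s *\<^sub>R e) (a * s) \<subseteq> \<Omega>"
  using assms by (auto simp: interior_cone_def)

text \<open>
  Above a graph with Lipschitz constant \<open>K\<close>, moving up by \<open>s\<close> gains height \<open>s\<close>. A further
  displacement shorter than \<open>a * s\<close> loses less than \<open>a * s\<close> in height and raises the graph by less
  than \<open>K * a * s\<close>; for \<open>a = 1 / (1 + K)\<close> the gain covers both losses.
\<close>
lemma local_cone:
  fixes \<Omega> :: "'a::euclidean_space set"
  assumes dom: "bounded_C2_domain \<Omega>" and p: "p \<in> closure \<Omega>"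
  shows "\<exists>r a e. r > 0 \<and> a > 0 \<and> interior_cone \<Omega> p r a e"
proof (cases "p \<in> \<Omega>")
  case True
  have "open \<Omega>" using dom by (simp add: bounded_C2_domain_def)
  then obtain R where R: "R > 0" "ball p R \<subseteq> \<Omega>" using True open_contains_ball by blast
  obtain e :: 'a where e: "norm e = 1" using vector_choose_size[of 1] by auto
  have "ball (y + s *\<^sub>R e) (1 * s) \<subseteq> \<Omega>" if y: "y \<in> \<Omega> \<inter> ball p (R/3)" and s: "0 < s" "s < R/3" for y s
  proof
    fix z assume z: "z \<in> ball (y + s *\<^sub>R e) (1 * s)"
    have "dist p z \<le> dist p y + dist y (y + s *\<^sub>R e) + dist (y + s *\<^sub>R e) z"
      by metric
    also have "\<dots> < R"
      using y z s e by (auto simp: dist_norm)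
    finally show "z \<in> \<Omega>" using R(2) by auto
  qed
  then have "interior_cone \<Omega> p (R/3) 1 e" using e by (simp add: interior_cone_def)
  then show ?thesis using R(1) by (intro exI[of _ "R/3"] exI[of _ 1] exI[of _ e]) simp
next
  case False
  then have "p \<in> frontier \<Omega>"
    using p dom by (auto simp: frontier_def bounded_C2_domain_def interior_open)
  then obtain R e \<gamma> where R: "R > 0" "norm e = 1" "C2_closure UNIV \<gamma>"
    and graph: "\<Omega> \<inter> ball p R = {x \<in> ball p R. \<gamma> (x - (x \<bullet> e) *\<^sub>R e) < x \<bullet> e}"
    using dom unfolding bounded_C2_domain_def by blast
  define \<pi> where "\<pi> x = x - (x \<bullet> e) *\<^sub>R e" for x
  have ee: "e \<bullet> e = 1" using R(2) by (simp add: norm_eq_1)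
  have \<pi>_diff: "\<pi> x - \<pi> y = \<pi> (x - y)" for x y
    by (simp add: \<pi>_def algebra_simps inner_diff_left)
  have \<pi>_le: "norm (\<pi> x) \<le> norm x" for x
  proof -
    have "(norm (\<pi> x))\<^sup>2 = (norm x)\<^sup>2 - (x \<bullet> e)\<^sup>2"
      unfolding \<pi>_def power2_norm_eq_inner
      by (simp add: inner_diff_left inner_diff_right ee power2_eq_square inner_commute)
    then have "(norm (\<pi> x))\<^sup>2 \<le> (norm x)\<^sup>2" by simp
    then show ?thesis by (rule power2_le_imp_le) simp
  qed
  obtain K where K: "K > 0"
    "\<And>x y. x \<in> ball (\<pi> p) R \<Longrightarrow> y \<in> ball (\<pi> p) R \<Longrightarrow> norm (\<gamma> x - \<gamma> y) \<le> K * norm (x - y)"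
    using C1_locally_lipschitz[OF R(3)] by blast
  define a where "a = 1 / (1 + K)"
  have a: "0 < a" "a \<le> 1" "a + K * a = 1" using K(1) by (auto simp: a_def field_simps)
  have "ball (y + s *\<^sub>R e) (a * s) \<subseteq> \<Omega>" if y: "y \<in> \<Omega> \<inter> ball p (R/3)" and s: "0 < s" "s < R/3" for y s
  proof
    fix z assume "z \<in> ball (y + s *\<^sub>R e) (a * s)"
    then have z: "norm (z - (y + s *\<^sub>R e)) < a * s" by (auto simp: dist_norm norm_minus_commute)
    have as: "a * s \<le> s" using a s by simp
    have "dist p z \<le> dist p y + dist y (y + s *\<^sub>R e) + dist (y + s *\<^sub>R e) z"
      by metric
    moreover have "dist (y + s *\<^sub>R e) z = norm (z - (y + s *\<^sub>R e))"
      by (simp add: dist_norm norm_minus_commute)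
    moreover have "dist p y < R / 3" using y by simp
    moreover have "dist y (y + s *\<^sub>R e) = s" using s R(2) by (simp add: dist_norm)
    ultimately have zR: "dist p z < R" and yR: "dist p y < R" using z s as R(1) by linarith+
    have "dist (\<pi> p) (\<pi> z) < R" "dist (\<pi> p) (\<pi> y) < R"
      using zR yR \<pi>_le[of "p - z"] \<pi>_le[of "p - y"] unfolding dist_norm \<pi>_diff by linarith+
    then have "\<pi> z \<in> ball (\<pi> p) R" "\<pi> y \<in> ball (\<pi> p) R" by simp_all
    then have "norm (\<gamma> (\<pi> z) - \<gamma> (\<pi> y)) \<le> K * norm (\<pi> z - \<pi> y)" by (rule K(2))
    moreover have "\<pi> z - \<pi> y = \<pi> (z - (y + s *\<^sub>R e))"
      unfolding \<pi>_diff by (simp add: \<pi>_def ee inner_diff_left inner_add_left algebra_simps)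
    then have "norm (\<pi> z - \<pi> y) < a * s" using \<pi>_le[of "z - (y + s *\<^sub>R e)"] z by simp
    then have "K * norm (\<pi> z - \<pi> y) \<le> K * (a * s)" using K(1) by simp
    ultimately have "\<gamma> (\<pi> z) \<le> \<gamma> (\<pi> y) + K * a * s" by (simp add: abs_le_iff)
    also have "\<gamma> (\<pi> y) < y \<bullet> e" using graph y yR unfolding \<pi>_def by (auto simp: set_eq_iff)
    also have "\<bar>(z - (y + s *\<^sub>R e)) \<bullet> e\<bar> < a * s"
      using Cauchy_Schwarz_ineq2[of "z - (y + s *\<^sub>R e)" e] z R(2) by simp
    then have "y \<bullet> e + K * a * s < z \<bullet> e - s + (a + K * a) * s"
      by (simp add: inner_diff_left inner_add_left ee algebra_simps)
    finally have "\<gamma> (\<pi> z) < z \<bullet> e" using a(3) by simp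
    then show "z \<in> \<Omega>" using graph zR unfolding \<pi>_def by (auto simp: set_eq_iff)
  qed
  then have "interior_cone \<Omega> p (R/3) a e" using R(2) by (simp add: interior_cone_def)
  then show ?thesis using R(1) a(1) by (intro exI[of _ "R/3"] exI[of _ a] exI[of _ e]) simp
qed

text \<open>Compactness of the closure: a finite cover by half-size balls leaves room for the radius.\<close>
lemma uniform_cone:
  fixes \<Omega> :: "'a::euclidean_space set"
  assumes dom: "bounded_C2_domain \<Omega>"
  obtains r a where "r > 0" "a > 0" "\<And>x. x \<in> closure \<Omega> \<Longrightarrow> \<exists>e. interior_cone \<Omega> x r a e"
proof -
  have "\<forall>p\<in>closure \<Omega>. \<exists>ra. fst ra > 0 \<and> snd ra > 0 \<and> (\<exists>e. interior_cone \<Omega> p (fst ra) (snd ra) e)"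
  proof
    fix p assume "p \<in> closure \<Omega>"
    from local_cone[OF dom this] obtain r a e where "r > 0" "a > 0" "interior_cone \<Omega> p r a e"
      by (elim exE conjE)
    then show "\<exists>ra. fst ra > 0 \<and> snd ra > 0 \<and> (\<exists>e. interior_cone \<Omega> p (fst ra) (snd ra) e)"
      by (intro exI[of _ "(r, a)"]) auto
  qed
  from bchoice[OF this] obtain ra where "\<forall>p\<in>closure \<Omega>. fst (ra p) > 0 \<and> snd (ra p) > 0 \<and>
      (\<exists>e. interior_cone \<Omega> p (fst (ra p)) (snd (ra p)) e)" by (elim exE)
  moreover define r a where "r p = fst (ra p)" and "a p = snd (ra p)" for p
  ultimately have P: "\<And>p. p \<in> closure \<Omega> \<Longrightarrow> r p > 0 \<and> a p > 0 \<and> (\<exists>e. interior_cone \<Omega> p (r p) (a p) e)"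
    by simp
  have "compact (closure \<Omega>)" using dom by (simp add: bounded_C2_domain_def compact_closure)
  then obtain F where F: "F \<subseteq> closure \<Omega>" "finite F" "closure \<Omega> \<subseteq> (\<Union>p\<in>F. ball p (r p / 2))"
    by (rule compactE_image[where f="\<lambda>p. ball p (r p / 2)" and C="closure \<Omega>"])
       (use P in auto)
  have "F \<noteq> {}" using F dom by (auto simp: bounded_C2_domain_def)
  define r0 where "r0 = Min (r ` F) / 2"
  define a0 where "a0 = Min (a ` F)"
  have pos: "r0 > 0" "a0 > 0"
    using F P \<open>F \<noteq> {}\<close> unfolding r0_def a0_def by auto
  show thesis
  proof (rule that[OF pos])
    fix x assume "x \<in> closure \<Omega>"
    then obtain p where p: "p \<in> F" "x \<in> ball p (r p / 2)" using F(3) by blast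
    have le: "r0 \<le> r p / 2" "a0 \<le> a p" using p F(2) by (auto simp: r0_def a0_def)
    obtain e where e: "interior_cone \<Omega> p (r p) (a p) e"
      using P[of p] p(1) F(1) by blast
    have "ball (y + s *\<^sub>R e) (a0 * s) \<subseteq> \<Omega>" if "y \<in> \<Omega>" "dist x y < r0" "0 < s" "s < r0" for y s
    proof -
      have "dist p y \<le> dist p x + dist x y" by metric
      then have "dist p y < r p" using that p(2) le by auto
      moreover have "s < r p" using that le pos by linarith
      ultimately have "ball (y + s *\<^sub>R e) (a p * s) \<subseteq> \<Omega>"
        using interior_coneD(2)[OF e that(1)] that(3) by blast
      moreover have "a0 * s \<le> a p * s" using that le by simp
      ultimately show ?thesis by (meson order_trans subset_ball)
    qed
    then have "interior_cone \<Omega> x r0 a0 e"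
      using interior_coneD(1)[OF e] by (simp add: interior_cone_def)
    then show "\<exists>e. interior_cone \<Omega> x r0 a0 e" ..
  qed
qed

text \<open>
  A segment between two nearby points may leave \<open>\<Omega>\<close>. The detour up along the common cone axis,
  across inside a ball of the cone, and down again stays in \<open>\<Omega>\<close> and is longer only by a constant
  factor. For points at a distance bounded below, boundedness of \<open>T\<close> suffices.
\<close>
lemma C1_imp_lipschitz:
  fixes \<Omega> :: "'a::euclidean_space set" and T :: "'a \<Rightarrow> 'b::real_normed_vector"
  assumes dom: "bounded_C2_domain \<Omega>" and T: "C2_closure \<Omega> T"
  obtains L where "L \<ge> 0" "\<And>x y. x \<in> \<Omega> \<Longrightarrow> y \<in> \<Omega> \<Longrightarrow> norm (T x - T y) \<le> L * norm (x - y)"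
proof -
  have comp: "compact (closure \<Omega>)" using dom by (simp add: bounded_C2_domain_def compact_closure)
  have op: "open \<Omega>" using dom by (simp add: bounded_C2_domain_def)
  obtain D where D: "continuous_on (closure \<Omega>) D" "\<And>x. x \<in> \<Omega> \<Longrightarrow> (T has_derivative blinfun_apply (D x)) (at x)"
    and Tc: "continuous_on (closure \<Omega>) T"
    using T unfolding C2_closure_def by blast
  have "bounded (D ` closure \<Omega>)" "bounded (T ` closure \<Omega>)"
    by (auto intro!: compact_imp_bounded compact_continuous_image D Tc comp)
  then obtain B M where B: "B > 0" "\<And>x. x \<in> closure \<Omega> \<Longrightarrow> norm (D x) \<le> B"
    and M: "M > 0" "\<And>x. x \<in> closure \<Omega> \<Longrightarrow> norm (T x) \<le> M"
    by (auto simp: bounded_pos)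
  have seg: "norm (T u - T v) \<le> B * norm (u - v)" if "closed_segment u v \<subseteq> \<Omega>" for u v
    by (rule differentiable_bound[where S="closed_segment u v" and f'="\<lambda>x. blinfun_apply (D x)"])
       (use that B(2) D(2) closure_subset[of \<Omega>] in \<open>auto simp: norm_blinfun.rep_eq[symmetric] intro:
           has_derivative_at_withinI\<close>)
  obtain r a where ra: "r > 0" "a > 0"
    and cone: "\<And>x. x \<in> closure \<Omega> \<Longrightarrow> \<exists>e. interior_cone \<Omega> x r a e"
    using uniform_cone[OF dom] by blast
  define \<delta> where "\<delta> = min r (a * r / 2)"
  have \<delta>: "\<delta> > 0" using ra by (auto simp: \<delta>_def)
  define L where "L = max (B * (1 + 4 / a)) (2 * M / \<delta>)"
  show thesis
  proof (rule that[of L])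
    show "L \<ge> 0" using B(1) ra unfolding L_def by (simp add: le_max_iff_disj)
    fix x y assume xy: "x \<in> \<Omega>" "y \<in> \<Omega>"
    then have xyc: "x \<in> closure \<Omega>" "y \<in> closure \<Omega>" using closure_subset by auto
    show "norm (T x - T y) \<le> L * norm (x - y)"
    proof (cases "norm (x - y) < \<delta> \<and> x \<noteq> y")
      case True
      \<comment> \<open>At this height the ball of radius \<open>a * s\<close> around \<open>x + s *\<^sub>R e\<close> contains
        \<open>y + s *\<^sub>R e\<close>.\<close>
      define s where "s = 2 * norm (x - y) / a"
      have s: "0 < s" "s < r" using True ra by (auto simp: s_def \<delta>_def field_simps)
      obtain e where "interior_cone \<Omega> x r a e" using cone[OF xyc(1)] by blast
      note e = interior_coneD[OF this]
      have up: "closed_segment w (w + s *\<^sub>R e) \<subseteq> \<Omega>" if w: "w \<in> \<Omega>" "dist x w < r" for w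
      proof
        fix z assume "z \<in> closed_segment w (w + s *\<^sub>R e)"
        then obtain u where u: "0 \<le> u" "u \<le> 1" "z = (1 - u) *\<^sub>R w + u *\<^sub>R (w + s *\<^sub>R e)"
          by (auto simp: closed_segment_def)
        then have z: "z = w + (u * s) *\<^sub>R e" by (simp add: algebra_simps)
        show "z \<in> \<Omega>"
        proof (cases "u = 0")
          case False
          then have "0 < u * s" "u * s < r" using u s by
              (auto intro: order.strict_trans1[OF mult_left_le_one_le])
          from e(2)[OF w this] have "z \<in> \<Omega>" using \<open>0 < u * s\<close> ra unfolding z by (auto simp: subset_iff)
          then show ?thesis .
        qed (use z w in auto)
      qed
      have wx: "dist x x < r" "dist x y < r" using ra True by (auto simp: \<delta>_def dist_norm)
      have "closed_segment (x + s *\<^sub>R e) (y + s *\<^sub>R e) \<subseteq> ball (x + s *\<^sub>R e) (a * s)"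
        by (rule closed_segment_subset) (use ra s True in \<open>auto simp: dist_norm s_def\<close>)
      also have "\<dots> \<subseteq> \<Omega>" using e(2)[OF xy(1) wx(1) s] .
      finally have "norm (T (x + s *\<^sub>R e) - T (y + s *\<^sub>R e)) \<le> B * norm (x - y)" using seg by fastforce
      moreover have "norm (T x - T (x + s *\<^sub>R e)) \<le> B * s" "norm (T y - T (y + s *\<^sub>R e)) \<le> B * s"
        using seg[OF up[OF xy(1) wx(1)]] seg[OF up[OF xy(2) wx(2)]] e(1) s by auto
      moreover have "norm (T x - T y) \<le> norm (T x - T (x + s *\<^sub>R e)) +
         norm (T (x + s *\<^sub>R e) - T (y + s *\<^sub>R e)) + norm (T y - T (y + s *\<^sub>R e))" by norm
      ultimately have "norm (T x - T y) \<le> B * norm (x - y) + 2 * B * s" by linarith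
      also have "\<dots> = B * (1 + 4 / a) * norm (x - y)" using ra by (simp add: s_def field_simps)
      also have "\<dots> \<le> L * norm (x - y)" unfolding L_def by (intro mult_right_mono) auto
      finally show ?thesis .
    next
      case False
      show ?thesis
      proof (cases "x = y")
        case False
        then have ge: "norm (x - y) \<ge> \<delta>" using \<open>\<not> (norm (x - y) < \<delta> \<and> x \<noteq> y)\<close> by auto
        have "norm (T x - T y) \<le> 2 * M" using norm_triangle_ineq4[of "T x" "T y"] M(2)[OF xyc(1)] M(2)[OF
            xyc(2)] by linarith
        also have "\<dots> = 2 * M / \<delta> * \<delta>" using \<delta> by simp
        also have "\<dots> \<le> L * norm (x - y)" using ge \<delta> M(1) unfolding L_def
            by (intro mult_mono) (auto simp: le_max_iff_disj)
        finally show ?thesis .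
      qed simp
    qed
  qed
qed

section \<open>Translations in the Lebesgue space L1, and logarithmic difference quotients\<close>

lemma
  fixes f :: "'a::euclidean_space \<Rightarrow> real"
  assumes [measurable]: "f \<in> borel_measurable borel"
  shows lborel_integral_translate: "(\<integral>x. f (x + v) \<partial>lborel) = (\<integral>x. f x \<partial>lborel)"
    and lborel_integrable_translate: "integrable lborel (\<lambda>x. f (x + v)) \<longleftrightarrow> integrable lborel f"
proof -
  have "(\<integral>x. f x \<partial>lborel) = (\<integral>x. f x \<partial>distr lborel borel ((+) v))" by (simp add: lborel_distr_plus)
  then show "(\<integral>x. f (x + v) \<partial>lborel) = (\<integral>x. f x \<partial>lborel)" by (simp add: integral_distr add.commute)
  have "integrable lborel f \<longleftrightarrow> integrable (distr lborel borel ((+) v)) f" by (simp add: lborel_distr_plus)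
  then show "integrable lborel (\<lambda>x. f (x + v)) \<longleftrightarrow> integrable lborel f"
      by (simp add: integrable_distr_eq add.commute)
qed

lemma lborel_integral_affine:
  fixes f :: "'a::euclidean_space \<Rightarrow> real"
  assumes [measurable]: "f \<in> borel_measurable borel" and h: "h > 0"
  shows "(\<integral>y. f y \<partial>lborel) = h ^ DIM('a) * (\<integral>z. f (x + h *\<^sub>R z) \<partial>lborel)"
proof -
  have "(\<integral>y. f y \<partial>lborel) = (\<integral>y. f y \<partial>density (distr lborel borel (\<lambda>z. x + h *\<^sub>R z)) (\<lambda>_. \<bar>h\<bar> ^ DIM('a)))"
    using lborel_affine[of h x] h by simp
  also have "\<dots> = (\<integral>z. h ^ DIM('a) * f (x + h *\<^sub>R z) \<partial>lborel)"
    using h by (subst integral_density) (auto simp: integral_distr)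
  finally show ?thesis by simp
qed

text \<open>
  The property passes to limits in \<open>L\<^sup>1\<close>, because translation preserves the integral. This reduces
  it to indicators of measurable sets and, by outer regularity, of open sets. For an open set the
  distance to the translate is determined by the measure of their overlap, which converges by
  dominated convergence since each point of an open set stays in it under small translations.
\<close>
lemma L1_translation_continuous:
  fixes f :: "'a::euclidean_space \<Rightarrow> real" and v :: "nat \<Rightarrow> 'a"
  assumes f: "integrable lborel f" and v: "v \<longlonglongrightarrow> 0"
  shows "(\<lambda>n. \<integral>x. \<bar>f (x + v n) - f x\<bar> \<partial>lborel) \<longlonglongrightarrow> 0"
proof -
  define P where "P f \<longleftrightarrow> (\<lambda>n. \<integral>x. \<bar>f (x + v n) - f x\<bar> \<partial>lborel) \<longlonglongrightarrow> 0" for f :: "'a \<Rightarrow> real"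
  have trans: "integrable lborel (\<lambda>x. f (x + u))" if "integrable lborel f" for f :: "'a \<Rightarrow> real" and u
    using that lborel_integrable_translate[of f u] by auto
  have approx: "P f" if f: "integrable lborel f" and
    ex: "\<And>\<epsilon>. \<epsilon> > 0 \<Longrightarrow> \<exists>g. integrable lborel g \<and> P g \<and> (\<integral>x. \<bar>f x - g x\<bar> \<partial>lborel) < \<epsilon>" for f
    unfolding P_def
  proof (rule LIMSEQ_I)
    fix \<epsilon> :: real assume "\<epsilon> > 0"
    then obtain g where g: "integrable lborel g" "P g" "(\<integral>x. \<bar>f x - g x\<bar> \<partial>lborel) < \<epsilon> / 3"
      using ex[of "\<epsilon> / 3"] by auto
    obtain N where N: "\<And>n. n \<ge> N \<Longrightarrow> (\<integral>x. \<bar>g (x + v n) - g x\<bar> \<partial>lborel) < \<epsilon> / 3"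
      using LIMSEQ_D[OF g(2)[unfolded P_def], of "\<epsilon> / 3"] \<open>\<epsilon> > 0\<close> by auto
    have "norm ((\<integral>x. \<bar>f (x + v n) - f x\<bar> \<partial>lborel) - 0) < \<epsilon>" if "n \<ge> N" for n
    proof -
      have [measurable]: "f \<in> borel_measurable borel" "g \<in> borel_measurable borel" using f g by auto
      have "(\<integral>x. \<bar>f (x + v n) - f x\<bar> \<partial>lborel) \<le>
        (\<integral>x. \<bar>f (x + v n) - g (x + v n)\<bar> + \<bar>g (x + v n) - g x\<bar> + \<bar>f x - g x\<bar> \<partial>lborel)"
        by (rule integral_mono) (use f g(1) trans in \<open>auto intro!: Bochner_Integration.integrable_add
            integrable_abs Bochner_Integration.integrable_diff\<close>)
      also have "\<dots> = (\<integral>x. \<bar>f (x + v n) - g (x + v n)\<bar> \<partial>lborel) + (\<integral>x. \<bar>g (x + v n) - g x\<bar> \<partial>lborel) +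
          (\<integral>x. \<bar>f x - g x\<bar> \<partial>lborel)"
        using f g(1) trans by simp
      also have "(\<integral>x. \<bar>f (x + v n) - g (x + v n)\<bar> \<partial>lborel) = (\<integral>x. \<bar>f x - g x\<bar> \<partial>lborel)"
        by (rule lborel_integral_translate) measurable
      also have "(\<integral>x. \<bar>f x - g x\<bar> \<partial>lborel) + (\<integral>x. \<bar>g (x + v n) - g x\<bar> \<partial>lborel) + (\<integral>x. \<bar>f x - g x\<bar> \<partial>lborel) < \<epsilon>"
        using N[OF that] g(3) by linarith
      finally show ?thesis by simp
    qed
    then show "\<exists>N. \<forall>n\<ge>N. norm ((\<integral>x. \<bar>f (x + v n) - f x\<bar> \<partial>lborel) - 0) < \<epsilon>" by blast
  qed
  have "P f" using f
  proof (induction rule: integrable_induct)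
    case (base A c)
    have P_open: "P (\<lambda>x. indicator U x * c)" if U: "open U" "emeasure lborel U < \<infinity>" for U
    proof -
      let ?I = "indicator U :: 'a \<Rightarrow> real"
      have [measurable]: "U \<in> sets borel" using U by simp
      have iU: "integrable lborel ?I" using U by (simp add: integrable_indicator_iff)
      have iUU: "integrable lborel (\<lambda>x. ?I (x + v n) * ?I x)" for n
      proof (rule Bochner_Integration.integrable_bound[OF iU])
        show "AE x in lborel. norm (?I (x + v n) * ?I x) \<le> norm (?I x)" by (auto simp: indicator_def)
      qed measurable
      have "(\<lambda>n. \<integral>x. ?I (x + v n) * ?I x \<partial>lborel) \<longlonglongrightarrow> (\<integral>x. ?I x \<partial>lborel)"
      proof (rule integral_dominated_convergence[where w="?I"])
        show "AE x in lborel. norm (?I (x + v n) * ?I x) \<le> ?I x" for n by (auto simp: indicator_def)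
        show "AE x in lborel. (\<lambda>n. ?I (x + v n) * ?I x) \<longlonglongrightarrow> ?I x"
        proof (rule AE_I2)
          fix x
          show "(\<lambda>n. ?I (x + v n) * ?I x) \<longlonglongrightarrow> ?I x"
          proof (cases "x \<in> U")
            case True
            have "(\<lambda>n. x + v n) \<longlonglongrightarrow> x + 0" by (intro tendsto_intros v)
            then have "\<forall>\<^sub>F n in sequentially. x + v n \<in> U" using True U(1) by (simp add: topological_tendstoD)
            then have "\<forall>\<^sub>F n in sequentially. ?I (x + v n) * ?I x = ?I x" by eventually_elim (use True in auto)
            then show ?thesis by (simp add: tendsto_eventually)
          qed simp
        qed
      qed (simp_all add: iU)
      then have "(\<lambda>n. \<bar>c\<bar> * (2 * (\<integral>x. ?I x \<partial>lborel) - 2 * (\<integral>x. ?I (x + v n) * ?I x \<partial>lborel))) \<longlonglongrightarrow>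
         \<bar>c\<bar> * (2 * (\<integral>x. ?I x \<partial>lborel) - 2 * (\<integral>x. ?I x \<partial>lborel))"
        by (intro tendsto_intros)
      moreover have "(\<integral>x. \<bar>?I (x + v n) * c - ?I x * c\<bar> \<partial>lborel)
          = \<bar>c\<bar> * (2 * (\<integral>x. ?I x \<partial>lborel) - 2 * (\<integral>x. ?I (x + v n) * ?I x \<partial>lborel))" for n
      proof -
        have "\<bar>?I (x + v n) * c - ?I x * c\<bar> = \<bar>c\<bar> * (?I (x + v n) + ?I x - 2 * (?I (x + v n) * ?I x))" for x
          by (auto simp: indicator_def)
        moreover have "(\<integral>x. ?I (x + v n) \<partial>lborel) = (\<integral>x. ?I x \<partial>lborel)"
          by (rule lborel_integral_translate) (use U in auto)
        ultimately show ?thesis using iU iUU trans[OF iU] by simp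
      qed
      ultimately show "P (\<lambda>x. indicator U x * c)" unfolding P_def by simp
    qed
    have "P (\<lambda>x. indicator A x * c)"
    proof (rule approx)
      show "integrable lborel (\<lambda>x. indicator A x * c)" using base by (simp add: integrable_indicator_iff)
      fix \<epsilon> :: real assume "\<epsilon> > 0"
      then have "\<epsilon> / (\<bar>c\<bar> + 1) > 0" by simp
      have "A \<in> sets lebesgue" using base by auto
      then obtain U where U: "open U" "A \<subseteq> U" "emeasure lebesgue (U - A) < \<epsilon> / (\<bar>c\<bar> + 1)"
        using sets_lebesgue_outer_open[OF _ \<open>\<epsilon> / (\<bar>c\<bar> + 1) > 0\<close>] by metis
      have [measurable]: "A \<in> sets borel" "U \<in> sets borel" using base U by auto
      have em: "emeasure lborel (U - A) < ennreal (\<epsilon> / (\<bar>c\<bar> + 1))" using U by simp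
      then have fin: "emeasure lborel (U - A) < \<infinity>" by (metis ennreal_less_top infinity_ennreal_def
          order_less_trans)
      have "emeasure lborel U \<le> emeasure lborel A + emeasure lborel (U - A)"
        using U(2) emeasure_subadditive[of A lborel "U - A"] by (simp add: Un_absorb1)
      also have "\<dots> < \<infinity>" using fin base by simp
      finally have Ufin: "emeasure lborel U < \<infinity>" .
      have "measure lborel (U - A) < \<epsilon> / (\<bar>c\<bar> + 1)"
        using em \<open>\<epsilon> / (\<bar>c\<bar> + 1) > 0\<close> fin by (subst (asm) emeasure_eq_ennreal_measure)
            (auto simp: ennreal_less_iff)
      then have small: "\<bar>c\<bar> * measure lborel (U - A) < \<epsilon>"
        using \<open>\<epsilon> > 0\<close> add_increasing[OF measure_nonneg[of lborel "U - A"] order_refl] by (simp add: field_simps)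
          (meson add_increasing measure_nonneg order_le_less_trans order_refl)
      have "(\<integral>x. \<bar>indicator A x * c - indicator U x * c\<bar> \<partial>lborel) = (\<integral>x. \<bar>c\<bar> * indicator (U - A) x \<partial>lborel)"
        using U(2) by (intro Bochner_Integration.integral_cong) (auto simp: indicator_def)
      also have "\<dots> < \<epsilon>" using small by simp
      finally have "(\<integral>x. \<bar>indicator A x * c - indicator U x * c\<bar> \<partial>lborel) < \<epsilon>" .
      moreover have "integrable lborel (\<lambda>x. indicator U x * c)" using Ufin
          by (simp add: integrable_indicator_iff)
      ultimately show "\<exists>g. integrable lborel g \<and> P g \<and> (\<integral>x. \<bar>indicator A x * c - g x\<bar> \<partial>lborel) < \<epsilon>"
        using P_open[OF U(1) Ufin] by blast
    qed
    then show ?case by simp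
  next
    case (add f g)
    have "(\<lambda>n. (\<integral>x. \<bar>f (x + v n) - f x\<bar> \<partial>lborel) + (\<integral>x. \<bar>g (x + v n) - g x\<bar> \<partial>lborel)) \<longlonglongrightarrow> 0"
      using tendsto_add[OF add.IH[unfolded P_def]] by simp
    then show ?case unfolding P_def
    proof (rule tendsto_sandwich[OF _ _ tendsto_const, rotated 2])
      show "\<forall>\<^sub>F n in sequentially. (\<integral>x. \<bar>f (x + v n) + g (x + v n) - (f x + g x)\<bar> \<partial>lborel)
          \<le> (\<integral>x. \<bar>f (x + v n) - f x\<bar> \<partial>lborel) + (\<integral>x. \<bar>g (x + v n) - g x\<bar> \<partial>lborel)"
      proof (intro always_eventually allI)
        fix n
        have i: "integrable lborel (\<lambda>x. \<bar>f (x + v n) - f x\<bar>)" "integrable lborel (\<lambda>x. \<bar>g (x + v n) - g x\<bar>)"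
          using add.hyps trans by auto
        have "(\<integral>x. \<bar>f (x + v n) + g (x + v n) - (f x + g x)\<bar> \<partial>lborel)
            \<le> (\<integral>x. \<bar>f (x + v n) - f x\<bar> + \<bar>g (x + v n) - g x\<bar> \<partial>lborel)"
          by (rule integral_mono) (use i add.hyps trans in auto)
        then show "(\<integral>x. \<bar>f (x + v n) + g (x + v n) - (f x + g x)\<bar> \<partial>lborel)
            \<le> (\<integral>x. \<bar>f (x + v n) - f x\<bar> \<partial>lborel) + (\<integral>x. \<bar>g (x + v n) - g x\<bar> \<partial>lborel)"
          using i by simp
      qed
    qed (auto intro!: always_eventually)
  next
    case (lim f s)
    show ?case
    proof (rule approx)
      fix \<epsilon> :: real assume "\<epsilon> > 0"
      have "(\<lambda>i. \<integral>x. \<bar>f x - s i x\<bar> \<partial>lborel) \<longlonglongrightarrow> (\<integral>x. 0 \<partial>(lborel :: 'a measure))"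
      proof (rule integral_dominated_convergence[where w="\<lambda>x. 3 * \<bar>f x\<bar>"])
        show "AE x in lborel. (\<lambda>i. \<bar>f x - s i x\<bar>) \<longlonglongrightarrow> 0"
        proof (rule AE_I2)
          fix x :: 'a
          have "(\<lambda>i. \<bar>f x - s i x\<bar>) \<longlonglongrightarrow> \<bar>f x - f x\<bar>" using lim(2)[of x] by (intro tendsto_intros) auto
          then show "(\<lambda>i. \<bar>f x - s i x\<bar>) \<longlonglongrightarrow> 0" by simp
        qed
        show "AE x in lborel. norm \<bar>f x - s i x\<bar> \<le> 3 * \<bar>f x\<bar>" for i
          using lim(3)[of _ i] by (intro AE_I2) (smt (verit) real_norm_def space_lborel UNIV_I)
      qed (use lim in auto)
      then have "(\<lambda>i. \<integral>x. \<bar>f x - s i x\<bar> \<partial>lborel) \<longlonglongrightarrow> 0" by simp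
      from order_tendstoD(2)[OF this \<open>\<epsilon> > 0\<close>] obtain i where "(\<integral>x. \<bar>f x - s i x\<bar> \<partial>lborel) < \<epsilon>"
        by (auto simp: eventually_sequentially)
      then show "\<exists>g. integrable lborel g \<and> P g \<and> (\<integral>x. \<bar>f x - g x\<bar> \<partial>lborel) < \<epsilon>" using lim(1) lim.IH by blast
    qed (use lim in auto)
  qed
  then show ?thesis by (simp add: P_def)
qed

text \<open>
  With \<open>v\<close> the squared increment of \<open>T\<close>, the logarithm \<open>ln (1 + v)\<close> lies between \<open>v - v\<^sup>2\<close> and
  \<open>v\<close>, and \<open>v\<close> is of order \<open>h\<^sup>2\<close>.
\<close>
lemma ln_difference_quotient_limit:
  fixes T :: "'a::real_normed_vector \<Rightarrow> 'b::real_normed_vector"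
  assumes T: "(T has_derivative D) (at x)" and h: "h \<longlonglongrightarrow> 0" "\<And>n. h n > 0"
  shows "(\<lambda>n. ln (1 + (norm (T x - T (x + h n *\<^sub>R z)))\<^sup>2) / (h n)\<^sup>2) \<longlonglongrightarrow> (norm (D z))\<^sup>2"
proof -
  define v where "v n = (norm (T x - T (x + h n *\<^sub>R z)))\<^sup>2" for n
  have lin: "linear D" using T by (rule has_derivative_linear)
  have q: "(\<lambda>n. (T (x + h n *\<^sub>R z) - T x) /\<^sub>R h n) \<longlonglongrightarrow> D z"
  proof -
    have "((\<lambda>t. x + t *\<^sub>R z) has_derivative (\<lambda>t. t *\<^sub>R z)) (at 0)"
      by (auto intro!: derivative_eq_intros)
    then have "((\<lambda>t. T (x + t *\<^sub>R z)) has_derivative (\<lambda>t. D (t *\<^sub>R z))) (at 0)"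
      by (rule has_derivative_compose) (use T in simp)
    then have "((\<lambda>t. norm (T (x + t *\<^sub>R z) - T x - D (t *\<^sub>R z)) / norm t) \<longlongrightarrow> 0) (at 0)"
      by (simp add: has_derivative_at)
    moreover have "\<forall>\<^sub>F t in at 0. norm (T (x + t *\<^sub>R z) - T x - D (t *\<^sub>R z)) / norm t =
        norm ((T (x + t *\<^sub>R z) - T x) /\<^sub>R t - D z)"
      unfolding eventually_at_filter
    proof (intro always_eventually allI impI)
      fix t :: real assume t: "t \<noteq> 0"
      have "(T (x + t *\<^sub>R z) - T x) /\<^sub>R t - D z = (T (x + t *\<^sub>R z) - T x - D (t *\<^sub>R z)) /\<^sub>R t"
        using t by (simp add: linear_scale[OF lin] scaleR_diff_right)
      then show "norm (T (x + t *\<^sub>R z) - T x - D (t *\<^sub>R z)) / norm t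
          = norm ((T (x + t *\<^sub>R z) - T x) /\<^sub>R t - D z)"
        by (simp add: divide_inverse mult.commute)
    qed
    ultimately have "((\<lambda>t. norm ((T (x + t *\<^sub>R z) - T x) /\<^sub>R t - D z)) \<longlongrightarrow> 0) (at 0)"
      by (rule Lim_transform_eventually)
    then have "((\<lambda>t. (T (x + t *\<^sub>R z) - T x) /\<^sub>R t) \<longlongrightarrow> D z) (at 0)"
      by (rule LIM_zero_cancel[OF tendsto_norm_zero_cancel])
    moreover have "filterlim h (at 0) sequentially"
      using h by (simp add: filterlim_at less_imp_neq[symmetric])
    ultimately show ?thesis by (rule filterlim_compose)
  qed
  then have "(\<lambda>n. (norm ((T (x + h n *\<^sub>R z) - T x) /\<^sub>R h n))\<^sup>2) \<longlonglongrightarrow> (norm (D z))\<^sup>2"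
    by (intro tendsto_intros)
  moreover have "(norm ((T (x + h n *\<^sub>R z) - T x) /\<^sub>R h n))\<^sup>2 = v n / (h n)\<^sup>2" for n
    using h(2)[of n] by (simp only: v_def norm_scaleR norm_minus_commute[of "T x"])
      (simp add: divide_inverse power_mult_distrib power_inverse mult.commute)
  ultimately have vh: "(\<lambda>n. v n / (h n)\<^sup>2) \<longlonglongrightarrow> (norm (D z))\<^sup>2" by simp
  have "(\<lambda>n. v n / (h n)\<^sup>2 * (h n)\<^sup>2) \<longlonglongrightarrow> (norm (D z))\<^sup>2 * 0\<^sup>2"
    by (intro tendsto_intros vh h)
  moreover have "v n / (h n)\<^sup>2 * (h n)\<^sup>2 = v n" for n using h(2)[of n] by simp
  ultimately have v0: "v \<longlonglongrightarrow> 0" by simp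
  have "\<forall>\<^sub>F n in sequentially. v n < 1" using v0 by (rule order_tendstoD) simp
  then have lower: "\<forall>\<^sub>F n in sequentially. v n / (h n)\<^sup>2 * (1 - v n) \<le> ln (1 + v n) / (h n)\<^sup>2"
  proof eventually_elim
    case (elim n)
    then have "v n - (v n)\<^sup>2 \<le> ln (1 + v n)" by (intro ln_one_plus_pos_lower_bound) (auto simp: v_def)
    then have "(v n * (1 - v n)) / (h n)\<^sup>2 \<le> ln (1 + v n) / (h n)\<^sup>2"
      by (intro divide_right_mono) (auto simp: power2_eq_square algebra_simps)
    then show ?case by simp
  qed
  have upper: "\<forall>\<^sub>F n in sequentially. ln (1 + v n) / (h n)\<^sup>2 \<le> v n / (h n)\<^sup>2"
    by (intro always_eventually allI divide_right_mono ln_add_one_self_le_self) (auto simp: v_def)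
  have "(\<lambda>n. v n / (h n)\<^sup>2 * (1 - v n)) \<longlonglongrightarrow> (norm (D z))\<^sup>2 * (1 - 0)"
    by (intro tendsto_intros vh v0)
  then have "(\<lambda>n. ln (1 + v n) / (h n)\<^sup>2) \<longlonglongrightarrow> (norm (D z))\<^sup>2"
    using tendsto_sandwich[OF lower upper _ vh] by simp
  then show ?thesis by (simp add: v_def)
qed

section \<open>The boundary is negligible\<close>

text \<open>
  A short translation along the cone axis moves a small boundary piece into the open set \<open>\<Omega>\<close>, hence
  off itself. The \<open>L\<^sup>1\<close> distance between its indicator and the translate is then at least its
  measure, and it tends to \<open>0\<close> by continuity of translations.
\<close>
lemma frontier_null_set:
  fixes \<Omega> :: "'a::euclidean_space set"
  assumes dom: "bounded_C2_domain \<Omega>"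
  shows "frontier \<Omega> \<in> null_sets lborel"
proof -
  have comp: "compact (closure \<Omega>)" and op: "open \<Omega>"
    using dom by (simp_all add: bounded_C2_domain_def compact_closure)
  obtain r a where ra: "r > 0" "a > 0"
    and cone: "\<And>x. x \<in> closure \<Omega> \<Longrightarrow> \<exists>e. interior_cone \<Omega> x r a e"
    using uniform_cone[OF dom] by blast
  have null: "frontier \<Omega> \<inter> ball p r \<in> null_sets lborel" if p: "p \<in> closure \<Omega>" for p
  proof -
    obtain e where "interior_cone \<Omega> p r a e" using cone[OF p] by blast
    note e = interior_coneD[OF this]
    define F where "F = frontier \<Omega> \<inter> ball p r"
    have F[measurable]: "F \<in> sets borel" unfolding F_def by (intro sets.Int) auto
    have Fb: "bounded F" unfolding F_def by (rule bounded_subset[of "ball p r"]) auto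
    then have fin: "emeasure lborel F < \<infinity>" by (rule emeasure_bounded_finite)
    have out: "y + s *\<^sub>R e \<notin> F" if y: "y \<in> F" and s: "0 < s" "s < r" for y s
    proof -
      have "y \<in> closure \<Omega>" using y by (auto simp: F_def frontier_def)
      moreover have "min (a * s) (r - dist p y) > 0" using y s ra by (auto simp: F_def)
      ultimately obtain y' where y': "y' \<in> \<Omega>" "dist y' y < min (a * s) (r - dist p y)"
        by (meson closure_approachable)
      have "dist p y' \<le> dist p y + dist y' y" by metric
      then have "ball (y' + s *\<^sub>R e) (a * s) \<subseteq> \<Omega>" using y' s by (intro e(2)) auto
      moreover have "y + s *\<^sub>R e \<in> ball (y' + s *\<^sub>R e) (a * s)" using y'(2) by (simp add: dist_norm)
      ultimately have "y + s *\<^sub>R e \<in> \<Omega>" by blast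
      then show ?thesis using op by (auto simp: F_def frontier_def interior_open)
    qed
    define s where "s n = r / real (n + 2)" for n
    have s: "0 < s n" "s n < r" for n
      using ra divide_strict_left_mono[of 1 "real (n + 2)" r] by (auto simp: s_def)
    have "(\<lambda>n. r * (1 / real (n + 2))) \<longlonglongrightarrow> r * 0"
      by (intro tendsto_mult tendsto_const LIMSEQ_ignore_initial_segment lim_1_over_n)
    then have "(\<lambda>n. s n *\<^sub>R e) \<longlonglongrightarrow> 0 *\<^sub>R e" unfolding s_def by (intro tendsto_intros) simp
    then have v: "(\<lambda>n. s n *\<^sub>R e) \<longlonglongrightarrow> 0" by simp
    let ?I = "indicator F :: 'a \<Rightarrow> real"
    have iF: "integrable lborel ?I" using fin by (simp add: integrable_indicator_iff)
    have iF': "integrable lborel (\<lambda>x. ?I (x + u))" for u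
      using iF lborel_integrable_translate[of ?I u] by simp
    have "measure lborel F \<le> (\<integral>x. \<bar>?I (x + s n *\<^sub>R e) - ?I x\<bar> \<partial>lborel)" for n
    proof -
      have "(\<integral>x. ?I x \<partial>lborel) \<le> (\<integral>x. \<bar>?I (x + s n *\<^sub>R e) - ?I x\<bar> \<partial>lborel)"
      proof (rule integral_mono[OF iF])
        show "integrable lborel (\<lambda>x. \<bar>?I (x + s n *\<^sub>R e) - ?I x\<bar>)" using iF iF' by simp
        show "?I x \<le> \<bar>?I (x + s n *\<^sub>R e) - ?I x\<bar>" for x
          using out[OF _ s, of x n] by (auto simp: indicator_def)
      qed
      then show ?thesis by simp
    qed
    then have "measure lborel F \<le> 0"
      using L1_translation_continuous[OF iF v] by (intro LIMSEQ_le_const) auto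
    then have "measure lborel F = 0" by (simp add: measure_le_0_iff)
    then have "emeasure lborel F = 0" using fin by (simp add: emeasure_eq_ennreal_measure less_top)
    then show ?thesis unfolding F_def[symmetric] by (auto intro: null_setsI)
  qed
  obtain C where C: "C \<subseteq> closure \<Omega>" "finite C" "closure \<Omega> \<subseteq> (\<Union>p\<in>C. ball p r)"
    by (rule compactE_image[OF comp, where f="\<lambda>p. ball p r" and C="closure \<Omega>"]) (use ra in auto)
  have "(\<Union>p\<in>C. frontier \<Omega> \<inter> ball p r) \<in> null_sets lborel"
    using C null by (intro null_sets.finite_UN) auto
  moreover have "frontier \<Omega> = (\<Union>p\<in>C. frontier \<Omega> \<inter> ball p r)"
    using C(3) by (auto simp: frontier_def)
  ultimately show ?thesis by simp
qed

section \<open>Gaussian moments\<close>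

lemma
  fixes f :: "'a::euclidean_space \<Rightarrow> real \<Rightarrow> real"
  assumes f: "\<And>b. b \<in> Basis \<Longrightarrow> integrable lborel (f b)"
  shows lborel_integrable_prod: "integrable lborel (\<lambda>z. \<Prod>b\<in>Basis. f b (z \<bullet> b))"
    and lborel_integral_prod: "(\<integral>z. (\<Prod>b\<in>Basis. f b (z \<bullet> b)) \<partial>lborel) = (\<Prod>b\<in>Basis. \<integral>x. f b x \<partial>lborel)"
proof -
  interpret product_sigma_finite "\<lambda>_::'a. lborel :: real measure" by standard
  let ?S = "\<lambda>g. \<Sum>b\<in>(Basis :: 'a set). g b *\<^sub>R b"
  have [measurable]: "f b \<in> borel_measurable borel" if "b \<in> Basis" for b using f[OF that] by auto
  have m: "(\<lambda>z. \<Prod>b\<in>Basis. f b (z \<bullet> b)) \<in> borel_measurable borel" by measurable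
  have S: "?S \<in> (\<Pi>\<^sub>M b\<in>Basis. lborel) \<rightarrow>\<^sub>M borel" by measurable
  have eq: "(\<Prod>b\<in>Basis. f b (?S g \<bullet> b)) = (\<Prod>b\<in>Basis. f b (g b))" for g by (intro prod.cong) auto
  show "integrable lborel (\<lambda>z. \<Prod>b\<in>Basis. f b (z \<bullet> b))"
    unfolding lborel_eq[where 'a='a] using m S product_integrable_prod[OF finite_Basis f]
        by (simp add: integrable_distr_eq eq)
  show "(\<integral>z. (\<Prod>b\<in>Basis. f b (z \<bullet> b)) \<partial>lborel) = (\<Prod>b\<in>Basis. \<integral>x. f b x \<partial>lborel)"
    unfolding lborel_eq[where 'a='a] using m S product_integral_prod[OF finite_Basis f]
        by (simp add: integral_distr eq)
qed

text \<open>Left without its normalising constant, which cancels in every ratio below.\<close>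
definition gauss :: "real \<Rightarrow> 'a::euclidean_space \<Rightarrow> real" where
  "gauss s z = exp (- (norm z)\<^sup>2 / (2 * s\<^sup>2))"

lemma gauss_measurable[measurable]: "gauss s \<in> borel_measurable borel"
  unfolding gauss_def by measurable

lemma gauss_eq_prod:
  fixes z :: "'a::euclidean_space"
  assumes s: "s > 0"
  shows "gauss s z = sqrt (2 * pi * s\<^sup>2) ^ DIM('a) * (\<Prod>b\<in>Basis. normal_density 0 s (z \<bullet> b))"
proof -
  have "(norm z)\<^sup>2 = (\<Sum>b\<in>Basis. (z \<bullet> b)\<^sup>2)"
    unfolding power2_norm_eq_inner by (subst euclidean_inner) (simp add: power2_eq_square)
  then have "gauss s z = (\<Prod>b\<in>Basis. exp (- (z \<bullet> b)\<^sup>2 / (2 * s\<^sup>2)))"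
    by (simp add: gauss_def exp_sum[symmetric] sum_divide_distrib sum_negf)
  also have "\<dots> = (\<Prod>b\<in>Basis. sqrt (2 * pi * s\<^sup>2) * normal_density 0 s (z \<bullet> b))"
    using s by (intro prod.cong) (auto simp: normal_density_def)
  finally show ?thesis by (simp add: prod.distrib)
qed

text \<open>
  The Gaussian is a product of one-dimensional normal densities; inserting linear factors
  changes only the factors at \<open>b\<close> and \<open>c\<close>.
\<close>
lemma gauss_moments:
  fixes b c :: "'a::euclidean_space"
  assumes s: "s > 0" and bc: "b \<in> Basis" "c \<in> Basis"
  shows "integrable lborel (gauss s :: 'a \<Rightarrow> real)"
    and "integrable lborel (\<lambda>z. gauss s z * ((z \<bullet> b) * (z \<bullet> c)))"
    and "(\<integral>z. gauss s z * ((z \<bullet> b) * (z \<bullet> c)) \<partial>lborel) = (if b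
        = c then s\<^sup>2 else 0) * (\<integral>z. gauss s z \<partial>(lborel :: 'a measure))"
proof -
  let ?c = "sqrt (2 * pi * s\<^sup>2) ^ DIM('a)"
  let ?n = "normal_density 0 s"
  have i0: "has_bochner_integral lborel ?n 1"
    using s by (simp add: has_bochner_integral_iff)
  have i1: "has_bochner_integral lborel (\<lambda>x. ?n x * x) 0" using normal_moment_nz_1[OF s, of 0] by simp
  have i2: "has_bochner_integral lborel (\<lambda>x. ?n x * (x * x)) (s\<^sup>2)"
    using normal_moment_even[OF s, of 0 1] s by (simp add: power2_eq_square fact_numeral)
  define f where "f d x = ?n x * ((if d = b then x else 1) * (if d = c then x else 1))" for d x
  have f: "has_bochner_integral lborel (f d) (if d = b \<and> d = c then s\<^sup>2 else if d = b \<or> d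
      = c then 0 else 1)" for d
    unfolding f_def using i0 i1 i2 by auto
  then have fi: "integrable lborel (f d)" for d by (auto simp: has_bochner_integral_iff split: if_splits)
  have prod: "gauss s z * ((z \<bullet> b) * (z \<bullet> c)) = ?c * (\<Prod>d\<in>Basis. f d (z \<bullet> d))" for z
  proof -
    have "(\<Prod>d\<in>Basis. f d (z \<bullet> d)) = (\<Prod>d\<in>Basis. ?n (z \<bullet> d)) * ((z \<bullet> b) * (z \<bullet> c))"
      unfolding f_def prod.distrib using bc by (simp add: prod.If_cases prod.delta)
    then show ?thesis using s by (simp add: gauss_eq_prod)
  qed
  have g: "gauss s = (\<lambda>z::'a. ?c * (\<Prod>b\<in>Basis. ?n (z \<bullet> b)))" using gauss_eq_prod[OF s] by blast
  show 1: "integrable lborel (gauss s :: 'a \<Rightarrow> real)" unfolding g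
    using i0 by (intro Bochner_Integration.integrable_mult_right lborel_integrable_prod)
        (auto simp: has_bochner_integral_iff)
  have I1: "(\<integral>z. gauss s z \<partial>(lborel :: 'a measure)) = ?c"
    unfolding g using s lborel_integral_prod[of "\<lambda>_::'a. ?n"] by simp
  show "integrable lborel (\<lambda>z. gauss s z * ((z \<bullet> b) * (z \<bullet> c)))" unfolding prod
    by (intro Bochner_Integration.integrable_mult_right lborel_integrable_prod fi)
  have "(\<integral>z. gauss s z * ((z \<bullet> b) * (z \<bullet> c)) \<partial>lborel) = ?c * (\<Prod>d\<in>Basis. \<integral>x. f d x \<partial>lborel)"
    unfolding prod by (simp add: lborel_integral_prod fi)
  also have "(\<Prod>d\<in>Basis. \<integral>x. f d x \<partial>lborel) = (\<Prod>d\<in>Basis. if d = b \<and> d = c then s\<^sup>2 else if d = b \<or> d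
      = c then 0 else 1)"
    using f by (intro prod.cong) (auto simp: has_bochner_integral_iff)
  also have "\<dots> = (if b = c then s\<^sup>2 else 0)"
  proof (cases "b = c")
    case True
    then have "(\<Prod>d\<in>Basis. if d = b \<and> d = c then s\<^sup>2 else if d = b \<or> d = c then 0 else 1) = (\<Prod>d\<in>Basis. if d
        = b then s\<^sup>2 else 1)"
      by (intro prod.cong) auto
    then show ?thesis using True bc by simp
  next
    case False
    then show ?thesis using bc(1) by (auto intro!: prod_zero bexI[of _ b])
  qed
  finally show "(\<integral>z. gauss s z * ((z \<bullet> b) * (z \<bullet> c)) \<partial>lborel) = (if b
      = c then s\<^sup>2 else 0) * (\<integral>z. gauss s z \<partial>(lborel :: 'a measure))"
    unfolding I1 by simp
qed

lemma gauss_integrable_moment2: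
  assumes s: "s > 0"
  shows "integrable lborel (\<lambda>z::'a::euclidean_space. gauss s z * (norm z)\<^sup>2)"
proof -
  have "gauss s z * (norm z)\<^sup>2 = (\<Sum>b\<in>Basis. gauss s z * ((z \<bullet> b) * (z \<bullet> b)))" for z :: 'a
    unfolding power2_norm_eq_inner by (subst euclidean_inner) (simp add: sum_distrib_left)
  then show ?thesis by (simp add: gauss_moments(2)[OF s] Bochner_Integration.integrable_sum)
qed

text \<open>
  Off-diagonal moments vanish and the diagonal ones are all \<open>s\<^sup>2\<close>, so \<open>|A z|\<^sup>2\<close> has Gaussian mean
  \<open>s\<^sup>2\<close> times the squared Hilbert-Schmidt norm of \<open>A\<close>. This is where the Dirichlet energy in the
  limit comes from.
\<close>
lemma gauss_quadratic_form:
  fixes A :: "'a::euclidean_space \<Rightarrow> 'b::real_inner"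
  assumes s: "s > 0" and A: "linear A"
  shows "integrable lborel (\<lambda>z. gauss s z * ((norm (A z))\<^sup>2 - s\<^sup>2 * (\<Sum>b\<in>Basis. (norm (A b))\<^sup>2)))"
    and "(\<integral>z. gauss s z * ((norm (A z))\<^sup>2 - s\<^sup>2 * (\<Sum>b\<in>Basis. (norm (A b))\<^sup>2)) \<partial>lborel) = 0"
proof -
  have A_expand: "A z = (\<Sum>b\<in>Basis. (z \<bullet> b) *\<^sub>R A b)" for z
  proof -
    have "A z = A (\<Sum>b\<in>Basis. (z \<bullet> b) *\<^sub>R b)" by (simp add: euclidean_representation)
    also have "\<dots> = (\<Sum>b\<in>Basis. (z \<bullet> b) *\<^sub>R A b)" using A by (simp only: linear_sum linear_scale)
    finally show ?thesis .
  qed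
  have sq: "(norm (A z))\<^sup>2 = (\<Sum>b\<in>Basis. \<Sum>c\<in>Basis. (z \<bullet> b) * (z \<bullet> c) * (A b \<bullet> A c))" for z
  proof -
    have "A z \<bullet> A z = (\<Sum>b\<in>Basis. (z \<bullet> b) *\<^sub>R A b) \<bullet> (\<Sum>c\<in>Basis. (z \<bullet> c) *\<^sub>R A c)"
      by (rule arg_cong2[where f=inner, OF A_expand A_expand])
    also have "\<dots> = (\<Sum>b\<in>Basis. \<Sum>c\<in>Basis. (z \<bullet> b) * (z \<bullet> c) * (A b \<bullet> A c))"
      by (simp only: inner_sum_left)
        (intro sum.cong refl, simp add: inner_sum_right sum_distrib_left mult_ac)
    finally show ?thesis unfolding power2_norm_eq_inner .
  qed
  have eq: "gauss s z * (norm (A z))\<^sup>2 = (\<Sum>b\<in>Basis. \<Sum>c\<in>Basis. (A b \<bullet> A c) * (gauss s z * ((z \<bullet> b)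
      * (z \<bullet> c))))" for z
    unfolding sq by (simp add: sum_distrib_left mult_ac)
  note m = gauss_moments[OF s]
  have g: "integrable lborel (gauss s :: 'a \<Rightarrow> real)" using m(1) SOME_Basis by blast
  have i: "integrable lborel (\<lambda>z. gauss s z * (norm (A z))\<^sup>2)"
    unfolding eq by (intro Bochner_Integration.integrable_sum Bochner_Integration.integrable_mult_right m(2))
  have "(\<integral>z. gauss s z * (norm (A z))\<^sup>2 \<partial>lborel) = (\<Sum>b\<in>Basis. \<Sum>c\<in>Basis. (A b \<bullet> A c) * (\<integral>z. gauss s z
      * ((z \<bullet> b) * (z \<bullet> c)) \<partial>lborel))"
    unfolding eq
  proof (subst Bochner_Integration.integral_sum, goal_cases)
    case (1 b)
    then show ?case
      by (intro Bochner_Integration.integrable_sum Bochner_Integration.integrable_mult_right m(2))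
  next
    case 2
    show ?case
    proof (intro sum.cong refl, subst Bochner_Integration.integral_sum)
      show "integrable lborel (\<lambda>z. (A b \<bullet> A c) * (gauss s z * ((z \<bullet> b) * (z \<bullet> c))))"
        if "b \<in> Basis" "c \<in> Basis" for b c using that by (intro Bochner_Integration.integrable_mult_right m(2))
    qed simp_all
  qed
  also have "\<dots> = (\<Sum>b\<in>Basis. \<Sum>c\<in>Basis. if b = c then (A b \<bullet> A c) * s\<^sup>2 *
      (\<integral>z. gauss s z \<partial>(lborel::'a measure)) else 0)"
    by (intro sum.cong refl) (simp add: m(3))
  also have "\<dots> = s\<^sup>2 * (\<Sum>b\<in>Basis. (norm (A b))\<^sup>2) * (\<integral>z. gauss s z \<partial>(lborel::'a measure))"
    by (simp add: sum.delta power2_norm_eq_inner sum_distrib_left sum_distrib_right mult_ac)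
  finally have I: "(\<integral>z. gauss s z * (norm (A z))\<^sup>2 \<partial>lborel) = s\<^sup>2 * (\<Sum>b\<in>Basis. (norm (A b))\<^sup>2) *
      (\<integral>z. gauss s z \<partial>(lborel::'a measure))" .
  show "integrable lborel (\<lambda>z. gauss s z * ((norm (A z))\<^sup>2 - s\<^sup>2 * (\<Sum>b\<in>Basis. (norm (A b))\<^sup>2)))"
    using i g by (simp add: right_diff_distrib)
  show "(\<integral>z. gauss s z * ((norm (A z))\<^sup>2 - s\<^sup>2 * (\<Sum>b\<in>Basis. (norm (A b))\<^sup>2)) \<partial>lborel) = 0"
    using i g I by (simp add: right_diff_distrib)
qed

lemma gauss_nonneg[simp]: "0 \<le> gauss s z" and gauss_le_1[simp]: "gauss s z \<le> 1"
  by (auto simp: gauss_def)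

lemma gauss_measurable2[measurable (raw)]:
  assumes [measurable]: "f \<in> borel_measurable M" "g \<in> borel_measurable M"
  shows "(\<lambda>x. gauss (f x) (g x)) \<in> borel_measurable M"
  unfolding gauss_def by measurable

lemma gauss_mono: "0 < s \<Longrightarrow> s \<le> S \<Longrightarrow> gauss s z \<le> gauss S z"
  unfolding gauss_def by (auto intro!: divide_left_mono mult_left_mono power_mono)

lemma gauss_scale: "h > 0 \<Longrightarrow> gauss (h * s) (h *\<^sub>R z) = gauss s z"
  by (simp add: gauss_def power_mult_distrib field_simps)

lemma gauss_minus[simp]: "gauss s (- z) = gauss s z"
  by (simp add: gauss_def)

lemma gauss_envelope_integrable:
  fixes S :: real
  assumes "S > 0"
  shows "integrable lborel (\<lambda>z::'a::euclidean_space. gauss S z * (1 + (norm z)\<^sup>2))"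
proof -
  have "integrable lborel (gauss S :: 'a \<Rightarrow> real)"
    using gauss_moments(1)[OF assms] SOME_Basis by blast
  then show ?thesis using gauss_integrable_moment2[OF assms, where 'a='a] by (simp add: distrib_left)
qed

section \<open>Bias: the mean of the kernel ratio\<close>

text \<open>
  The bounds on \<open>\<rho>\<close> and \<open>\<sigma>\<close> hold on the whole space and all three functions are Borel, which is
  arranged by extending \<open>\<rho>\<close> and \<open>T\<close> by constants. The sample has density \<open>\<rho>0\<close>, the restriction
  of \<open>\<rho>\<close> to \<open>\<Omega>\<close>.
\<close>
locale kernel_setup =
  fixes \<Omega> :: "'a::euclidean_space set" and \<rho> \<sigma> :: "'a \<Rightarrow> real"
    and T :: "'a \<Rightarrow> 'b::euclidean_space" and D :: "'a \<Rightarrow> 'a \<Rightarrow>\<^sub>L 'b"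
    and c C s S L r a :: real
  assumes open_dom: "open \<Omega>" and bounded_dom: "bounded \<Omega>"
    and \<rho>_measurable[measurable]: "\<rho> \<in> borel_measurable borel"
    and \<rho>_bounds: "\<And>x. c \<le> \<rho> x" "\<And>x. \<rho> x \<le> C" and c_pos: "0 < c"
    and \<sigma>_measurable[measurable]: "\<sigma> \<in> borel_measurable borel"
    and \<sigma>_bounds: "\<And>x. s \<le> \<sigma> x" "\<And>x. \<sigma> x \<le> S" and s_pos: "0 < s"
    and T_measurable[measurable]: "T \<in> borel_measurable borel"
    and D_cont: "continuous_on \<Omega> D"
    and T_deriv: "\<And>x. x \<in> \<Omega> \<Longrightarrow> (T has_derivative blinfun_apply (D x)) (at x)"
    and D_bound: "\<And>x. x \<in> \<Omega> \<Longrightarrow> norm (D x) \<le> L"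
    and T_lipschitz: "\<And>x y. x \<in> \<Omega> \<Longrightarrow> y \<in> \<Omega> \<Longrightarrow> norm (T x - T y) \<le> L * norm (x - y)"
    and L_nonneg: "0 \<le> L"
    and cone: "\<And>x. x \<in> \<Omega> \<Longrightarrow> \<exists>e. interior_cone \<Omega> x r a e" and r_pos: "0 < r" and a_pos: "0 < a"
begin

definition \<rho>0 where "\<rho>0 x = indicator \<Omega> x * \<rho> x"

definition logsq where "logsq h x y = ln (1 + (norm (T x - T y))\<^sup>2) / h\<^sup>2"

text \<open>
  \<open>mass\<close> and \<open>moment\<close> are the means of the weight and of the weighted logarithm, divided by
  \<open>h ^ DIM('a)\<close>, after the substitution \<open>y = x + h *\<^sub>R z\<close>; see \<open>kernel_integral\<close>.
\<close>
definition mass where "mass h x = (\<integral>z. gauss (\<sigma> x) z * \<rho>0 (x + h *\<^sub>R z) \<partial>lborel)"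

definition moment where
  "moment h x = (\<integral>z. gauss (\<sigma> x) z * logsq h x (x + h *\<^sub>R z) * \<rho>0 (x + h *\<^sub>R z) \<partial>lborel)"

text \<open>
  The candidate limit of \<open>moment / mass\<close>; its mean becomes the Dirichlet term of the limit
  functional.
\<close>
definition energy where "energy x = (\<sigma> x)\<^sup>2 * (\<Sum>b\<in>Basis. (norm (D x b))\<^sup>2)"

text \<open>An integrable bound in \<open>z\<close> alone, up to constants, for all Gaussian integrands.\<close>
abbreviation envelope :: "'a \<Rightarrow> real" where "envelope z \<equiv> gauss S z * (1 + (norm z)\<^sup>2)"

lemma dom_measurable[measurable]: "\<Omega> \<in> sets borel" using open_dom by simp

lemma S_pos: "0 < S" and C_pos: "0 < C"
  using s_pos c_pos \<sigma>_bounds[of undefined] \<rho>_bounds[of undefined] by linarith+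

lemma \<sigma>_pos: "0 < \<sigma> x" using s_pos \<sigma>_bounds(1)[of x] by linarith

lemma \<rho>0_measurable[measurable]: "\<rho>0 \<in> borel_measurable borel" unfolding \<rho>0_def by measurable

lemma \<rho>0_bounds: "0 \<le> \<rho>0 x" "\<rho>0 x \<le> C"
  using \<rho>_bounds[of x] c_pos C_pos by (auto simp: \<rho>0_def indicator_def)

lemma dom_finite: "emeasure lborel \<Omega> < \<infinity>" using bounded_dom by (rule emeasure_bounded_finite)

lemma bounded_on_dom_integrable:
  assumes "f \<in> borel_measurable borel" and B: "\<And>x. x \<in> \<Omega> \<Longrightarrow> \<bar>f x\<bar> \<le> B"
  shows "integrable lborel (\<lambda>x. indicator \<Omega> x * f x :: real)"
proof (rule Bochner_Integration.integrable_bound)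
  show "integrable lborel (\<lambda>x. B * indicator \<Omega> x)" using dom_finite by (simp add: integrable_indicator_iff)
  show "AE x in lborel. norm (indicator \<Omega> x * f x) \<le> norm (B * indicator \<Omega> x)"
    by (intro AE_I2) (use B in \<open>force simp: indicator_def\<close>)
qed (use assms(1) in measurable)

lemma \<rho>0_integrable: "integrable lborel \<rho>0"
  unfolding \<rho>0_def
proof (rule bounded_on_dom_integrable)
  show "\<bar>\<rho> x\<bar> \<le> C" for x using \<rho>_bounds[of x] c_pos by simp
qed measurable

lemma envelope_integrable: "integrable lborel envelope" using gauss_envelope_integrable[OF S_pos] .

lemma gauss_\<sigma>_le: "gauss (\<sigma> x) z \<le> gauss S z" by (rule gauss_mono[OF \<sigma>_pos \<sigma>_bounds(2)])

lemma logsq_measurable[measurable (raw)]: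
  assumes [measurable]: "f \<in> borel_measurable N" "g \<in> borel_measurable N"
  shows "(\<lambda>x. logsq h (f x) (g x)) \<in> borel_measurable N"
  unfolding logsq_def by measurable

lemma logsq_nonneg: "0 \<le> logsq h x y" by (simp add: logsq_def)

lemma logsq_le:
  assumes "x \<in> \<Omega>" "y \<in> \<Omega>"
  shows "logsq h x y \<le> L\<^sup>2 * (norm (x - y))\<^sup>2 / h\<^sup>2"
proof -
  have "ln (1 + (norm (T x - T y))\<^sup>2) \<le> (norm (T x - T y))\<^sup>2" by (rule ln_add_one_self_le_self) simp
  also have "\<dots> \<le> (L * norm (x - y))\<^sup>2" using T_lipschitz[OF assms] by (intro power_mono) auto
  finally show ?thesis unfolding logsq_def by (intro divide_right_mono) (auto simp: power_mult_distrib)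
qed

lemma logsq_scaled_le:
  assumes "x \<in> \<Omega>" "x + h *\<^sub>R z \<in> \<Omega>" "h > 0"
  shows "logsq h x (x + h *\<^sub>R z) \<le> L\<^sup>2 * (norm z)\<^sup>2"
  using logsq_le[OF assms(1,2), of h] assms(3) by (simp add: power_mult_distrib)

lemma mass_measurable[measurable]: "mass h \<in> borel_measurable borel" unfolding mass_def by measurable

lemma moment_measurable[measurable]: "moment h \<in> borel_measurable borel" unfolding moment_def by measurable

lemma energy_measurable: "(\<lambda>x. indicator \<Omega> x * energy x) \<in> borel_measurable borel"
proof -
  have "continuous_on \<Omega> (\<lambda>x. \<Sum>b\<in>Basis. (norm (D x b))\<^sup>2)"
    by (intro continuous_intros D_cont)
  then have "(\<lambda>x. indicator \<Omega> x *\<^sub>R (\<Sum>b\<in>Basis. (norm (D x b))\<^sup>2)) \<in> borel_measurable borel"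
    by (intro borel_measurable_continuous_on_indicator) auto
  then have "(\<lambda>x. (\<sigma> x)\<^sup>2 * (indicator \<Omega> x *\<^sub>R (\<Sum>b\<in>Basis. (norm (D x b))\<^sup>2))) \<in> borel_measurable borel"
    by measurable
  then show ?thesis by (simp add: energy_def mult_ac)
qed

lemma energy_bounds:
  assumes "x \<in> \<Omega>"
  shows "0 \<le> energy x" "energy x \<le> S\<^sup>2 * (real DIM('a) * L\<^sup>2)"
proof -
  show "0 \<le> energy x" unfolding energy_def by (intro mult_nonneg_nonneg sum_nonneg) auto
  have "(\<Sum>b\<in>Basis. (norm (D x b))\<^sup>2) \<le> (\<Sum>b\<in>(Basis::'a set). L\<^sup>2)"
  proof (intro sum_mono power_mono)
    fix b :: 'a assume "b \<in> Basis"
    then have "norm (D x b) \<le> norm (D x) * 1" using norm_blinfun[of "D x" b] by simp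
    then show "norm (D x b) \<le> L" using D_bound[OF assms] by simp
  qed auto
  then show "energy x \<le> S\<^sup>2 * (real DIM('a) * L\<^sup>2)"
    unfolding energy_def using \<sigma>_bounds(2)[of x] \<sigma>_pos[of x]
    by (intro mult_mono power_mono sum_nonneg) auto
qed

lemma mass_integrable: "integrable lborel (\<lambda>z. gauss (\<sigma> x) z * \<rho>0 (x + h *\<^sub>R z))"
proof (rule Bochner_Integration.integrable_bound)
  show "integrable lborel (\<lambda>z. C * envelope z)" using envelope_integrable by simp
  show "AE z in lborel. norm (gauss (\<sigma> x) z * \<rho>0 (x + h *\<^sub>R z)) \<le> norm (C * envelope z)"
  proof (intro AE_I2)
    fix z
    have "gauss (\<sigma> x) z * \<rho>0 (x + h *\<^sub>R z) \<le> envelope z * C"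
    proof (intro mult_mono)
      show "gauss (\<sigma> x) z \<le> envelope z" using gauss_\<sigma>_le[of x z] mult_left_mono[of 1 "1
          + (norm z)\<^sup>2" "gauss S z"] by simp
    qed (use \<rho>0_bounds in auto)
    then show "norm (gauss (\<sigma> x) z * \<rho>0 (x + h *\<^sub>R z)) \<le> norm (C * envelope z)"
      using \<rho>0_bounds[of "x + h *\<^sub>R z"] C_pos by (simp add: abs_mult mult_ac)
  qed
qed measurable

lemma moment_integrand_le:
  assumes "x \<in> \<Omega>" "h > 0"
  shows "gauss (\<sigma> x) z * logsq h x (x + h *\<^sub>R z) * \<rho>0 (x + h *\<^sub>R z) \<le> C * L\<^sup>2 * envelope z"
proof (cases "x + h *\<^sub>R z \<in> \<Omega>")
  case True
  have "gauss (\<sigma> x) z * logsq h x (x + h *\<^sub>R z) \<le> gauss S z * (L\<^sup>2 * (norm z)\<^sup>2)"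
    by (intro mult_mono gauss_\<sigma>_le logsq_scaled_le[OF assms(1) True assms(2)] logsq_nonneg) auto
  also have "\<dots> \<le> gauss S z * (L\<^sup>2 * (1 + (norm z)\<^sup>2))" by (intro mult_left_mono) auto
  finally have "gauss (\<sigma> x) z * logsq h x (x + h *\<^sub>R z) * \<rho>0 (x + h *\<^sub>R z)
      \<le> (gauss S z * (L\<^sup>2 * (1 + (norm z)\<^sup>2))) * C"
    by (rule mult_mono[OF _ \<rho>0_bounds(2)]) (use \<rho>0_bounds(1) in auto)
  then show ?thesis by (simp add: mult_ac)
next
  case False
  then show ?thesis using C_pos by (simp add: \<rho>0_def)
qed

lemma moment_integrable:
  assumes "x \<in> \<Omega>" "h > 0"
  shows "integrable lborel (\<lambda>z. gauss (\<sigma> x) z * logsq h x (x + h *\<^sub>R z) * \<rho>0 (x + h *\<^sub>R z))"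
proof (rule Bochner_Integration.integrable_bound)
  show "integrable lborel (\<lambda>z. C * L\<^sup>2 * envelope z)" using envelope_integrable by simp
  show "AE z in lborel. norm (gauss (\<sigma> x) z * logsq h x (x + h *\<^sub>R z) * \<rho>0 (x + h *\<^sub>R z))
      \<le> norm (C * L\<^sup>2 * envelope z)"
    using moment_integrand_le[OF assms] by (intro AE_I2)
        (simp add: abs_mult logsq_nonneg \<rho>0_bounds C_pos less_imp_le)
qed measurable

lemma moment_bounds:
  assumes "x \<in> \<Omega>" "h > 0"
  shows "0 \<le> moment h x" "moment h x \<le> C * L\<^sup>2 * (\<integral>z. envelope z \<partial>lborel)"
proof -
  show "0 \<le> moment h x" unfolding moment_def by (intro integral_nonneg_AE AE_I2 mult_nonneg_nonneg
      logsq_nonneg \<rho>0_bounds) auto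
  have "moment h x \<le> (\<integral>z. C * L\<^sup>2 * envelope z \<partial>lborel)" unfolding moment_def
    by (intro integral_mono moment_integrable moment_integrand_le assms) (use envelope_integrable in simp)
  then show "moment h x \<le> C * L\<^sup>2 * (\<integral>z. envelope z \<partial>lborel)" by simp
qed

text \<open>
  For \<open>h < r\<close> the rescaled domain seen from \<open>x\<close> contains \<open>ball e a\<close>, however close \<open>x\<close> is to
  the boundary.
\<close>
lemma mass_lower: "\<exists>p>0. \<forall>x\<in>\<Omega>. \<forall>h. 0 < h \<and> h < r \<longrightarrow> p \<le> mass h x"
proof (intro exI conjI ballI allI impI)
  let ?g = "exp (- (1 + a)\<^sup>2 / (2 * s\<^sup>2))"
  let ?p = "?g * c * measure lborel (ball (0::'a) a)"
  show "0 < ?p" using c_pos a_pos by simp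
  fix x h assume x: "x \<in> \<Omega>" and h: "0 < h \<and> h < r"
  obtain e where "interior_cone \<Omega> x r a e" using cone[OF x] by blast
  note e = interior_coneD[OF this]
  have "?p = (\<integral>z. indicator (ball e a) z * (?g * c) \<partial>lborel)"
    using a_pos by (simp add: content_ball mult_ac)
  also have "\<dots> \<le> mass h x" unfolding mass_def
  proof (rule integral_mono)
    show "integrable lborel (\<lambda>z. indicator (ball e a) z * (?g * c))"
      using emeasure_lborel_ball_finite[of e a] by (simp add: integrable_indicator_iff)
    fix z
    show "indicator (ball e a) z * (?g * c) \<le> gauss (\<sigma> x) z * \<rho>0 (x + h *\<^sub>R z)"
    proof (cases "z \<in> ball e a")
      case True
      have "dist (x + h *\<^sub>R e) (x + h *\<^sub>R z) = h * dist e z"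
        using h by (simp add: dist_norm scaleR_diff_right[symmetric])
      then have "x + h *\<^sub>R z \<in> ball (x + h *\<^sub>R e) (a * h)" using True h by (simp add: mult.commute)
      moreover have "ball (x + h *\<^sub>R e) (a * h) \<subseteq> \<Omega>" using h r_pos by (intro e(2)[OF x]) auto
      ultimately have "x + h *\<^sub>R z \<in> \<Omega>" by blast
      then have "c \<le> \<rho>0 (x + h *\<^sub>R z)" using \<rho>_bounds by (simp add: \<rho>0_def)
      moreover have "?g \<le> gauss (\<sigma> x) z"
      proof -
        have "norm z \<le> norm e + dist e z" by (metis dist_norm norm_minus_commute norm_triangle_sub add.commute)
        then have "norm z \<le> 1 + a" using e(1) True by simp
        then have "(norm z)\<^sup>2 \<le> (1 + a)\<^sup>2" by (intro power_mono) auto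
        then have "- (1 + a)\<^sup>2 / (2 * s\<^sup>2) \<le> - (norm z)\<^sup>2 / (2 * s\<^sup>2)" using s_pos
            by (intro divide_right_mono) auto
        then have "?g \<le> gauss s z" by (simp add: gauss_def)
        also have "\<dots> \<le> gauss (\<sigma> x) z" by (rule gauss_mono[OF s_pos \<sigma>_bounds(1)])
        finally show ?thesis .
      qed
      ultimately show ?thesis using True c_pos by (simp add: mult_mono)
    qed (use \<rho>0_bounds in simp)
  qed (rule mass_integrable)
  finally show "?p \<le> mass h x" .
qed

lemma mass_scaled:
  assumes "h > 0"
  shows "(\<integral>y. gauss (h * \<sigma> x) (x - y) * \<rho>0 y \<partial>lborel) = h ^ DIM('a) * mass h x"
  unfolding mass_def using assms by (subst lborel_integral_affine[of _ h x]) (auto simp: gauss_scale)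

lemma moment_scaled:
  assumes "h > 0"
  shows "(\<integral>y. gauss (h * \<sigma> x) (x - y) * logsq h x y * \<rho>0 y \<partial>lborel) = h ^ DIM('a) * moment h x"
  unfolding moment_def using assms by (subst lborel_integral_affine[of _ h x]) (auto simp: gauss_scale)

text \<open>
  The two parts of the bias: \<open>transl_err\<close> measures how much the density varies at scale \<open>h\<close>, and
  \<open>lin_err\<close> how far \<open>T\<close> is from its linearisation at that scale.
\<close>
definition transl_err where "transl_err h x = (\<integral>z. envelope z * \<bar>\<rho>0 (x + h *\<^sub>R z) - \<rho>0 x\<bar> \<partial>lborel)"

definition lin_err where
  "lin_err h x = \<bar>\<integral>z. gauss (\<sigma> x) z * (indicator \<Omega> (x + h *\<^sub>R z) * logsq h x (x + h *\<^sub>R z) - energy x) \<partial>lborel\<bar>"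

definition err_const where "err_const = L\<^sup>2 + S\<^sup>2 * (real DIM('a) * L\<^sup>2)"

lemma err_const_nonneg: "0 \<le> err_const" by (simp add: err_const_def)

lemma centred_bound:
  assumes "x \<in> \<Omega>" "h > 0"
  shows "\<bar>gauss (\<sigma> x) z * (indicator \<Omega> (x + h *\<^sub>R z) * logsq h x (x + h *\<^sub>R z) - energy x)\<bar>
      \<le> err_const * envelope z"
proof -
  let ?N = "indicator \<Omega> (x + h *\<^sub>R z) * logsq h x (x + h *\<^sub>R z)"
  have "0 \<le> ?N" "?N \<le> L\<^sup>2 * (norm z)\<^sup>2"
    using logsq_scaled_le[OF assms(1) _ assms(2), of z] by (auto simp: indicator_def logsq_nonneg)
  then have "\<bar>?N - energy x\<bar> \<le> L\<^sup>2 * (norm z)\<^sup>2 + S\<^sup>2 * (real DIM('a) * L\<^sup>2)"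
    using energy_bounds[OF assms(1)] mult_nonneg_nonneg[of "L\<^sup>2" "(norm z)\<^sup>2"] by (simp add: abs_le_iff)
  also have "\<dots> \<le> err_const * (1 + (norm z)\<^sup>2)" by (simp add: err_const_def algebra_simps)
  finally have "gauss (\<sigma> x) z * \<bar>?N - energy x\<bar> \<le> gauss S z * (err_const * (1 + (norm z)\<^sup>2))"
    by (intro mult_mono gauss_\<sigma>_le) auto
  then show ?thesis by (simp add: abs_mult mult_ac)
qed

lemma centred_integrable:
  assumes "x \<in> \<Omega>" "h > 0"
  shows "integrable lborel (\<lambda>z. gauss (\<sigma> x) z * (indicator \<Omega> (x + h *\<^sub>R z) * logsq h x (x + h *\<^sub>R z)
      - energy x))"
proof (rule Bochner_Integration.integrable_bound)
  show "integrable lborel (\<lambda>z. err_const * envelope z)" using envelope_integrable by simp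
  show "AE z in lborel. norm (gauss (\<sigma> x) z * (indicator \<Omega> (x + h *\<^sub>R z) * logsq h x (x + h *\<^sub>R z)
      - energy x)) \<le> norm (err_const * envelope z)"
    using centred_bound[OF assms] by (intro AE_I2) (smt (verit) real_norm_def)
qed measurable

lemma transl_err_integrand_integrable: "integrable lborel (\<lambda>z. envelope z * \<bar>\<rho>0 (x + h *\<^sub>R z) - \<rho>0 x\<bar>)"
proof (rule Bochner_Integration.integrable_bound)
  show "integrable lborel (\<lambda>z. C * envelope z)" using envelope_integrable by simp
  show "AE z in lborel. norm (envelope z * \<bar>\<rho>0 (x + h *\<^sub>R z) - \<rho>0 x\<bar>) \<le> norm (C * envelope z)"
  proof (intro AE_I2)
    fix z
    have "\<bar>\<rho>0 (x + h *\<^sub>R z) - \<rho>0 x\<bar> \<le> C" using \<rho>0_bounds[of x] \<rho>0_bounds[of "x + h *\<^sub>R z"] by linarith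
    then have "envelope z * \<bar>\<rho>0 (x + h *\<^sub>R z) - \<rho>0 x\<bar> \<le> envelope z * C" by (intro mult_left_mono) auto
    then show "norm (envelope z * \<bar>\<rho>0 (x + h *\<^sub>R z) - \<rho>0 x\<bar>) \<le> norm (C * envelope z)" using C_pos
        by (simp add: abs_mult mult_ac)
  qed
qed measurable

text \<open>
  The difference is the Gaussian integral of \<open>(logsq - energy) * \<rho>0(x + h z)\<close>. Writing
  \<open>\<rho>0(x + h z)\<close> as \<open>(\<rho>0(x + h z) - \<rho>0 x) + \<rho>0 x\<close> separates the two errors; the factor
  \<open>\<rho>0 x\<close> then stands outside an integral whose limit is \<open>0\<close> by \<open>gauss_quadratic_form\<close>.
\<close>
lemma numerator_error:
  assumes "x \<in> \<Omega>" "h > 0"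
  shows "\<bar>moment h x - energy x * mass h x\<bar> \<le> err_const * transl_err h x + C * lin_err h x"
proof -
  let ?k = "\<lambda>z. gauss (\<sigma> x) z * (indicator \<Omega> (x + h *\<^sub>R z) * logsq h x (x + h *\<^sub>R z) - energy x)"
  let ?d = "\<lambda>z. \<rho>0 (x + h *\<^sub>R z) - \<rho>0 x"
  note ci = centred_integrable[OF assms]
  have kd_le: "\<bar>?k z * ?d z\<bar> \<le> err_const * (envelope z * \<bar>?d z\<bar>)" for z
    using mult_right_mono[OF centred_bound[OF assms, of z], of "\<bar>?d z\<bar>"] by (simp add: abs_mult mult_ac)
  have KE: "integrable lborel (\<lambda>z. err_const * (envelope z * \<bar>?d z\<bar>))"
    by (intro Bochner_Integration.integrable_mult_right transl_err_integrand_integrable)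
  have kd: "integrable lborel (\<lambda>z. ?k z * ?d z)"
  proof (rule Bochner_Integration.integrable_bound[OF KE])
    show "AE z in lborel. norm (?k z * ?d z) \<le> norm (err_const * (envelope z * \<bar>?d z\<bar>))"
      using kd_le by (intro AE_I2) (smt (verit) real_norm_def)
  qed measurable
  have "moment h x - energy x * mass h x =
     (\<integral>z. gauss (\<sigma> x) z * logsq h x (x + h *\<^sub>R z) * \<rho>0 (x + h *\<^sub>R z) - energy x * (gauss (\<sigma> x) z * \<rho>0 (x + h
         *\<^sub>R z)) \<partial>lborel)"
    unfolding mass_def moment_def using moment_integrable[OF assms] mass_integrable by simp
  also have "\<dots> = (\<integral>z. ?k z * ?d z + \<rho>0 x * ?k z \<partial>lborel)"
    by (intro Bochner_Integration.integral_cong) (auto simp: \<rho>0_def indicator_def algebra_simps)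
  also have "\<dots> = (\<integral>z. ?k z * ?d z \<partial>lborel) + \<rho>0 x * (\<integral>z. ?k z \<partial>lborel)"
    using kd ci by simp
  finally have split: "moment h x - energy x * mass h x = (\<integral>z. ?k z * ?d z \<partial>lborel) + \<rho>0 x *
      (\<integral>z. ?k z \<partial>lborel)" .
  have "\<bar>moment h x - energy x * mass h x\<bar> \<le> \<bar>\<integral>z. ?k z * ?d z \<partial>lborel\<bar> + \<rho>0 x * \<bar>\<integral>z. ?k z \<partial>lborel\<bar>"
    unfolding split using abs_triangle_ineq[of "\<integral>z. ?k z * ?d z \<partial>lborel" "\<rho>0 x * (\<integral>z. ?k z \<partial>lborel)"]
    by (simp only: abs_mult abs_of_nonneg[OF \<rho>0_bounds(1)])
  moreover have "\<bar>\<integral>z. ?k z * ?d z \<partial>lborel\<bar> \<le> err_const * transl_err h x"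
  proof -
    have "\<bar>\<integral>z. ?k z * ?d z \<partial>lborel\<bar> \<le> (\<integral>z. \<bar>?k z * ?d z\<bar> \<partial>lborel)" by (rule integral_abs_bound)
    also have "\<dots> \<le> (\<integral>z. err_const * (envelope z * \<bar>?d z\<bar>) \<partial>lborel)"
      by (rule integral_mono[OF _ KE kd_le]) (use kd in simp)
    finally show ?thesis by (simp add: transl_err_def)
  qed
  moreover have "\<rho>0 x * \<bar>\<integral>z. ?k z \<partial>lborel\<bar> \<le> C * lin_err h x"
    unfolding lin_err_def using \<rho>0_bounds by (intro mult_right_mono) auto
  ultimately show ?thesis by linarith
qed

lemma lin_err_bounds:
  assumes "x \<in> \<Omega>" "h > 0"
  shows "0 \<le> lin_err h x" "lin_err h x \<le> err_const * (\<integral>z. envelope z \<partial>lborel)"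
proof -
  show "0 \<le> lin_err h x" by (simp add: lin_err_def)
  have "lin_err h x \<le> (\<integral>z. \<bar>gauss (\<sigma> x) z * (indicator \<Omega> (x + h *\<^sub>R z) * logsq h x (x + h *\<^sub>R z)
      - energy x)\<bar> \<partial>lborel)"
    unfolding lin_err_def by (rule integral_abs_bound)
  also have "\<dots> \<le> (\<integral>z. err_const * envelope z \<partial>lborel)"
    by (intro integral_mono centred_bound assms integrable_abs centred_integrable) (use envelope_integrable
        in simp)
  finally show "lin_err h x \<le> err_const * (\<integral>z. envelope z \<partial>lborel)" by simp
qed

text \<open>\<open>energy\<close> is only known to be measurable on \<open>\<Omega>\<close>, hence the indicator.\<close>
lemma lin_err_measurable: "(\<lambda>x. indicator \<Omega> x * lin_err h x) \<in> borel_measurable borel"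
proof -
  define g where "g x = indicator \<Omega> x * energy x" for x
  have [measurable]: "g \<in> borel_measurable borel" unfolding g_def by (rule energy_measurable)
  have "(\<lambda>x. indicator \<Omega> x * \<bar>\<integral>z. gauss (\<sigma> x) z * (indicator \<Omega> (x + h *\<^sub>R z) * logsq h x (x + h *\<^sub>R z)
      - g x) \<partial>lborel\<bar>) \<in> borel_measurable borel"
    by measurable
  also have "(\<lambda>x. indicator \<Omega> x * \<bar>\<integral>z. gauss (\<sigma> x) z * (indicator \<Omega> (x + h *\<^sub>R z) * logsq h x (x + h *\<^sub>R z)
      - g x) \<partial>lborel\<bar>)
     = (\<lambda>x. indicator \<Omega> x * lin_err h x)"
    by (auto simp: fun_eq_iff lin_err_def g_def indicator_def)
  finally show ?thesis .
qed

text \<open>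
  Dominated convergence in \<open>z\<close>; for fixed \<open>z\<close> the point \<open>x + h z\<close> eventually lies in \<open>\<Omega>\<close>, and the
  limiting integral is the centred quadratic form, which vanishes.
\<close>
lemma lin_err_tendsto:
  assumes x: "x \<in> \<Omega>" and h: "h \<longlonglongrightarrow> 0" "\<And>n. h n > 0"
  shows "(\<lambda>n. lin_err (h n) x) \<longlonglongrightarrow> 0"
proof -
  have "(\<lambda>n. \<integral>z. gauss (\<sigma> x) z * (indicator \<Omega> (x + h n *\<^sub>R z) * logsq (h n) x (x + h n *\<^sub>R z)
      - energy x) \<partial>lborel)
     \<longlonglongrightarrow> (\<integral>z. gauss (\<sigma> x) z * ((norm (D x z))\<^sup>2 - energy x) \<partial>lborel)"
  proof (rule integral_dominated_convergence[where w="\<lambda>z. err_const * envelope z"])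
    have [measurable]: "(\<lambda>z. D x z) \<in> borel_measurable borel"
      by (intro borel_measurable_continuous_onI blinfun.continuous_on continuous_intros)
    show "(\<lambda>z. gauss (\<sigma> x) z * ((norm (D x z))\<^sup>2 - energy x)) \<in> borel_measurable lborel"
      by measurable
    show "integrable lborel (\<lambda>z. err_const * envelope z)" using envelope_integrable by simp
    show "AE z in lborel. norm (gauss (\<sigma> x) z * (indicator \<Omega> (x + h n *\<^sub>R z) * logsq (h n) x (x + h n *\<^sub>R z)
        - energy x)) \<le> err_const * envelope z" for n
      using centred_bound[OF x h(2)] by (intro AE_I2) simp
    show "AE z in lborel. (\<lambda>n. gauss (\<sigma> x) z * (indicator \<Omega> (x + h n *\<^sub>R z) * logsq (h n) x (x + h n *\<^sub>R z)
        - energy x))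
       \<longlonglongrightarrow> gauss (\<sigma> x) z * ((norm (D x z))\<^sup>2 - energy x)"
    proof (intro AE_I2 tendsto_intros)
      fix z
      have "(\<lambda>n. x + h n *\<^sub>R z) \<longlonglongrightarrow> x + 0 *\<^sub>R z" by (intro tendsto_intros h)
      then have "\<forall>\<^sub>F n in sequentially. x + h n *\<^sub>R z \<in> \<Omega>"
        using open_dom x by (simp add: topological_tendstoD)
      then have "\<forall>\<^sub>F n in sequentially. logsq (h n) x (x + h n *\<^sub>R z)
          = indicator \<Omega> (x + h n *\<^sub>R z) * logsq (h n) x (x + h n *\<^sub>R z)"
        by eventually_elim simp
      moreover have "(\<lambda>n. logsq (h n) x (x + h n *\<^sub>R z)) \<longlonglongrightarrow> (norm (D x z))\<^sup>2"
        unfolding logsq_def by (rule ln_difference_quotient_limit[OF T_deriv[OF x] h])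
      ultimately show "(\<lambda>n. indicator \<Omega> (x + h n *\<^sub>R z) * logsq (h n) x (x + h n *\<^sub>R z)) \<longlonglongrightarrow> (norm (D x z))\<^sup>2"
        by (rule Lim_transform_eventually[rotated])
    qed
  qed measurable
  also have "(\<integral>z. gauss (\<sigma> x) z * ((norm (D x z))\<^sup>2 - energy x) \<partial>lborel) = 0"
    unfolding energy_def
    by (rule gauss_quadratic_form[OF \<sigma>_pos]) (intro bounded_linear.linear blinfun.bounded_linear_right)
  finally show ?thesis unfolding lin_err_def by (rule tendsto_rabs_zero)
qed

lemma lin_err_integral_tendsto:
  assumes h: "h \<longlonglongrightarrow> 0" "\<And>n. h n > 0"
  shows "(\<lambda>n. \<integral>x. indicator \<Omega> x * lin_err (h n) x \<partial>lborel) \<longlonglongrightarrow> 0"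
proof -
  let ?B = "err_const * (\<integral>z. envelope z \<partial>lborel)"
  have "(\<lambda>n. \<integral>x. indicator \<Omega> x * lin_err (h n) x \<partial>lborel) \<longlonglongrightarrow> (\<integral>x. 0 \<partial>(lborel :: 'a measure))"
  proof (rule integral_dominated_convergence[where w="\<lambda>x. ?B * indicator \<Omega> x"])
    show "integrable lborel (\<lambda>x. ?B * indicator \<Omega> x)" using dom_finite by (simp add: integrable_indicator_iff)
    show "AE x in lborel. norm (indicator \<Omega> x * lin_err (h n) x) \<le> ?B * indicator \<Omega> x" for n
      using lin_err_bounds[OF _ h(2)] by (intro AE_I2) (auto simp: indicator_def)
    show "AE x in lborel. (\<lambda>n. indicator \<Omega> x * lin_err (h n) x) \<longlonglongrightarrow> 0"
      using lin_err_tendsto[OF _ h] by (intro AE_I2) (auto simp: indicator_def)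
  qed (use lin_err_measurable in simp_all)
  then show ?thesis by simp
qed

lemma transl_err_measurable[measurable]: "transl_err h \<in> borel_measurable borel" unfolding transl_err_def
    by measurable

lemma transl_err_nonneg: "0 \<le> transl_err h x" unfolding transl_err_def by (intro integral_nonneg_AE AE_I2) simp

lemma translate_integrable: "integrable lborel (\<lambda>x. \<bar>\<rho>0 (x + u) - \<rho>0 x\<bar>)"
  using \<rho>0_integrable lborel_integrable_translate[of \<rho>0 u] by simp

lemma translate_L1_bounds:
  shows "0 \<le> (\<integral>x. \<bar>\<rho>0 (x + u) - \<rho>0 x\<bar> \<partial>lborel)"
    and "(\<integral>x. \<bar>\<rho>0 (x + u) - \<rho>0 x\<bar> \<partial>lborel) \<le> 2 * (\<integral>x. \<rho>0 x \<partial>lborel)"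
proof -
  show "0 \<le> (\<integral>x. \<bar>\<rho>0 (x + u) - \<rho>0 x\<bar> \<partial>lborel)" by (intro integral_nonneg_AE AE_I2) simp
  have i': "integrable lborel (\<lambda>x. \<rho>0 (x + u))"
    using \<rho>0_integrable lborel_integrable_translate[of \<rho>0 u] by simp
  have "(\<integral>x. \<bar>\<rho>0 (x + u) - \<rho>0 x\<bar> \<partial>lborel) \<le> (\<integral>x. \<rho>0 (x + u) + \<rho>0 x \<partial>lborel)"
  proof (rule integral_mono[OF translate_integrable])
    fix x show "\<bar>\<rho>0 (x + u) - \<rho>0 x\<bar> \<le> \<rho>0 (x + u) + \<rho>0 x"
      using \<rho>0_bounds(1)[of x] \<rho>0_bounds(1)[of "x + u"] by linarith
  qed (use i' \<rho>0_integrable in simp)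
  also have "\<dots> = 2 * (\<integral>x. \<rho>0 x \<partial>lborel)"
    using i' \<rho>0_integrable lborel_integral_translate[of \<rho>0 u] by simp
  finally show "(\<integral>x. \<bar>\<rho>0 (x + u) - \<rho>0 x\<bar> \<partial>lborel) \<le> 2 * (\<integral>x. \<rho>0 x \<partial>lborel)" .
qed

text \<open>
  By Tonelli the mean over \<open>x\<close> is a Gaussian average of \<open>L\<^sup>1\<close> distances between \<open>\<rho>0\<close> and its
  translates, to which \<open>L1_translation_continuous\<close> applies for each \<open>z\<close>.
\<close>
lemma transl_err_integral:
  shows "integrable lborel (transl_err h)"
    and "(\<integral>x. transl_err h x \<partial>lborel) = (\<integral>z. envelope z * (\<integral>x. \<bar>\<rho>0 (x + h *\<^sub>R z) - \<rho>0 x\<bar> \<partial>lborel) \<partial>lborel)"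
proof -
  let ?m = "\<lambda>z. \<integral>x. \<bar>\<rho>0 (x + h *\<^sub>R z) - \<rho>0 x\<bar> \<partial>lborel"
  note i = translate_integrable and m0 = translate_L1_bounds(1) and m_le = translate_L1_bounds(2)
  have mm[measurable]: "?m \<in> borel_measurable borel" by measurable
  have wm: "integrable lborel (\<lambda>z. envelope z * ?m z)"
  proof (rule Bochner_Integration.integrable_bound)
    show "integrable lborel (\<lambda>z. envelope z * (2 * (\<integral>x. \<rho>0 x \<partial>lborel)))" using envelope_integrable by simp
    show "AE z in lborel. norm (envelope z * ?m z) \<le> norm (envelope z * (2 * (\<integral>x. \<rho>0 x \<partial>lborel)))"
      using m0 by (intro AE_I2) (auto simp: abs_mult intro!: mult_left_mono order_trans[OF m_le])
  qed measurable
  have "(\<integral>\<^sup>+x. ennreal (transl_err h x) \<partial>lborel) = (\<integral>\<^sup>+x. \<integral>\<^sup>+z. ennreal (envelope z * \<bar>\<rho>0 (x + h *\<^sub>R z)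
      - \<rho>0 x\<bar>) \<partial>lborel \<partial>lborel)"
    unfolding transl_err_def by (intro nn_integral_cong nn_integral_eq_integral[symmetric]
        transl_err_integrand_integrable AE_I2) simp
  also have "\<dots> = (\<integral>\<^sup>+z. \<integral>\<^sup>+x. ennreal (envelope z * \<bar>\<rho>0 (x + h *\<^sub>R z) - \<rho>0 x\<bar>) \<partial>lborel \<partial>lborel)"
    by (rule lborel_pair.Fubini') measurable
  also have "\<dots> = (\<integral>\<^sup>+z. ennreal (envelope z * ?m z) \<partial>lborel)"
    by (intro nn_integral_cong) (subst nn_integral_eq_integral, auto simp: i)
  also have "\<dots> = ennreal (\<integral>z. envelope z * ?m z \<partial>lborel)"
    by (intro nn_integral_eq_integral wm AE_I2 mult_nonneg_nonneg m0) auto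
  finally have *: "(\<integral>\<^sup>+x. ennreal (transl_err h x) \<partial>lborel) = ennreal (\<integral>z. envelope z * ?m z \<partial>lborel)" .
  show "integrable lborel (transl_err h)"
    by (rule integrableI_nonneg) (use * transl_err_nonneg in auto)
  show "(\<integral>x. transl_err h x \<partial>lborel) = (\<integral>z. envelope z * ?m z \<partial>lborel)"
    using * by (subst integral_eq_nn_integral) (auto simp: transl_err_nonneg intro!: integral_nonneg_AE m0)
qed

lemma transl_err_integral_tendsto:
  assumes h: "h \<longlonglongrightarrow> 0"
  shows "(\<lambda>n. \<integral>x. transl_err (h n) x \<partial>lborel) \<longlonglongrightarrow> 0"
proof -
  let ?m = "\<lambda>h z. \<integral>x. \<bar>\<rho>0 (x + h *\<^sub>R z) - \<rho>0 x\<bar> \<partial>lborel"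
  note m0 = translate_L1_bounds(1) and m_le = translate_L1_bounds(2)
  have "(\<lambda>n. \<integral>z. envelope z * ?m (h n) z \<partial>lborel) \<longlonglongrightarrow> (\<integral>z. envelope z * 0 \<partial>lborel)"
  proof (rule integral_dominated_convergence[where w="\<lambda>z. envelope z * (2 * (\<integral>x. \<rho>0 x \<partial>lborel))"])
    show "integrable lborel (\<lambda>z. envelope z * (2 * (\<integral>x. \<rho>0 x \<partial>lborel)))" using envelope_integrable by simp
    show "AE z in lborel. norm (envelope z * ?m (h n) z) \<le> envelope z * (2 * (\<integral>x. \<rho>0 x \<partial>lborel))" for n
      using m0 m_le by (intro AE_I2) (auto simp: abs_mult intro!: mult_left_mono)
    show "AE z in lborel. (\<lambda>n. envelope z * ?m (h n) z) \<longlonglongrightarrow> envelope z * 0"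
    proof (intro AE_I2 tendsto_mult tendsto_const L1_translation_continuous \<rho>0_integrable)
      fix z :: 'a
      have "(\<lambda>n. h n *\<^sub>R z) \<longlonglongrightarrow> 0 *\<^sub>R z" by (rule tendsto_scaleR[OF h tendsto_const])
      then show "(\<lambda>n. h n *\<^sub>R z) \<longlonglongrightarrow> 0" by simp
    qed
  qed measurable
  then show ?thesis unfolding transl_err_integral(2) by simp
qed

lemma ratio_bounds:
  obtains p B where "p > 0" "B \<ge> 0"
    "\<And>x h. x \<in> \<Omega> \<Longrightarrow> 0 < h \<Longrightarrow> h < r \<Longrightarrow> p \<le> mass h x"
    "\<And>x h. x \<in> \<Omega> \<Longrightarrow> 0 < h \<Longrightarrow> h < r \<Longrightarrow> 0 \<le> moment h x / mass h x"
    "\<And>x h. x \<in> \<Omega> \<Longrightarrow> 0 < h \<Longrightarrow> h < r \<Longrightarrow> moment h x / mass h x \<le> B"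
proof -
  obtain p where p: "p > 0" "\<And>x h. x \<in> \<Omega> \<Longrightarrow> 0 < h \<Longrightarrow> h < r \<Longrightarrow> p \<le> mass h x" using mass_lower by blast
  have w0: "0 \<le> C * L\<^sup>2 * (\<integral>z. envelope z \<partial>lborel)"
    using C_pos by (intro mult_nonneg_nonneg integral_nonneg_AE AE_I2) auto
  show thesis
  proof (rule that[OF p(1) _ p(2)])
    show "0 \<le> C * L\<^sup>2 * (\<integral>z. envelope z \<partial>lborel) / p" using w0 p(1) by (rule divide_nonneg_pos)
    fix x h assume x: "x \<in> \<Omega>" and h: "0 < h" "h < r"
    show "0 \<le> moment h x / mass h x" using moment_bounds(1)[OF x h(1)] p(2)[OF x h] p(1) by simp
    show "moment h x / mass h x \<le> C * L\<^sup>2 * (\<integral>z. envelope z \<partial>lborel) / p"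
      by (intro frac_le moment_bounds x h p w0)
  qed
qed

text \<open>
  Dividing \<open>numerator_error\<close> by \<open>mass\<close>, which is bounded below, turns the convergence of the two
  errors in the mean into convergence of the mean ratio.
\<close>
theorem mean_ratio_tendsto:
  assumes h: "h \<longlonglongrightarrow> 0" "\<And>n. h n > 0"
  shows "(\<lambda>n. \<integral>x. moment (h n) x / mass (h n) x * \<rho>0 x \<partial>lborel) \<longlonglongrightarrow> (\<integral>x. energy x * \<rho>0 x \<partial>lborel)"
proof -
  obtain p B where p: "p > 0" "\<And>x h. x \<in> \<Omega> \<Longrightarrow> 0 < h \<Longrightarrow> h < r \<Longrightarrow> p \<le> mass h x"
    and B: "B \<ge> 0" "\<And>x h. x \<in> \<Omega> \<Longrightarrow> 0 < h \<Longrightarrow> h < r \<Longrightarrow> 0 \<le> moment h x / mass h x"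
      "\<And>x h. x \<in> \<Omega> \<Longrightarrow> 0 < h \<Longrightarrow> h < r \<Longrightarrow> moment h x / mass h x \<le> B"
    by (rule ratio_bounds) blast
  define err where "err n = C / p * (err_const * (\<integral>x. transl_err (h n) x \<partial>lborel) + C * (\<integral>x. indicator \<Omega> x
      * lin_err (h n) x \<partial>lborel))" for n
  have "err \<longlonglongrightarrow> C / p * (err_const * 0 + C * 0)" unfolding err_def
    by (intro tendsto_intros transl_err_integral_tendsto lin_err_integral_tendsto h)
  then have err: "err \<longlonglongrightarrow> 0" by simp
  have iF: "integrable lborel (\<lambda>x. indicator \<Omega> x * lin_err (h n) x)" for n
  proof -
    have "integrable lborel (\<lambda>x. indicator \<Omega> x * (indicator \<Omega> x * lin_err (h n) x))"
      using lin_err_bounds[OF _ h(2)] by (intro bounded_on_dom_integrable lin_err_measurable) auto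
    then show ?thesis by (rule Bochner_Integration.integrable_cong[THEN iffD1, rotated 2])
        (auto simp: indicator_def)
  qed
  have il: "integrable lborel (\<lambda>x. energy x * \<rho>0 x)"
  proof -
    have "integrable lborel (\<lambda>x. indicator \<Omega> x * (indicator \<Omega> x * energy x * \<rho> x))"
    proof (rule bounded_on_dom_integrable)
      show "(\<lambda>x. indicator \<Omega> x * energy x * \<rho> x) \<in> borel_measurable borel"
        by (intro borel_measurable_times energy_measurable) measurable
      show "\<bar>indicator \<Omega> x * energy x * \<rho> x\<bar> \<le> (S\<^sup>2 * (real DIM('a) * L\<^sup>2)) * C" if "x \<in> \<Omega>" for x
        using energy_bounds[OF that] \<rho>_bounds[of x] c_pos that
        by (simp add: abs_mult) (intro mult_mono, auto)
    qed
    then show ?thesis by (rule Bochner_Integration.integrable_cong[THEN iffD1, rotated 2])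
        (auto simp: \<rho>0_def indicator_def)
  qed
  have "\<forall>\<^sub>F n in sequentially. h n < r" using h(1) r_pos by (rule order_tendstoD)
  then have "\<forall>\<^sub>F n in sequentially. norm ((\<integral>x. moment (h n) x / mass (h n) x * \<rho>0 x \<partial>lborel) - (\<integral>x. energy x
      * \<rho>0 x \<partial>lborel)) \<le> err n"
  proof eventually_elim
    case (elim n)
    let ?q = "\<lambda>x. moment (h n) x / mass (h n) x"
    have pos: "p \<le> mass (h n) x" if "x \<in> \<Omega>" for x using p(2)[OF that h(2) elim] .
    have iq: "integrable lborel (\<lambda>x. ?q x * \<rho>0 x)"
    proof -
      have "integrable lborel (\<lambda>x. indicator \<Omega> x * (?q x * \<rho> x))"
      proof (rule bounded_on_dom_integrable)
        show "\<bar>?q x * \<rho> x\<bar> \<le> B * C" if "x \<in> \<Omega>" for x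
          using B(2,3)[OF that h(2) elim] \<rho>_bounds[of x] c_pos B(1)
          by (simp only: abs_mult) (intro mult_mono, auto)
      qed measurable
      then show ?thesis by (rule Bochner_Integration.integrable_cong[THEN iffD1, rotated 2]) (auto simp: \<rho>0_def)
    qed
    have "norm ((\<integral>x. ?q x * \<rho>0 x \<partial>lborel) - (\<integral>x. energy x * \<rho>0 x \<partial>lborel))
        = \<bar>\<integral>x. ?q x * \<rho>0 x - energy x * \<rho>0 x \<partial>lborel\<bar>"
      using iq il by simp
    also have "\<dots> \<le> (\<integral>x. \<bar>?q x * \<rho>0 x - energy x * \<rho>0 x\<bar> \<partial>lborel)" by (rule integral_abs_bound)
    also have "\<dots> \<le> (\<integral>x. C / p * (err_const * transl_err (h n) x + C * (indicator \<Omega> x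
        * lin_err (h n) x)) \<partial>lborel)"
    proof (rule integral_mono)
      show "integrable lborel (\<lambda>x. C / p * (err_const * transl_err (h n) x + C * (indicator \<Omega> x
          * lin_err (h n) x)))"
        using transl_err_integral(1) iF by simp
      fix x
      show "\<bar>?q x * \<rho>0 x - energy x * \<rho>0 x\<bar> \<le> C / p * (err_const * transl_err (h n) x + C * (indicator \<Omega> x
          * lin_err (h n) x))"
      proof (cases "x \<in> \<Omega>")
        case True
        have P0: "mass (h n) x > 0" using pos[OF True] p(1) by linarith
        have "?q x - energy x = (moment (h n) x - energy x * mass (h n) x) / mass (h n) x" using P0
            by (simp add: field_simps)
        then have "\<bar>?q x - energy x\<bar> = \<bar>moment (h n) x - energy x * mass (h n) x\<bar> / mass (h n) x" using P0
            by simp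
        also have "\<dots> \<le> (err_const * transl_err (h n) x + C * lin_err (h n) x) / p"
          by (intro frac_le numerator_error[OF True h(2)] order_trans[OF abs_ge_zero numerator_error[OF True
              h(2)]] pos[OF True] p(1))
        finally have "\<bar>?q x - energy x\<bar> * \<rho>0 x \<le> (err_const * transl_err (h n) x + C * lin_err (h n) x) / p * C"
          by (rule mult_mono[OF _ \<rho>0_bounds(2)]) (use \<rho>0_bounds(1) p(1) err_const_nonneg transl_err_nonneg
              C_pos lin_err_bounds[OF True h(2)] in auto)
        moreover have "\<bar>?q x * \<rho>0 x - energy x * \<rho>0 x\<bar> = \<bar>?q x - energy x\<bar> * \<rho>0 x"
          by (simp only: left_diff_distrib[symmetric] abs_mult abs_of_nonneg[OF \<rho>0_bounds(1)])
        ultimately show ?thesis using True by (simp add: mult_ac)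
      next
        case False
        then show ?thesis using p(1) err_const_nonneg transl_err_nonneg C_pos by (simp add: \<rho>0_def)
      qed
    qed (use iq il in simp)
    also have "\<dots> = err n" unfolding err_def using transl_err_integral(1) iF by simp
    finally show ?case .
  qed
  then have "(\<lambda>n. (\<integral>x. moment (h n) x / mass (h n) x * \<rho>0 x \<partial>lborel) - (\<integral>x. energy x * \<rho>0 x \<partial>lborel)) \<longlonglongrightarrow> 0"
    by (rule Lim_null_comparison[OF _ err])
  then show ?thesis by (rule LIM_zero_cancel)
qed

text \<open>
  The indicators change nothing at points of \<open>\<Omega>\<close>, and they make the bounds below valid for all
  \<open>x\<close> and \<open>y\<close>.
\<close>
definition kernel where "kernel h x y = indicator \<Omega> x * indicator \<Omega> y * gauss (h * \<sigma> x) (x - y)"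

lemma kernel_bounds: "0 \<le> kernel h x y" "kernel h x y \<le> 1"
  by (auto simp: kernel_def indicator_def)

lemma kernel_measurable[measurable (raw)]:
  assumes [measurable]: "f \<in> borel_measurable N" "g \<in> borel_measurable N"
  shows "(\<lambda>x. kernel h (f x) (g x)) \<in> borel_measurable N"
  unfolding kernel_def by measurable

text \<open>
  \<open>logsq\<close> is at most a constant times \<open>q = |x - y|\<^sup>2 / (2 h\<^sup>2 S\<^sup>2)\<close>, which is unbounded as \<open>h\<close> tends to \<open>0\<close>; the
  Gaussian factor \<open>exp (- q)\<close> compensates since \<open>q * exp (- q) \<le> 1\<close>.
\<close>
lemma kernel_logsq_bounds:
  assumes h: "h > 0"
  shows "0 \<le> kernel h x y * logsq h x y" "kernel h x y * logsq h x y \<le> 2 * S\<^sup>2 * L\<^sup>2"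
proof -
  show "0 \<le> kernel h x y * logsq h x y" by (intro mult_nonneg_nonneg kernel_bounds logsq_nonneg)
  show "kernel h x y * logsq h x y \<le> 2 * S\<^sup>2 * L\<^sup>2"
  proof (cases "x \<in> \<Omega> \<and> y \<in> \<Omega>")
    case True
    define q where "q = (norm (x - y))\<^sup>2 / (2 * (h * S)\<^sup>2)"
    have S2: "S\<^sup>2 > 0" using S_pos by simp
    have "gauss (h * \<sigma> x) (x - y) \<le> gauss (h * S) (x - y)"
      using h \<sigma>_pos[of x] \<sigma>_bounds(2)[of x] by (intro gauss_mono) auto
    also have "\<dots> = exp (- q)" by (simp add: gauss_def q_def)
    finally have g: "gauss (h * \<sigma> x) (x - y) \<le> exp (- q)" .
    have "L\<^sup>2 * (norm (x - y))\<^sup>2 / h\<^sup>2 = 2 * S\<^sup>2 * L\<^sup>2 * q"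
      using h S_pos by (simp add: q_def power_mult_distrib)
    then have l: "logsq h x y \<le> 2 * S\<^sup>2 * L\<^sup>2 * q" using logsq_le[of x y h] True by simp
    have "kernel h x y * logsq h x y \<le> exp (- q) * (2 * S\<^sup>2 * L\<^sup>2 * q)"
      using True g l logsq_nonneg by (auto simp: kernel_def intro!: mult_mono)
    also have "\<dots> = 2 * S\<^sup>2 * L\<^sup>2 * (q * exp (- q))" by simp
    also have "\<dots> \<le> 2 * S\<^sup>2 * L\<^sup>2 * 1"
    proof (rule mult_left_mono)
      have "q \<le> exp q" using exp_ge_add_one_self[of q] by linarith
      then show "q * exp (- q) \<le> 1" by (simp add: exp_minus field_simps)
    qed simp
    finally show ?thesis by simp
  qed (auto simp: kernel_def)
qed

lemma kernel_integral:
  assumes x: "x \<in> \<Omega>" and h: "h > 0"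
  shows "(\<integral>y. kernel h x y * \<rho>0 y \<partial>lborel) = h ^ DIM('a) * mass h x"
    and "(\<integral>y. kernel h x y * logsq h x y * \<rho>0 y \<partial>lborel) = h ^ DIM('a) * moment h x"
  unfolding mass_scaled[OF h, symmetric] moment_scaled[OF h, symmetric]
  by (intro Bochner_Integration.integral_cong; use x in \<open>simp add: kernel_def \<rho>0_def indicator_def\<close>)+

lemma mass_upper: "mass h x \<le> C * (\<integral>z. envelope z \<partial>lborel)"
proof -
  have "mass h x \<le> (\<integral>z. C * envelope z \<partial>lborel)" unfolding mass_def
  proof (rule integral_mono[OF mass_integrable])
    show "integrable lborel (\<lambda>z. C * envelope z)" using envelope_integrable by simp
    fix z
    have "gauss (\<sigma> x) z \<le> envelope z" using gauss_\<sigma>_le[of x z] mult_left_mono[of 1 "1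
        + (norm z)\<^sup>2" "gauss S z"] by simp
    then have "gauss (\<sigma> x) z * \<rho>0 (x + h *\<^sub>R z) \<le> envelope z * C" by (intro mult_mono \<rho>0_bounds) auto
    then show "gauss (\<sigma> x) z * \<rho>0 (x + h *\<^sub>R z) \<le> C * envelope z" by (simp add: mult.commute)
  qed
  then show ?thesis by simp
qed

end

section \<open>Almost sure limits along the sample\<close>

lemma quotient_perturbation:
  fixes U V q p N \<epsilon> p0 B :: real
  assumes p: "0 < p0" "p0 \<le> p" and B: "0 \<le> q / p" "q / p \<le> B" and N: "N > 0"
    and U: "\<bar>U - N * q\<bar> \<le> \<epsilon> * N" and V: "\<bar>V - N * p\<bar> \<le> \<epsilon> * N" and \<epsilon>: "\<epsilon> \<le> p0 / 2"
  shows "\<bar>U / V - q / p\<bar> \<le> 2 * (1 + B) / p0 * \<epsilon>"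
proof -
  have \<epsilon>0: "0 \<le> \<epsilon> * N" using U by linarith
  have "N * p0 / 2 = N * p0 - p0 / 2 * N" by simp
  also have "\<dots> \<le> N * p - \<epsilon> * N" using p \<epsilon> N by (intro diff_mono mult_left_mono mult_right_mono) auto
  finally have V_low: "N * p0 / 2 \<le> V" using V by linarith
  then have V0: "V > 0" using N p by (smt (verit) divide_pos_pos mult_pos_pos)
  have "U / V - q / p = ((U - N * q) + q / p * (N * p - V)) / V"
    using V0 p by (simp add: field_simps)
  then have "\<bar>U / V - q / p\<bar> = \<bar>(U - N * q) + q / p * (N * p - V)\<bar> / V" using V0 by simp
  also have "\<dots> \<le> ((1 + B) * (\<epsilon> * N)) / (N * p0 / 2)"
  proof (rule frac_le)
    have t: "\<bar>q / p * (N * p - V)\<bar> \<le> B * (\<epsilon> * N)"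
      unfolding abs_mult using B V \<epsilon>0 by (intro mult_mono) (auto simp: abs_minus_commute)
    show "\<bar>(U - N * q) + q / p * (N * p - V)\<bar> \<le> (1 + B) * (\<epsilon> * N)"
      unfolding distrib_right mult_1_left by (rule order_trans[OF abs_triangle_ineq add_mono[OF U t]])
    show "0 < N * p0 / 2" using N p by simp
  qed (use B \<epsilon>0 V_low in auto)
  also have "\<dots> = 2 * (1 + B) / p0 * \<epsilon>" using N by simp
  finally show ?thesis .
qed

lemma average_close:
  fixes u v :: "nat \<Rightarrow> real"
  assumes "\<And>i. i \<in> {1..n} \<Longrightarrow> \<bar>u i - v i\<bar> \<le> \<epsilon>" "n \<ge> 1"
  shows "\<bar>(\<Sum>i=1..n. u i) / real n - (\<Sum>i=1..n. v i) / real n\<bar> \<le> \<epsilon>"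
proof -
  have "\<bar>\<Sum>i=1..n. u i - v i\<bar> \<le> (\<Sum>i=1..n. \<epsilon>)"
    using assms(1) by (intro order_trans[OF sum_abs] sum_mono) auto
  then have "\<bar>(\<Sum>i=1..n. u i) - (\<Sum>i=1..n. v i)\<bar> \<le> real n * \<epsilon>" by (simp add: sum_subtractf)
  then show ?thesis using assms(2) by (simp add: diff_divide_distrib[symmetric] divide_le_eq mult.commute)
qed

locale sampled_kernel = kernel_setup \<Omega> \<rho> \<sigma> T D c C s S L r a + prob_space M
  for \<Omega> :: "'a::euclidean_space set" and \<rho> \<sigma> and T :: "'a \<Rightarrow> 'b::euclidean_space"
    and D c C s S L r a and M :: "'envelope measure" +
  fixes X :: "nat \<Rightarrow> 'envelope \<Rightarrow> 'a"
  assumes X_measurable: "\<And>i. 1 \<le> i \<Longrightarrow> X i \<in> M \<rightarrow>\<^sub>M borel"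
    and X_indep: "indep_vars (\<lambda>_. borel) X {1..}"
    and X_law: "\<And>i. 1 \<le> i \<Longrightarrow> distr M borel (X i) = density lborel (\<lambda>x. ennreal (\<rho>0 x))"
begin

abbreviation \<mu> where "\<mu> \<equiv> density lborel (\<lambda>x. ennreal (\<rho>0 x))"

lemma law_prob: "prob_space \<mu>"
  using X_law[of 1] prob_space_distr[OF X_measurable[of 1]] by simp

lemma integral_law:
  fixes f :: "'a \<Rightarrow> real"
  assumes "f \<in> borel_measurable borel"
  shows "(\<integral>x. f x \<partial>\<mu>) = (\<integral>x. f x * \<rho>0 x \<partial>lborel)"
  using assms \<rho>0_bounds by (subst integral_real_density) (auto simp: mult.commute)

lemma AE_sample_in_domain: "AE \<omega> in M. \<forall>i\<ge>1. X i \<omega> \<in> \<Omega>"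
proof -
  have "AE x in \<mu>. x \<in> \<Omega>" by (subst AE_density) (auto simp: \<rho>0_def indicator_def)
  then have "AE \<omega> in M. X i \<omega> \<in> \<Omega>" if "i \<ge> 1" for i
    unfolding X_law[OF that, symmetric] by (subst (asm) AE_distr_iff[OF X_measurable[OF that]]) auto
  then show ?thesis unfolding AE_all_countable by (auto intro: AE_I2)
qed

text \<open>\<open>uniform_empirical_average\<close> with the means written as Lebesgue integrals.\<close>
lemma uniform_average:
  fixes f :: "nat \<Rightarrow> 'a \<Rightarrow> 'a \<Rightarrow> real" and b :: "nat \<Rightarrow> real" and k :: real
  assumes f: "\<And>n. n \<ge> 1 \<Longrightarrow> case_prod (f n) \<in> borel_measurable (borel \<Otimes>\<^sub>M borel)"
    and f0: "\<And>n x y. n \<ge> 1 \<Longrightarrow> 0 \<le> f n x y" "\<And>n x y. n \<ge> 1 \<Longrightarrow> f n x y \<le> B"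
    and k: "\<And>n x. n \<ge> 1 \<Longrightarrow> (\<integral>y. f n x y * \<rho>0 y \<partial>lborel) \<le> k * b n"
    and b: "filterlim (\<lambda>n. real n * b n / ln (real n)) at_top sequentially"
  shows "AE \<omega> in M. \<forall>\<epsilon>>0. \<forall>\<^sub>F n in sequentially. \<forall>i\<in>{1..n}.
     \<bar>(\<Sum>j=1..n. f n (X i \<omega>) (X j \<omega>)) - real n * (\<integral>y. f n (X i \<omega>) y * \<rho>0 y \<partial>lborel)\<bar> \<le> \<epsilon> * (real n * b n)"
proof -
  have fx: "f n x \<in> borel_measurable borel" if "n \<ge> 1" for n x
    using measurable_compose[OF _ f[OF that], of "\<lambda>y. (x, y)"] by simp
  have eq: "(\<integral>y. f n x y * \<rho>0 y \<partial>lborel) = (\<integral>y. f n x y \<partial>\<mu>)" if "n \<ge> 1" for n x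
    using integral_law[OF fx[OF that]] by simp
  have "AE \<omega> in M. \<forall>\<epsilon>>0. \<forall>\<^sub>F n in sequentially. \<forall>i\<in>{1..n}.
     \<bar>(\<Sum>j=1..n. f n (X i \<omega>) (X j \<omega>)) - real n * (\<integral>y. f n (X i \<omega>) y \<partial>\<mu>)\<bar> \<le> \<epsilon> * (real n * b n)"
  proof (rule uniform_empirical_average[OF law_prob _ X_measurable X_indep X_law _ f0 _ b])
    show "case_prod (f n) \<in> borel_measurable (\<mu> \<Otimes>\<^sub>M \<mu>)" if "n \<ge> 1" for n
    proof -
      have "sets (\<mu> \<Otimes>\<^sub>M \<mu>) = sets (borel \<Otimes>\<^sub>M borel)" by (intro sets_pair_measure_cong) auto
      from measurable_cong_sets[OF this refl] show ?thesis using f[OF that] by blast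
    qed
    show "(\<integral>y. f n x y \<partial>\<mu>) \<le> k * b n" if "n \<ge> 1" for n x using k[OF that] eq[OF that] by simp
  qed auto
  then show ?thesis
  proof eventually_elim
    case (elim \<omega>)
    show ?case
    proof (intro allI impI)
      fix \<epsilon> :: real assume "\<epsilon> > 0"
      with elim have "\<forall>\<^sub>F n in sequentially. \<forall>i\<in>{1..n}.
        \<bar>(\<Sum>j=1..n. f n (X i \<omega>) (X j \<omega>)) - real n * (\<integral>y. f n (X i \<omega>) y \<partial>\<mu>)\<bar> \<le> \<epsilon> * (real n * b n)" by blast
      with eventually_ge_at_top[of 1] show "\<forall>\<^sub>F n in sequentially. \<forall>i\<in>{1..n}.
        \<bar>(\<Sum>j=1..n. f n (X i \<omega>) (X j \<omega>)) - real n * (\<integral>y. f n (X i \<omega>) y * \<rho>0 y \<partial>lborel)\<bar> \<le> \<epsilon> * (real n * b n)"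
        by eventually_elim (simp add: eq)
    qed
  qed
qed

lemma n_over_ln: "filterlim (\<lambda>n. real n * 1 / ln (real n)) at_top sequentially"
  by real_asymp

lemma law_mean_bounds:
  assumes "g \<in> borel_measurable borel" "\<And>y. 0 \<le> g y" "\<And>y. g y \<le> B"
  shows "0 \<le> (\<integral>y. g y * \<rho>0 y \<partial>lborel)" "(\<integral>y. g y * \<rho>0 y \<partial>lborel) \<le> B"
proof -
  interpret \<mu>: prob_space \<mu> by (rule law_prob)
  have B: "0 \<le> B" using assms(2,3)[of undefined] by linarith
  show "0 \<le> (\<integral>y. g y * \<rho>0 y \<partial>lborel)" using assms(2) \<rho>0_bounds by (intro integral_nonneg_AE AE_I2) auto
  have "(\<integral>y. g y \<partial>\<mu>) \<le> (\<integral>y. B \<partial>\<mu>)" by (rule integral_mono') (use assms B in auto)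
  then show "(\<integral>y. g y * \<rho>0 y \<partial>lborel) \<le> B" using integral_law[OF assms(1)] \<mu>.prob_space by simp
qed

lemma law_mean_ge:
  assumes "g \<in> borel_measurable borel" "\<And>y. \<delta> \<le> g y" "\<And>y. g y \<le> B"
  shows "\<delta> \<le> (\<integral>y. g y * \<rho>0 y \<partial>lborel)"
proof -
  interpret \<mu>: prob_space \<mu> by (rule law_prob)
  have "\<bar>g y\<bar> \<le> \<bar>\<delta>\<bar> + \<bar>B\<bar>" for y using assms(2,3)[of y] by linarith
  then have "integrable \<mu> g" using assms(1) by (intro \<mu>.integrable_const_bound[of _ "\<bar>\<delta>\<bar> + \<bar>B\<bar>"]) auto
  then have "\<delta> \<le> (\<integral>y. g y \<partial>\<mu>)" by (rule \<mu>.integral_ge_const) (use assms(2) in auto)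
  then show ?thesis using integral_law[OF assms(1)] by simp
qed

text \<open>
  \<open>uniform_average\<close> for functions of the second argument alone, with means of order \<open>1\<close>: a law of
  large numbers for triangular arrays.
\<close>
lemma array_average_tendsto:
  fixes g :: "nat \<Rightarrow> 'a \<Rightarrow> real"
  assumes g: "\<And>n. n \<ge> 1 \<Longrightarrow> g n \<in> borel_measurable borel"
    and g0: "\<And>n x. n \<ge> 1 \<Longrightarrow> 0 \<le> g n x" "\<And>n x. n \<ge> 1 \<Longrightarrow> g n x \<le> B"
  shows "AE \<omega> in M. (\<lambda>n. (\<Sum>i=1..n. g n (X i \<omega>)) / real n - (\<integral>x. g n x * \<rho>0 x \<partial>lborel)) \<longlonglongrightarrow> 0"
proof -
  have "AE \<omega> in M. \<forall>\<epsilon>>0. \<forall>\<^sub>F n in sequentially. \<forall>i\<in>{1..n}.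
     \<bar>(\<Sum>j=1..n. g n (X j \<omega>)) - real n * (\<integral>y. g n y * \<rho>0 y \<partial>lborel)\<bar> \<le> \<epsilon> * (real n * 1)"
  proof (rule uniform_average[where f="\<lambda>n x y. g n y" and b="\<lambda>_. 1", OF _ g0 _ n_over_ln])
    show "(\<lambda>(x, y). g n y) \<in> borel_measurable (borel \<Otimes>\<^sub>M borel)" if "n \<ge> 1" for n
      using g[OF that] by measurable
    show "(\<integral>y. g n y * \<rho>0 y \<partial>lborel) \<le> B * 1" if "n \<ge> 1" for n
      using law_mean_bounds(2)[OF g[OF that] g0[OF that]] by simp
  qed
  then show ?thesis
  proof eventually_elim
    case (elim \<omega>)
    show ?case
    proof (rule LIMSEQ_I)
      fix \<epsilon> :: real assume "\<epsilon> > 0"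
      then have "\<forall>\<^sub>F n in sequentially. \<forall>i\<in>{1..n}.
         \<bar>(\<Sum>j=1..n. g n (X j \<omega>)) - real n * (\<integral>y. g n y * \<rho>0 y \<partial>lborel)\<bar> \<le> \<epsilon> / 2 * (real n * 1)"
        by (intro elim[THEN spec, THEN mp]) simp
      with eventually_ge_at_top[of 1]
      have "\<forall>\<^sub>F n in sequentially. norm ((\<Sum>i=1..n. g n (X i \<omega>)) / real n - (\<integral>x. g n x * \<rho>0 x \<partial>lborel) - 0) < \<epsilon>"
      proof eventually_elim
        case (elim n)
        then have b: "\<bar>(\<Sum>j=1..n. g n (X j \<omega>)) - real n * (\<integral>y. g n y * \<rho>0 y \<partial>lborel)\<bar> \<le> \<epsilon> / 2 * (real n * 1)"
          by (metis atLeastAtMost_iff order_refl)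
        have "(\<Sum>i=1..n. g n (X i \<omega>)) / real n - (\<integral>x. g n x * \<rho>0 x \<partial>lborel) =
           ((\<Sum>j=1..n. g n (X j \<omega>)) - real n * (\<integral>y. g n y * \<rho>0 y \<partial>lborel)) / real n"
          using elim(1) by (simp add: field_simps)
        then have "norm ((\<Sum>i=1..n. g n (X i \<omega>)) / real n - (\<integral>x. g n x * \<rho>0 x \<partial>lborel)) \<le> \<epsilon> / 2"
          using b elim(1) by (simp add: divide_le_eq)
        then show ?case using \<open>\<epsilon> > 0\<close> by simp
      qed
      then show "\<exists>N. \<forall>n\<ge>N. norm ((\<Sum>i=1..n. g n (X i \<omega>)) / real n - (\<integral>x. g n x * \<rho>0 x \<partial>lborel) - 0) < \<epsilon>"
        by (simp add: eventually_sequentially)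
    qed
  qed
qed

text \<open>
  Uniformly in \<open>i\<close>, the inner average over \<open>j\<close> is close to its mean given \<open>X i\<close>; the outer average
  over \<open>i\<close> of these means obeys the law of large numbers.
\<close>
lemma V_statistic_tendsto:
  fixes \<phi> :: "'a \<Rightarrow> 'a \<Rightarrow> real"
  assumes \<phi>: "case_prod \<phi> \<in> borel_measurable (borel \<Otimes>\<^sub>M borel)" and \<phi>0: "\<And>x y. 0 \<le> \<phi> x y" "\<And>x y. \<phi> x y \<le> B"
  shows "AE \<omega> in M. (\<lambda>n. 1 / (real n)\<^sup>2 * (\<Sum>i=1..n. \<Sum>j=1..n. \<phi> (X i \<omega>) (X j \<omega>)))
     \<longlonglongrightarrow> (\<integral>x. (\<integral>y. \<phi> x y * \<rho>0 y \<partial>lborel) * \<rho>0 x \<partial>lborel)"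
proof -
  define m where "m x = (\<integral>y. \<phi> x y * \<rho>0 y \<partial>lborel)" for x
  note \<phi>[measurable]
  have \<phi>x: "\<phi> x \<in> borel_measurable borel" for x by measurable
  have m[measurable]: "m \<in> borel_measurable borel" unfolding m_def by measurable
  note m0 = law_mean_bounds[OF \<phi>x \<phi>0, folded m_def]
  have "AE \<omega> in M. (\<lambda>n. (\<Sum>i=1..n. m (X i \<omega>)) / real n - (\<integral>x. m x * \<rho>0 x \<partial>lborel)) \<longlonglongrightarrow> 0"
    by (rule array_average_tendsto[OF m m0])
  moreover have "AE \<omega> in M. \<forall>\<epsilon>>0. \<forall>\<^sub>F n in sequentially. \<forall>i\<in>{1..n}.
     \<bar>(\<Sum>j=1..n. \<phi> (X i \<omega>) (X j \<omega>)) - real n * m (X i \<omega>)\<bar> \<le> \<epsilon> * (real n * 1)"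
    unfolding m_def by (rule uniform_average[where f="\<lambda>_. \<phi>" and b="\<lambda>_. 1", OF \<phi> \<phi>0 _ n_over_ln])
     (use m0(2) in \<open>simp add: m_def\<close>)
  ultimately show ?thesis
  proof eventually_elim
    case (elim \<omega>)
    have "(\<lambda>n. 1 / (real n)\<^sup>2 * (\<Sum>i=1..n. \<Sum>j=1..n. \<phi> (X i \<omega>) (X j \<omega>)) - (\<Sum>i=1..n. m (X i \<omega>)) / real n) \<longlonglongrightarrow> 0"
    proof (rule LIMSEQ_I)
      fix \<epsilon> :: real assume "\<epsilon> > 0"
      then have "\<forall>\<^sub>F n in sequentially. \<forall>i\<in>{1..n}.
         \<bar>(\<Sum>j=1..n. \<phi> (X i \<omega>) (X j \<omega>)) - real n * m (X i \<omega>)\<bar> \<le> \<epsilon> / 2 * (real n * 1)"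
        by (intro elim(2)[THEN spec, THEN mp]) simp
      with eventually_ge_at_top[of 1]
      have "\<forall>\<^sub>F n in sequentially. norm (1 / (real n)\<^sup>2 * (\<Sum>i=1..n. \<Sum>j=1..n. \<phi> (X i \<omega>) (X j \<omega>)) -
          (\<Sum>i=1..n. m (X i \<omega>)) / real n - 0) < \<epsilon>"
      proof eventually_elim
        case (elim n)
        have "\<bar>(\<Sum>i=1..n. (\<Sum>j=1..n. \<phi> (X i \<omega>) (X j \<omega>)) / real n) / real n - (\<Sum>i=1..n. m (X i \<omega>)) / real n\<bar>
            \<le> \<epsilon> / 2"
        proof (rule average_close[OF _ elim(1)])
          fix i assume i: "i \<in> {1..n}"
          have "(\<Sum>j=1..n. \<phi> (X i \<omega>) (X j \<omega>)) / real n - m (X i \<omega>)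
              = ((\<Sum>j=1..n. \<phi> (X i \<omega>) (X j \<omega>)) - real n * m (X i \<omega>)) / real n"
            using elim(1) by (simp add: field_simps)
          then show "\<bar>(\<Sum>j=1..n. \<phi> (X i \<omega>) (X j \<omega>)) / real n - m (X i \<omega>)\<bar> \<le> \<epsilon> / 2"
            using elim(2)[rule_format, OF i] elim(1) by (simp add: divide_le_eq)
        qed
        then show ?case using \<open>\<epsilon> > 0\<close> by (simp add: sum_divide_distrib[symmetric] power2_eq_square)
      qed
      then show "\<exists>N. \<forall>n\<ge>N. norm (1 / (real n)\<^sup>2 * (\<Sum>i=1..n. \<Sum>j=1..n. \<phi> (X i \<omega>) (X j \<omega>)) -
          (\<Sum>i=1..n. m (X i \<omega>)) / real n - 0) < \<epsilon>"
        by (simp add: eventually_sequentially)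
    qed
    from tendsto_add[OF tendsto_add[OF this elim(1)] tendsto_const[of "\<integral>x. m x * \<rho>0 x \<partial>lborel"]]
    show ?case by (simp add: m_def)
  qed
qed

text \<open>
  Uniformly in \<open>i\<close>, the ratio of the two empirical sums is close to \<open>moment / mass\<close> at \<open>X i\<close>; the
  average of the latter follows its expectation, whose limit is \<open>mean_ratio_tendsto\<close>.
\<close>
theorem local_average_tendsto:
  fixes h :: "nat \<Rightarrow> real"
  assumes h0: "\<And>n. n \<ge> 1 \<Longrightarrow> h n > 0" and h: "h \<longlonglongrightarrow> 0"
    and growth: "filterlim (\<lambda>n. real n * h n ^ DIM('a) / ln (real n)) at_top sequentially"
  shows "AE \<omega> in M. (\<lambda>n. (\<Sum>i=1..n. (\<Sum>j=1..n. kernel (h n) (X i \<omega>) (X j \<omega>) * logsq (h n) (X i \<omega>) (X j \<omega>)) /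
      (\<Sum>j=1..n. kernel (h n) (X i \<omega>) (X j \<omega>))) / real n) \<longlonglongrightarrow> (\<integral>x. energy x * \<rho>0 x \<partial>lborel)"
proof -
  define W where "W = (\<integral>z. envelope z \<partial>lborel)"
  have W: "0 \<le> W" unfolding W_def by (intro integral_nonneg_AE AE_I2) simp
  obtain p B where p: "p > 0" "\<And>x h. x \<in> \<Omega> \<Longrightarrow> 0 < h \<Longrightarrow> h < r \<Longrightarrow> p \<le> mass h x"
    and B: "B \<ge> 0" "\<And>x h. x \<in> \<Omega> \<Longrightarrow> 0 < h \<Longrightarrow> h < r \<Longrightarrow> 0 \<le> moment h x / mass h x"
      "\<And>x h. x \<in> \<Omega> \<Longrightarrow> 0 < h \<Longrightarrow> h < r \<Longrightarrow> moment h x / mass h x \<le> B"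
    by (rule ratio_bounds) blast
  \<comment> \<open>\<open>mass\<close> is bounded below only for \<open>h < r\<close>, so the ratio is cut off for the finitely many
    other \<open>n\<close> to be bounded for all \<open>n\<close>.\<close>
  define g where "g n x = (if h n < r then indicator \<Omega> x * (moment (h n) x / mass (h n) x) else 0)" for n x
  have g0: "0 \<le> g n x" "g n x \<le> B" if "n \<ge> 1" for n x
    using B(1) B(2,3)[of x "h n"] h0[OF that] by (auto simp: g_def indicator_def)
  have gm: "g n \<in> borel_measurable borel" for n unfolding g_def by measurable
  have small: "\<forall>\<^sub>F n in sequentially. h n < r" using h r_pos by (rule order_tendstoD)
  have "(\<lambda>n. \<integral>x. g n x * \<rho>0 x \<partial>lborel) \<longlonglongrightarrow> (\<integral>x. energy x * \<rho>0 x \<partial>lborel)"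
  proof (rule Lim_transform_eventually)
    \<comment> \<open>\<open>h 0\<close> may fail to be positive.\<close>
    define h' where "h' n = (if n = 0 then 1 else h n)" for n
    have ev: "\<forall>\<^sub>F n in sequentially. h n = h' n" using eventually_ge_at_top[of 1]
        by eventually_elim (simp add: h'_def)
    have "h' \<longlonglongrightarrow> 0" by (rule Lim_transform_eventually[OF h ev])
    then show "(\<lambda>n. \<integral>x. moment (h' n) x / mass (h' n) x * \<rho>0 x \<partial>lborel) \<longlonglongrightarrow> (\<integral>x. energy x * \<rho>0 x \<partial>lborel)"
      by (rule mean_ratio_tendsto) (use h0 in \<open>simp add: h'_def\<close>)
    show "\<forall>\<^sub>F n in sequentially. (\<integral>x. moment (h' n) x / mass (h' n) x * \<rho>0 x \<partial>lborel)
        = (\<integral>x. g n x * \<rho>0 x \<partial>lborel)"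
      using ev small by eventually_elim (auto simp: g_def \<rho>0_def indicator_def intro!:
          Bochner_Integration.integral_cong)
  qed
  note mean = this
  let ?b = "\<lambda>n. h n ^ DIM('a)"
  have avg: "AE \<omega> in M. (\<lambda>n. (\<Sum>i=1..n. g n (X i \<omega>)) / real n - (\<integral>x. g n x * \<rho>0 x \<partial>lborel)) \<longlonglongrightarrow> 0"
    by (rule array_average_tendsto[OF gm g0])
  have den: "AE \<omega> in M. \<forall>\<epsilon>>0. \<forall>\<^sub>F n in sequentially. \<forall>i\<in>{1..n}.
     \<bar>(\<Sum>j=1..n. kernel (h n) (X i \<omega>) (X j \<omega>)) - real n * (\<integral>y. kernel (h n) (X i \<omega>) y * \<rho>0 y \<partial>lborel)\<bar>
         \<le> \<epsilon> * (real n * ?b n)"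
  proof (rule uniform_average[where f="\<lambda>n. kernel (h n)" and b="?b" and k="C * W", OF _ kernel_bounds _ growth])
    show "(\<lambda>(x, y). kernel (h n) x y) \<in> borel_measurable (borel \<Otimes>\<^sub>M borel)" for n by measurable
    show "(\<integral>y. kernel (h n) x y * \<rho>0 y \<partial>lborel) \<le> C * W * ?b n" if n: "n \<ge> 1" for n x
    proof (cases "x \<in> \<Omega>")
      case True
      then show ?thesis using kernel_integral(1)[OF True h0[OF n]] mass_upper[of "h n" x] h0[OF n]
        by (simp add: W_def mult.commute)
    next
      case False
      then show ?thesis using W C_pos h0[OF n] by (simp add: kernel_def)
    qed
  qed
  have num: "AE \<omega> in M. \<forall>\<epsilon>>0. \<forall>\<^sub>F n in sequentially. \<forall>i\<in>{1..n}.
     \<bar>(\<Sum>j=1..n. kernel (h n) (X i \<omega>) (X j \<omega>) * logsq (h n) (X i \<omega>) (X j \<omega>)) -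
       real n * (\<integral>y. kernel (h n) (X i \<omega>) y * logsq (h n) (X i \<omega>) y * \<rho>0 y \<partial>lborel)\<bar> \<le> \<epsilon> * (real n * ?b n)"
  proof (rule uniform_average[where f="\<lambda>n x y. kernel (h n) x y * logsq (h n) x y" and b="?b" and k="C * L\<^sup>2
      * W", OF _ kernel_logsq_bounds _ growth])
    show "(\<lambda>(x, y). kernel (h n) x y * logsq (h n) x y) \<in> borel_measurable (borel \<Otimes>\<^sub>M borel)" for n
        by measurable
    show "(\<integral>y. kernel (h n) x y * logsq (h n) x y * \<rho>0 y \<partial>lborel) \<le> C * L\<^sup>2 * W * ?b n" if n: "n \<ge> 1" for n x
    proof (cases "x \<in> \<Omega>")
      case True
      then show ?thesis using kernel_integral(2)[OF True h0[OF n]] moment_bounds(2)[OF True h0[OF n]] h0[OF n]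
        by (simp add: W_def mult.commute)
    next
      case False
      then show ?thesis using W C_pos h0[OF n] by (simp add: kernel_def)
    qed
  qed (use h0 in auto)
  from avg den num AE_sample_in_domain show ?thesis
  proof eventually_elim
    case (elim \<omega>)
    define V where "V n i = (\<Sum>j=1..n. kernel (h n) (X i \<omega>) (X j \<omega>))" for n i
    define U where "U n i = (\<Sum>j=1..n. kernel (h n) (X i \<omega>) (X j \<omega>) * logsq (h n) (X i \<omega>) (X j \<omega>))" for n i
    have "(\<lambda>n. (\<Sum>i=1..n. U n i / V n i) / real n - (\<Sum>i=1..n. g n (X i \<omega>)) / real n) \<longlonglongrightarrow> 0"
    proof (rule LIMSEQ_I)
      fix \<eta> :: real assume \<eta>: "\<eta> > 0"
      define \<epsilon> where "\<epsilon> = min (p / 2) (\<eta> * p / (4 * (1 + B)))"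
      have \<epsilon>: "\<epsilon> > 0" "\<epsilon> \<le> p / 2"
        using \<eta> p(1) B(1) min.cobounded1[of "p / 2" "\<eta> * p / (4 * (1 + B))"] by (simp_all only: \<epsilon>_def) simp_all
      have "\<epsilon> \<le> \<eta> * p / (4 * (1 + B))" by (simp add: \<epsilon>_def)
      then have \<epsilon>\<eta>: "2 * (1 + B) / p * \<epsilon> \<le> \<eta> / 2" using p(1) B(1) by (simp add: field_simps)
      have "\<forall>\<^sub>F n in sequentially. norm ((\<Sum>i=1..n. U n i / V n i) / real n - (\<Sum>i=1..n. g n (X i \<omega>)) / real n
          - 0) < \<eta>"
        using elim(2)[THEN spec, THEN mp, OF \<epsilon>(1)] elim(3)[THEN spec, THEN mp, OF \<epsilon>(1)] small
            eventually_ge_at_top[of 1]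
      proof eventually_elim
        case (elim n)
        have hn: "h n > 0" using h0 elim(4) by simp
        let ?N = "real n * ?b n"
        have N: "?N > 0" using hn elim(4) by simp
        have "\<bar>U n i / V n i - g n (X i \<omega>)\<bar> \<le> 2 * (1 + B) / p * \<epsilon>" if i: "i \<in> {1..n}" for i
        proof -
          have x: "X i \<omega> \<in> \<Omega>" using \<open>\<forall>i\<ge>1. X i \<omega> \<in> \<Omega>\<close> i by simp
          have "\<bar>V n i - ?N * mass (h n) (X i \<omega>)\<bar> \<le> \<epsilon> * ?N"
            using elim(1)[rule_format, OF i] unfolding V_def kernel_integral(1)[OF x hn]
                by (simp add: mult.assoc)
          moreover have "\<bar>U n i - ?N * moment (h n) (X i \<omega>)\<bar> \<le> \<epsilon> * ?N"
            using elim(2)[rule_format, OF i] unfolding U_def kernel_integral(2)[OF x hn]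
                by (simp add: mult.assoc)
          ultimately have "\<bar>U n i / V n i - moment (h n) (X i \<omega>) / mass (h n) (X i \<omega>)\<bar> \<le> 2 * (1 + B) / p * \<epsilon>"
            using p(2)[OF x hn elim(3)] B(2,3)[OF x hn elim(3)] N \<epsilon>(2) p(1)
            by (intro quotient_perturbation[where N="?N"]) auto
          then show ?thesis using x elim(3) by (simp add: g_def)
        qed
        then have "\<bar>(\<Sum>i=1..n. U n i / V n i) / real n - (\<Sum>i=1..n. g n (X i \<omega>)) / real n\<bar> \<le> 2 * (1 + B) / p * \<epsilon>"
          by (rule average_close[OF _ elim(4)])
        then show ?case using \<epsilon>\<eta> \<eta> by simp
      qed
      then show "\<exists>N. \<forall>n\<ge>N. norm ((\<Sum>i=1..n. U n i / V n i) / real n - (\<Sum>i=1..n. g n (X i \<omega>)) / real n - 0) < \<eta>"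
        by (simp add: eventually_sequentially)
    qed
    from tendsto_add[OF tendsto_add[OF this elim(1)] mean] show ?case by (simp add: U_def V_def)
  qed
qed

end

section \<open>The Kullback-Leibler functional\<close>

lemma gradient_norm:
  fixes f :: "'a::euclidean_space \<Rightarrow> real"
  assumes f: "(f has_derivative f') (at x)"
  shows "(norm (gradient f x))\<^sup>2 = (\<Sum>b\<in>Basis. (f' b)\<^sup>2)"
proof -
  define G where "G = (\<Sum>b\<in>Basis. f' b *\<^sub>R b)"
  have lin: "linear f'" using f by (rule has_derivative_linear)
  have G: "f' h = h \<bullet> G" for h
  proof -
    have "f' h = f' (\<Sum>b\<in>Basis. (h \<bullet> b) *\<^sub>R b)" by (simp add: euclidean_representation)
    also have "\<dots> = (\<Sum>b\<in>Basis. (h \<bullet> b) * f' b)" using lin by (simp add: linear_sum linear_scale)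
    finally show ?thesis by (simp add: G_def inner_sum_right mult.commute)
  qed
  have deriv: "GDERIV f x :> G" using f by (simp add: gderiv_def G[symmetric])
  have "gradient f x = G" unfolding gradient_def
  proof (rule the_equality, rule deriv)
    fix H assume "GDERIV f x :> H"
    then have "(\<lambda>h. h \<bullet> H) = (\<lambda>h. h \<bullet> G)"
      using deriv unfolding gderiv_def by (rule has_derivative_unique)
    then show "H = G" by (metis vector_eq_ldot)
  qed
  then have "(norm (gradient f x))\<^sup>2 = (\<Sum>b\<in>Basis. (G \<bullet> b)\<^sup>2)"
    unfolding power2_norm_eq_inner by (subst euclidean_inner) (simp add: power2_eq_square)
  also have "\<dots> = (\<Sum>b\<in>Basis. (f' b)\<^sup>2)" by (simp add: G inner_commute)
  finally show ?thesis .
qed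

lemma sum_gradient_norm:
  fixes T :: "'a::euclidean_space \<Rightarrow> real^'m"
  assumes T: "(T has_derivative T') (at x)"
  shows "(\<Sum>i\<in>UNIV. (norm (gradient (\<lambda>y. T y $ i) x))\<^sup>2) = (\<Sum>b\<in>Basis. (norm (T' b))\<^sup>2)"
proof -
  have d: "((\<lambda>y. T y $ i) has_derivative (\<lambda>h. T' h $ i)) (at x)" for i
    by (rule bounded_linear.has_derivative[OF bounded_linear_vec_nth T])
  have "(\<Sum>i\<in>UNIV. (norm (gradient (\<lambda>y. T y $ i) x))\<^sup>2) = (\<Sum>i\<in>UNIV. \<Sum>b\<in>Basis. (T' b $ i)\<^sup>2)"
    by (intro sum.cong refl gradient_norm[OF d])
  also have "\<dots> = (\<Sum>b\<in>Basis. \<Sum>i\<in>UNIV. (T' b $ i)\<^sup>2)" by (rule sum.swap)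
  also have "\<dots> = (\<Sum>b\<in>Basis. (norm (T' b))\<^sup>2)"
    by (simp add: power2_norm_eq_inner inner_vec_def) (simp add: power2_eq_square)
  finally show ?thesis .
qed

lemma sigma_kappa_mono:
  fixes \<rho>1 \<rho>2 :: "real^'d \<Rightarrow> real"
  assumes "0 < \<kappa>" "0 < \<rho>1 x" "\<rho>1 x \<le> \<rho>2 y"
  shows "sigma_kappa \<kappa> \<rho>2 y \<le> sigma_kappa \<kappa> \<rho>1 x"
  unfolding sigma_kappa_def using assms
  by (intro mult_left_mono powr_mono2 divide_left_mono) auto

lemma sigma_kappa_square:
  fixes \<rho> :: "real^'d \<Rightarrow> real"
  assumes \<kappa>: "0 < \<kappa>" and \<rho>: "0 < \<rho> x"
  shows "(sigma_kappa \<kappa> \<rho> x)\<^sup>2 * \<rho> x =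
    \<kappa> powr (2 / real CARD('d)) / (2 * pi * exp 1) * \<rho> x powr (1 - 2 / real CARD('d))"
proof -
  let ?d = "real CARD('d)"
  have "((\<kappa> / \<rho> x) powr (1 / ?d))\<^sup>2 = (\<kappa> / \<rho> x) powr (2 / ?d)"
    using assms by (simp add: powr_power)
  also have "\<dots> = \<kappa> powr (2 / ?d) / \<rho> x powr (2 / ?d)" using assms by (simp add: powr_divide)
  finally have 1: "((\<kappa> / \<rho> x) powr (1 / ?d))\<^sup>2 = \<kappa> powr (2 / ?d) / \<rho> x powr (2 / ?d)" .
  have 2: "\<rho> x powr (1 - 2 / ?d) = \<rho> x / \<rho> x powr (2 / ?d)" using \<rho> by (simp add: powr_diff)
  have "(1 / sqrt (2 * pi * exp 1))\<^sup>2 = 1 / (2 * pi * exp 1)"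
    by (simp add: power_divide)
  then show ?thesis unfolding sigma_kappa_def power_mult_distrib 1 2 by simp
qed

theorem theorem2p4:
  fixes \<Omega> :: "(real^'d) set"
    and \<rho> :: "real^'d \<Rightarrow> real"
    and \<mu> :: "(real^'d) measure"
    and M :: "'w measure"
    and X :: "nat \<Rightarrow> 'w \<Rightarrow> real^'d"
    and \<kappa> :: real
    and h :: "nat \<Rightarrow> real"
    and T :: "real^'d \<Rightarrow> real^'m"
  assumes "bounded_C2_domain \<Omega>"
    and "set_borel_measurable borel (closure \<Omega>) \<rho>"
    and "\<exists>c C. 0 < c \<and> 0 < C \<and> (\<forall>x\<in>\<Omega>. c \<le> \<rho> x \<and> \<rho> x \<le> C)"
    and "\<mu> = density lborel (\<lambda>x. ennreal (indicator (closure \<Omega>) x * \<rho> x))"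
    and "prob_space \<mu>"
    and "prob_space M"
    and "prob_space.indep_vars M (\<lambda>_. borel) X {1..}"
    and "\<And>i. 1 \<le> i \<Longrightarrow> distr M borel (X i) = \<mu>"
    and "0 < \<kappa>"
    and "\<And>n. 1 \<le> n \<Longrightarrow> 0 < h n"
    and "h \<longlonglongrightarrow> 0"
    and "filterlim (\<lambda>n. real n * h n ^ CARD('d) / ln (real n)) at_top sequentially"
    and "C2_closure \<Omega> T"
  shows "AE \<omega> in M. (\<lambda>n. KL_emp \<kappa> \<rho> (h n) (\<lambda>i. X i \<omega>) n T) \<longlonglongrightarrow> KL_lim \<kappa> \<Omega> \<rho> T"
proof -
  interpret M: prob_space M by fact
  have op: "open \<Omega>" and bdd: "bounded \<Omega>" and comp: "compact (closure \<Omega>)"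
    using assms(1) by (simp_all add: bounded_C2_domain_def compact_closure)
  have \<Omega>[measurable]: "\<Omega> \<in> sets borel" using op by simp
  \<comment> \<open>Constants outside \<open>\<Omega>\<close> make the density and the map Borel, and the density bounded, on the
    whole space.\<close>
  obtain c C0 where c: "0 < c" "\<And>x. x \<in> \<Omega> \<Longrightarrow> c \<le> \<rho> x" and C0: "\<And>x. x \<in> \<Omega> \<Longrightarrow> \<rho> x \<le> C0"
    using assms(3) by blast
  define C where "C = max c C0"
  define \<rho>' where "\<rho>' x = (if x \<in> \<Omega> then \<rho> x else c)" for x
  have \<rho>'_bounds: "c \<le> \<rho>' x" "\<rho>' x \<le> C" for x
    using c C0 by (auto simp: \<rho>'_def C_def le_max_iff_disj)
  have \<rho>c[measurable]: "(\<lambda>x. indicator (closure \<Omega>) x * \<rho> x) \<in> borel_measurable borel"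
    using assms(2) by (simp add: set_borel_measurable_def)
  have \<rho>'_meas[measurable]: "\<rho>' \<in> borel_measurable borel"
  proof -
    have "(\<lambda>x. if x \<in> \<Omega> then indicator (closure \<Omega>) x * \<rho> x else c) \<in> borel_measurable borel" by measurable
    also have "(\<lambda>x. if x \<in> \<Omega> then indicator (closure \<Omega>) x * \<rho> x else c) = \<rho>'"
      using closure_subset[of \<Omega>] by (auto simp: \<rho>'_def fun_eq_iff)
    finally show ?thesis .
  qed
  define \<sigma> where "\<sigma> = sigma_kappa \<kappa> \<rho>'"
  define s where "s = sigma_kappa \<kappa> (\<lambda>_::real^'d. C) undefined"
  define S where "S = sigma_kappa \<kappa> (\<lambda>_::real^'d. c) undefined"
  have C_pos: "C > 0" using c by (simp add: C_def)
  have \<sigma>_bounds: "s \<le> \<sigma> x" "\<sigma> x \<le> S" for x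
    unfolding s_def S_def \<sigma>_def using \<rho>'_bounds[of x] c(1) assms(9)
    by (auto intro!: sigma_kappa_mono)
  have s_pos: "0 < s" unfolding s_def sigma_kappa_def using assms(9) C_pos by simp
  have \<sigma>_meas: "\<sigma> \<in> borel_measurable borel" unfolding \<sigma>_def sigma_kappa_def by measurable
  define T' where "T' x = (if x \<in> \<Omega> then T x else 0)" for x
  have Tc: "continuous_on (closure \<Omega>) T" using assms(13) by (simp add: C2_closure_def)
  obtain D where Dc: "continuous_on (closure \<Omega>) D"
    and TD: "\<And>x. x \<in> \<Omega> \<Longrightarrow> (T has_derivative blinfun_apply (D x)) (at x)"
    using assms(13) unfolding C2_closure_def by blast
  have T'D: "(T' has_derivative blinfun_apply (D x)) (at x)" if "x \<in> \<Omega>" for x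
    by (rule has_derivative_transform_within_open[OF TD[OF that] op that]) (simp add: T'_def)
  have T'_meas[measurable]: "T' \<in> borel_measurable borel"
  proof -
    have "(\<lambda>x. indicator \<Omega> x *\<^sub>R T x) \<in> borel_measurable borel"
      using continuous_on_subset[OF Tc closure_subset] by (intro borel_measurable_continuous_on_indicator) auto
    also have "(\<lambda>x. indicator \<Omega> x *\<^sub>R T x) = T'" by (auto simp: T'_def)
    finally show ?thesis .
  qed
  have "bounded (D ` closure \<Omega>)" "bounded (T ` closure \<Omega>)"
    by (auto intro!: compact_imp_bounded compact_continuous_image Dc Tc comp)
  then obtain L1 R where L1: "\<And>x. x \<in> closure \<Omega> \<Longrightarrow> norm (D x) \<le> L1"
    and R: "R > 0" "\<And>x. x \<in> closure \<Omega> \<Longrightarrow> norm (T x) \<le> R"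
    by (auto simp: bounded_pos)
  obtain L2 where L2: "L2 \<ge> 0" "\<And>x y. x \<in> \<Omega> \<Longrightarrow> y \<in> \<Omega> \<Longrightarrow> norm (T x - T y) \<le> L2 * norm (x - y)"
    using C1_imp_lipschitz[OF assms(1,13)] by blast
  define L where "L = max L1 L2"
  obtain r a where ra: "r > 0" "a > 0" and cone: "\<And>x. x \<in> closure \<Omega> \<Longrightarrow> \<exists>e. interior_cone \<Omega> x r a e"
    using uniform_cone[OF assms(1)] by blast
  have cl: "x \<in> closure \<Omega>" if "x \<in> \<Omega>" for x using that closure_subset by auto
  interpret kernel_setup \<Omega> \<rho>' \<sigma> T' D c C s S L r a
  proof
    show "continuous_on \<Omega> D" using Dc closure_subset by (rule continuous_on_subset)
    show "norm (D x) \<le> L" if "x \<in> \<Omega>" for x using L1[OF cl[OF that]] by (simp add: L_def)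
    show "norm (T' x - T' y) \<le> L * norm (x - y)" if "x \<in> \<Omega>" "y \<in> \<Omega>" for x y
      using L2(2)[OF that] that mult_right_mono[of L2 L "norm (x - y)"] by (simp add: T'_def L_def)
    show "0 \<le> L" using L2(1) by (simp add: L_def)
    show "\<exists>e. interior_cone \<Omega> x r a e" if "x \<in> \<Omega>" for x by (rule cone[OF cl[OF that]])
  qed (use op bdd \<rho>'_bounds \<rho>'_meas \<sigma>_bounds s_pos \<sigma>_meas T'_meas T'D ra c(1) in auto)
  have law: "\<mu> = density lborel (\<lambda>x. ennreal (\<rho>0 x))"
    unfolding assms(4)
  proof (rule density_cong)
    show "AE x in lborel. ennreal (indicator (closure \<Omega>) x * \<rho> x) = ennreal (\<rho>0 x)"
    proof (rule AE_I'[OF frontier_null_set[OF assms(1)]])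
      show "{x \<in> space lborel. ennreal (indicator (closure \<Omega>) x * \<rho> x) \<noteq> ennreal (\<rho>0 x)} \<subseteq> frontier \<Omega>"
        using op cl by (auto simp: \<rho>0_def \<rho>'_def frontier_def interior_open indicator_def split: if_splits)
    qed
  qed measurable
  interpret sampled_kernel \<Omega> \<rho>' \<sigma> T' D c C s S L r a M X
  proof
    show "X i \<in> M \<rightarrow>\<^sub>M borel" if "1 \<le> i" for i
      using assms(7) that unfolding M.indep_vars_def by auto
  qed (use assms(7,8) law in auto)
  define \<phi> where "\<phi> x y = 1 / (1 + (norm (T' x - T' y))\<^sup>2)" for x y
  have \<phi>_meas[measurable]: "case_prod \<phi> \<in> borel_measurable (borel \<Otimes>\<^sub>M borel)" unfolding \<phi>_def by measurable
  have \<phi>_bounds: "0 \<le> \<phi> x y" "\<phi> x y \<le> 1" for x y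
    using add_pos_nonneg[of 1 "(norm (T' x - T' y))\<^sup>2"] by (auto simp: \<phi>_def)
  define I where "I = (\<integral>x. (\<integral>y. \<phi> x y * \<rho>0 y \<partial>lborel) * \<rho>0 x \<partial>lborel)"
  \<comment> \<open>The logarithm is continuous at \<open>I\<close> because \<open>\<phi>\<close>, hence also \<open>I\<close>, is bounded below.\<close>
  have I_pos: "I > 0"
  proof -
    define \<delta> where "\<delta> = 1 / (1 + (2 * R)\<^sup>2)"
    have "\<delta> \<le> \<phi> x y" for x y
    proof -
      have "norm (T' x) \<le> R" for x using R cl by (auto simp: T'_def)
      then have "norm (T' x - T' y) \<le> 2 * R" using norm_triangle_ineq4[of "T' x" "T' y"] by (smt (verit))
      then have "(norm (T' x - T' y))\<^sup>2 \<le> (2 * R)\<^sup>2" by (intro power_mono) auto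
      then show ?thesis unfolding \<delta>_def \<phi>_def by (intro divide_left_mono)
          (auto intro!: mult_pos_pos add_pos_nonneg)
    qed
    have \<phi>x: "\<phi> x \<in> borel_measurable borel" for x by measurable
    have "\<delta> \<le> I" unfolding I_def
      by (intro law_mean_ge[where B=1] law_mean_ge[OF \<phi>x \<open>\<And>y. \<delta> \<le> \<phi> _ y\<close> \<phi>_bounds(2)]
          law_mean_bounds[OF \<phi>x \<phi>_bounds]) measurable
    moreover have "\<delta> > 0" by (auto simp: \<delta>_def intro!: add_pos_nonneg)
    ultimately show ?thesis by linarith
  qed
  define A where "A = (\<integral>x. energy x * \<rho>0 x \<partial>lborel)"
  have KL: "KL_lim \<kappa> \<Omega> \<rho> T = A + ln I"
  proof -
    define k where "k = \<kappa> powr (2 / real CARD('d)) / (2 * pi * exp 1)"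
    have "k * (LINT x:\<Omega>|lborel. (\<Sum>i\<in>UNIV. (norm (gradient (\<lambda>y. T y $ i) x))\<^sup>2) * \<rho> x powr (1 - 2
        / real CARD('d)))
      = (\<integral>x. k * (indicator \<Omega> x *\<^sub>R ((\<Sum>i\<in>UNIV. (norm (gradient (\<lambda>y. T y $ i) x))\<^sup>2) * \<rho> x powr (1 - 2
          / real CARD('d)))) \<partial>lborel)"
      unfolding set_lebesgue_integral_def by simp
    also have "\<dots> = A" unfolding A_def
    proof (rule Bochner_Integration.integral_cong[OF refl])
      fix x
      show "k * (indicator \<Omega> x *\<^sub>R ((\<Sum>i\<in>UNIV. (norm (gradient (\<lambda>y. T y $ i) x))\<^sup>2) * \<rho> x powr (1 - 2
          / real CARD('d)))) = energy x * \<rho>0 x"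
      proof (cases "x \<in> \<Omega>")
        case True
        have "\<rho>' x > 0" using \<rho>'_bounds(1)[of x] c(1) by linarith
        from sigma_kappa_square[where \<rho>=\<rho>' and x=x, OF assms(9) this]
        have "(\<sigma> x)\<^sup>2 * \<rho> x = k * \<rho> x powr (1 - 2 / real CARD('d))"
          using True by (simp add: \<sigma>_def \<rho>'_def k_def)
        moreover have "energy x * \<rho>0 x = (\<Sum>b\<in>Basis. (norm (D x b))\<^sup>2) * ((\<sigma> x)\<^sup>2 * \<rho> x)"
          using True by (simp add: energy_def \<rho>0_def \<rho>'_def)
        ultimately show ?thesis using True
          by (simp add: sum_gradient_norm[OF TD[OF True]])
      qed (simp add: \<rho>0_def)
    qed
    finally have 1: "k * (LINT x:\<Omega>|lborel. (\<Sum>i\<in>UNIV. (norm (gradient (\<lambda>y. T y $ i) x))\<^sup>2) * \<rho> x powr (1 - 2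
        / real CARD('d))) = A" .
    have 2: "(LINT x:\<Omega>|lborel. (LINT x':\<Omega>|lborel. 1 / (1 + (norm (T x - T x'))\<^sup>2) * \<rho> x * \<rho> x')) = I"
      unfolding I_def set_lebesgue_integral_def
    proof (rule Bochner_Integration.integral_cong[OF refl])
      fix x
      show "indicator \<Omega> x *\<^sub>R (\<integral>y. indicator \<Omega> y *\<^sub>R (1 / (1 + (norm (T x - T y))\<^sup>2) * \<rho> x * \<rho> y) \<partial>lborel)
          = (\<integral>y. \<phi> x y * \<rho>0 y \<partial>lborel) * \<rho>0 x"
      proof (cases "x \<in> \<Omega>")
        case True
        have "(\<integral>y. indicator \<Omega> y *\<^sub>R (1 / (1 + (norm (T x - T y))\<^sup>2) * \<rho> x * \<rho> y) \<partial>lborel)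
            = (\<integral>y. \<rho> x * (\<phi> x y * \<rho>0 y) \<partial>lborel)"
          using True by (intro Bochner_Integration.integral_cong)
              (auto simp: \<phi>_def T'_def \<rho>0_def \<rho>'_def indicator_def)
        then show ?thesis using True by (simp add: \<rho>0_def \<rho>'_def)
      qed (simp add: \<rho>0_def)
    qed
    show ?thesis unfolding KL_lim_def k_def[symmetric] 1 2 ..
  qed
  have growth: "filterlim (\<lambda>n. real n * h n ^ DIM(real^'d) / ln (real n)) at_top sequentially"
    using assms(12) by simp
  have "AE \<omega> in M. (\<lambda>n. (\<Sum>i=1..n. (\<Sum>j=1..n. kernel (h n) (X i \<omega>) (X j \<omega>) * logsq (h n) (X i \<omega>) (X j \<omega>)) /
      (\<Sum>j=1..n. kernel (h n) (X i \<omega>) (X j \<omega>))) / real n) \<longlonglongrightarrow> A"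
    unfolding A_def by (rule local_average_tendsto[OF _ assms(11) growth]) (rule assms(10))
  from this V_statistic_tendsto[OF \<phi>_meas \<phi>_bounds] AE_sample_in_domain
  show ?thesis
  proof eventually_elim
    case (elim \<omega>)
    let ?x = "\<lambda>i. X i \<omega>"
    have A_eq: "A_emp \<kappa> \<rho> (h n) ?x n T / (h n)\<^sup>2 =
      (\<Sum>i=1..n. (\<Sum>j=1..n. kernel (h n) (?x i) (?x j) * logsq (h n) (?x i) (?x j)) /
          (\<Sum>j=1..n. kernel (h n) (?x i) (?x j))) / real n" for n
    proof -
      have in_dom: "?x i \<in> \<Omega>" if "i \<in> {1..n}" for i using elim(3) that by simp
      have T_eq: "T (?x i) = T' (?x i)" if "i \<in> {1..n}" for i
        using in_dom[OF that] by (simp add: T'_def)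
      have sigma_eq: "sigma_kappa \<kappa> \<rho> (?x i) = \<sigma> (?x i)" if "i \<in> {1..n}" for i
        using in_dom[OF that] by (simp add: \<sigma>_def sigma_kappa_def \<rho>'_def)
      have weight_eq: "gauss_weight \<kappa> \<rho> (h n) (?x i) (?x j) = kernel (h n) (?x i) (?x j)"
        if "i \<in> {1..n}" "j \<in> {1..n}" for i j
        using in_dom[OF that(1)] in_dom[OF that(2)]
        by (simp add: gauss_weight_def kernel_def gauss_def sigma_eq[OF that(1)])
      have swap: "u / v / z = u / z / v" for u v z :: real by (simp add: mult.commute)
      have ratio_eq: "(\<Sum>j=1..n. gauss_weight \<kappa> \<rho> (h n) (?x i) (?x j) * ln (1 + (norm (T (?x i)
          - T (?x j)))\<^sup>2)) /
          (\<Sum>j=1..n. gauss_weight \<kappa> \<rho> (h n) (?x i) (?x j)) / (h n)\<^sup>2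
        = (\<Sum>j=1..n. kernel (h n) (?x i) (?x j) * logsq (h n) (?x i) (?x j)) /
            (\<Sum>j=1..n. kernel (h n) (?x i) (?x j))"
        if i: "i \<in> {1..n}" for i
      proof -
        have den: "(\<Sum>j=1..n. gauss_weight \<kappa> \<rho> (h n) (?x i) (?x j)) = (\<Sum>j=1..n. kernel (h n) (?x i) (?x j))"
          using weight_eq[OF i] by (intro sum.cong) auto
        have num: "(\<Sum>j=1..n. gauss_weight \<kappa> \<rho> (h n) (?x i) (?x j) * ln (1 + (norm (T (?x i) - T (?x j)))\<^sup>2))
            / (h n)\<^sup>2 =
           (\<Sum>j=1..n. kernel (h n) (?x i) (?x j) * logsq (h n) (?x i) (?x j))"
          unfolding sum_divide_distrib logsq_def using weight_eq[OF i] T_eq[OF i] T_eq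
          by (intro sum.cong) auto
        show ?thesis by (subst swap) (simp only: num den)
      qed
      have "A_emp \<kappa> \<rho> (h n) ?x n T / (h n)\<^sup>2 =
        (\<Sum>i=1..n. (\<Sum>j=1..n. gauss_weight \<kappa> \<rho> (h n) (?x i) (?x j) * ln (1 + (norm (T (?x i) - T (?x j)))\<^sup>2)) /
          (\<Sum>j=1..n. gauss_weight \<kappa> \<rho> (h n) (?x i) (?x j)) / (h n)\<^sup>2) / real n"
        unfolding A_emp_def sum_divide_distrib[symmetric] by (subst swap) simp
      also have "\<dots> = (\<Sum>i=1..n. (\<Sum>j=1..n. kernel (h n) (?x i) (?x j) * logsq (h n) (?x i) (?x j)) /
          (\<Sum>j=1..n. kernel (h n) (?x i) (?x j))) / real n"
        by (rule arg_cong[where f="\<lambda>u. u / real n"], rule sum.cong[OF refl ratio_eq])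
      finally show ?thesis .
    qed
    have R_eq: "R_emp ?x n T = ln (1 / (real n)\<^sup>2 * (\<Sum>i=1..n. \<Sum>j=1..n. \<phi> (?x i) (?x j)))" for n
      unfolding R_emp_def \<phi>_def using elim(3) by (simp add: T'_def)
    have "(\<lambda>n. KL_emp \<kappa> \<rho> (h n) ?x n T) \<longlonglongrightarrow> A + ln I"
      unfolding KL_emp_def A_eq R_eq
      by (intro tendsto_add tendsto_ln) (use elim(1,2) I_pos in \<open>simp_all add: I_def\<close>)
    then show ?case by (simp add: KL)
  qed
qed

end
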